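(* Let $a<b$, $A,B$ be real numbers and let $L\in C([a,b]\times\mathbb{R}\times\mathbb{R})$ satisfy: (i) for each compact $G\subset[a,b]\times\mathbb{R}\times\mathbb{R}$ there exist $C>0$ and $\alpha>0$ such that $|L(x_1,u_1,v_1)-L(x_2,u_2,v_2)|\le C(|x_1-x_2|+|u_1-u_2|+|v_1-v_2|)^{\alpha}$ for all $(x_1,u_1,v_1),(x_2,u_2,v_2)\in G$; (ii) $L_{vv}\in C([a,b]\times\mathbb{R}\times\mathbb{R})$ and there exists $\mu>0$ such that $L_{vv}\ge\mu$ everywhere. Let $f,g\in C^1([a,b])$ with $f<g$, and suppose that $$\lim_{\varepsilon\to0}\int_0^{e\varepsilon}\big[\omega_h(\xi+\gamma\sqrt{\xi})\big]^{\theta}\frac{d\xi}{\xi}=0\quad\text{for all }h\in\{f,f',g,g'\}\text{ and all }\gamma,\theta>0,$$ where $\omega_h:[0,\infty[\to[0,\infty[$ is the modulus of continuity of $h$. Then every minimizer of $\mathcal{J}_L(\cdot;[a,b])$ over $\mathcal{A}_{f,g}$, i.e. every $u\in\mathcal{A}_{f,g}$ with $\mathcal{J}_L(u;[a,b])\le\mathcal{J}_L(v;[a,b])$ for all $v\in\mathcal{A}_{f,g}$, has Tonelli's partial regularity.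
   Context: $e$ is Napier's number. $L=L(x,u,v)$; $L_{vv}$ is the second partial derivative in $v$. Functions in $W^{1,1}([a,b])$ are identified with their absolutely continuous representatives. $\mathcal{J}_L(u;[a,b]):=\int_a^bL(x,u(x),u'(x))\,dx$ and $$\mathcal{A}_{f,g}:=\{u\in W^{1,1}([a,b]):u(a)=A,\ u(b)=B,\ f\le u\le g\}.$$ The modulus of continuity of $h\in C([a,b])$ is $\omega_h(\varepsilon)=\sup\{|h(x)-h(y)|:x,y\in[a,b],\ |x-y|\le\varepsilon\}$. Tonelli's partial regularity. For $u\in W^{1,1}([a,b])$ let $\Omega_u:=\{x\in[a,b]:u\text{ is differentiable at }x\}$ (finite derivative, one-sided at $a$ and $b$). $u$ has Tonelli's partial regularity if: $\Omega_u$ is an open subset of $[a,b]$; $[a,b]\setminus\Omega_u=\{x\in[a,b]:u'(x)=-\infty\text{ or }u'(x)=\infty\}$; and $u'\in C([a,b];[-\infty,\infty])$. *)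

theory Defs
  imports "HOL-Analysis.Analysis"
begin

text \<open>
  All notions on \<open>[a,b]\<close> are formulated for total functions \<open>real \<Rightarrow> real\<close> but depend only on
  their restrictions to \<open>{a..b}\<close>; derivatives at the endpoints are one-sided.
\<close>

definition derivI :: "real \<Rightarrow> real \<Rightarrow> (real \<Rightarrow> real) \<Rightarrow> real \<Rightarrow> real" where
  "derivI a b u x = vector_derivative u (at x within {a..b})"

definition C1_on :: "real \<Rightarrow> real \<Rightarrow> (real \<Rightarrow> real) \<Rightarrow> bool" where
  "C1_on a b f \<longleftrightarrow>
     (\<forall>x\<in>{a..b}. f differentiable (at x within {a..b})) \<and> continuous_on {a..b} (derivI a b f)"

definition abs_cont_on :: "real \<Rightarrow> real \<Rightarrow> (real \<Rightarrow> real) \<Rightarrow> bool" where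
  "abs_cont_on a b u \<longleftrightarrow>
     (\<forall>\<epsilon>>0. \<exists>\<delta>>0. \<forall>(n::nat) s t.
        (\<forall>i<n. a \<le> s i \<and> s i \<le> t i \<and> t i \<le> b) \<longrightarrow>
        (\<forall>i<n. \<forall>j<n. i \<noteq> j \<longrightarrow> {s i<..<t i} \<inter> {s j<..<t j} = {}) \<longrightarrow>
        (\<Sum>i<n. t i - s i) < \<delta> \<longrightarrow>
        (\<Sum>i<n. \<bar>u (t i) - u (s i)\<bar>) < \<epsilon>)"

text \<open>Test functions for weak derivatives: \<open>C\<^sup>1\<close> functions with compact support in \<open>]a,b[\<close>.\<close>

definition test_fun :: "real \<Rightarrow> real \<Rightarrow> (real \<Rightarrow> real) \<Rightarrow> bool" where
  "test_fun a b \<phi> \<longleftrightarrow>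
     (\<forall>x. \<phi> differentiable (at x)) \<and> continuous_on UNIV (deriv \<phi>) \<and>
     (\<exists>K. compact K \<and> K \<subseteq> {a<..<b} \<and> (\<forall>x. x \<notin> K \<longrightarrow> \<phi> x = 0))"

definition weak_deriv :: "real \<Rightarrow> real \<Rightarrow> (real \<Rightarrow> real) \<Rightarrow> (real \<Rightarrow> real) \<Rightarrow> bool" where
  "weak_deriv a b u w \<longleftrightarrow>
     (\<forall>\<phi>. test_fun a b \<phi> \<longrightarrow>
        (LINT x|lebesgue_on {a..b}. u x * deriv \<phi> x) = - (LINT x|lebesgue_on {a..b}. w x * \<phi> x))"

text \<open>
  The Sobolev space \<open>W\<^sup>1\<^sup>,\<^sup>1([a,b])\<close>; each class is identified with its absolutely
  continuous representative.
\<close>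

definition W11 :: "real \<Rightarrow> real \<Rightarrow> (real \<Rightarrow> real) set" where
  "W11 a b = {u. abs_cont_on a b u \<and> integrable (lebesgue_on {a..b}) u \<and>
                 (\<exists>w. integrable (lebesgue_on {a..b}) w \<and> weak_deriv a b u w)}"

definition admissible ::
  "real \<Rightarrow> real \<Rightarrow> real \<Rightarrow> real \<Rightarrow> (real \<Rightarrow> real) \<Rightarrow> (real \<Rightarrow> real) \<Rightarrow> (real \<Rightarrow> real) set" where
  "admissible a b A B f g =
     {u \<in> W11 a b. u a = A \<and> u b = B \<and> (\<forall>x\<in>{a..b}. f x \<le> u x \<and> u x \<le> g x)}"

text \<open>
  \<open>\<integral> L(x,u(x),u'(x)) dx\<close> as an extended real: the integral of the positive part minus that of
  the negative part (\<open>ennreal\<close> sends negative reals to \<open>0\<close>).  For \<open>L\<close> continuous with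
  \<open>L\<^sub>v\<^sub>v \<ge> \<mu> > 0\<close> and \<open>u\<close> bounded, \<open>L(x,u(x),\<sqdot>)\<close> is bounded below uniformly in \<open>x\<close>, so the second
  term is finite and the value is never \<open>\<infinity> - \<infinity>\<close>.  The pointwise derivative of an absolutely
  continuous \<open>u\<close> exists almost everywhere; its junk values elsewhere do not matter.
\<close>

definition J :: "(real \<Rightarrow> real \<Rightarrow> real \<Rightarrow> real) \<Rightarrow> real \<Rightarrow> real \<Rightarrow> (real \<Rightarrow> real) \<Rightarrow> ereal" where
  "J L a b u =
     enn2ereal (\<integral>\<^sup>+x. ennreal (L x (u x) (derivI a b u x)) \<partial>lebesgue_on {a..b}) -
     enn2ereal (\<integral>\<^sup>+x. ennreal (- L x (u x) (derivI a b u x)) \<partial>lebesgue_on {a..b})"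

definition is_minimizer ::
  "(real \<Rightarrow> real \<Rightarrow> real \<Rightarrow> real) \<Rightarrow> real \<Rightarrow> real \<Rightarrow> (real \<Rightarrow> real) set \<Rightarrow> (real \<Rightarrow> real) \<Rightarrow> bool" where
  "is_minimizer L a b S u \<longleftrightarrow> u \<in> S \<and> (\<forall>v\<in>S. J L a b u \<le> J L a b v)"

definition L_vv :: "(real \<Rightarrow> real \<Rightarrow> real \<Rightarrow> real) \<Rightarrow> real \<Rightarrow> real \<Rightarrow> real \<Rightarrow> real" where
  "L_vv L x u v = deriv (deriv (L x u)) v"

definition L_vv_exists :: "(real \<Rightarrow> real \<Rightarrow> real \<Rightarrow> real) \<Rightarrow> real \<Rightarrow> real \<Rightarrow> bool" where
  "L_vv_exists L a b \<longleftrightarrow>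
     (\<forall>x\<in>{a..b}. \<forall>u v. L x u differentiable (at v) \<and> deriv (L x u) differentiable (at v))"

definition modulus :: "real \<Rightarrow> real \<Rightarrow> (real \<Rightarrow> real) \<Rightarrow> real \<Rightarrow> real" where
  "modulus a b h \<epsilon> = Sup {\<bar>h x - h y\<bar> | x y. x \<in> {a..b} \<and> y \<in> {a..b} \<and> \<bar>x - y\<bar> \<le> \<epsilon>}"

text \<open>The integral is taken in \<open>[0,\<infinity>]\<close>, so that divergence is not mistaken for the value \<open>0\<close>.\<close>

definition dini_condition :: "real \<Rightarrow> real \<Rightarrow> (real \<Rightarrow> real) \<Rightarrow> real \<Rightarrow> real \<Rightarrow> bool" where
  "dini_condition a b h \<gamma> \<theta> \<longleftrightarrow>
     ((\<lambda>\<epsilon>. \<integral>\<^sup>+\<xi>\<in>{0<..exp 1 * \<epsilon>}.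
           ennreal (modulus a b h (\<xi> + \<gamma> * sqrt \<xi>) powr \<theta> / \<xi>) \<partial>lborel)
        \<longlongrightarrow> 0) (at_right 0)"

definition has_ext_deriv ::
  "real \<Rightarrow> real \<Rightarrow> (real \<Rightarrow> real) \<Rightarrow> real \<Rightarrow> ereal \<Rightarrow> bool" where
  "has_ext_deriv a b u x l \<longleftrightarrow>
     ((\<lambda>y. ereal ((u y - u x) / (y - x))) \<longlongrightarrow> l) (at x within {a..b})"

definition ext_deriv :: "real \<Rightarrow> real \<Rightarrow> (real \<Rightarrow> real) \<Rightarrow> real \<Rightarrow> ereal" where
  "ext_deriv a b u x = Lim (at x within {a..b}) (\<lambda>y. ereal ((u y - u x) / (y - x)))"

definition diff_points :: "real \<Rightarrow> real \<Rightarrow> (real \<Rightarrow> real) \<Rightarrow> real set" where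
  "diff_points a b u = {x \<in> {a..b}. u differentiable (at x within {a..b})}"

text \<open>
  In \<open>tonelli_partial_regularity\<close> the second clause makes the extended derivative exist at every
  point of \<open>[a,b]\<close>, so the third clause never refers to a nonexistent limit.
\<close>

definition tonelli_partial_regularity :: "real \<Rightarrow> real \<Rightarrow> (real \<Rightarrow> real) \<Rightarrow> bool" where
  "tonelli_partial_regularity a b u \<longleftrightarrow>
     openin (top_of_set {a..b}) (diff_points a b u) \<and>
     {a..b} - diff_points a b u =
       {x \<in> {a..b}. has_ext_deriv a b u x (-\<infinity>) \<or> has_ext_deriv a b u x \<infinity>} \<and>
     continuous_on {a..b} (ext_deriv a b u)"

end

theory Submission
  imports Defs
begin

text \<open>
  Write \<open>slope u c d\<close> for the difference quotient of \<open>u\<close> over \<open>[c,d]\<close>.  Everything follows from a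
  rigidity property: on a short interval \<open>[c,d]\<close> whose slope is bounded by \<open>M\<close>, the slopes over all
  subintervals are uniformly close to \<open>slope u c d\<close>.  It implies that at each point the slopes over
  shrinking intervals converge in \<open>[-\<infinity>,\<infinity>]\<close>, and such a strict extended derivative is continuous.

  For the rigidity, compare \<open>u\<close> on \<open>[c,d]\<close> with the chord of \<open>u\<close> plus the difference \<open>h\<close> minus the
  chord of \<open>h\<close>, where \<open>h\<close> is the nearer of the obstacles \<open>f\<close> and \<open>g\<close>; this competitor is admissible
  and its derivative is within \<open>\<omega>(d - c)\<close> of \<open>slope u c d\<close>, where \<open>\<omega>\<close> is the sum of the moduli of continuity
  of \<open>f'\<close> and \<open>g'\<close>.  Uniform convexity and the Hoelder continuity of \<open>L\<close> and \<open>L\<^sub>v\<close> then bound the mean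
  of \<open>\<bar>u' - slope u c d\<bar>\<close> by a multiple of \<open>(d - c)\<^sup>\<beta> + \<omega>(d - c)\<close>.  Hence the slope changes by at most such an
  amount when the interval is halved, and the sum over all halvings is small: the power is geometric
  and the sum of \<open>\<omega>(l / 2\<^sup>i)\<close> is dominated by the Dini integral with \<open>\<theta> = 1\<close>.
\<close>

section \<open>Rigidity of slopes\<close>

text \<open>Adding \<open>h\<close> minus its chord reconciles the chord of \<open>u\<close> with
  the obstacle: the competitor minus \<open>h\<close> is the chord of \<open>u - h\<close>, so it
  keeps the sign of \<open>u - h\<close>, while on short intervals the other obstacle is out of
  reach. The integrand is frozen at \<open>(c, u c, slope u c d)\<close>. The difficulty is
  circular: the freezing error depends on the oscillation of \<open>u\<close> on
  \<open>[c,d]\<close>, which a bound on one slope does not control; it is bounded only through the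
  mean deviation \<open>m\<close> that is being estimated. Hoelder exponents at most
  \<open>1\<close> for \<open>L\<close> and \<open>1/2\<close> for \<open>L\<^sub>v\<close> make the
  squared error at most linear in \<open>m\<close>, so the quadratic gain from convexity absorbs it.
  The exponent for \<open>L\<^sub>v\<close> is half that for \<open>L\<close>, by interpolation with
  the bound on \<open>L\<^sub>v\<^sub>v\<close>. A second circularity: the estimate at each smaller
  scale again presupposes a slope bound. Summability keeps the accumulated change below
  \<open>1\<close>, so the bound \<open>M + 1\<close> serves for all scales.\<close>

definition slope :: "(real \<Rightarrow> real) \<Rightarrow> real \<Rightarrow> real \<Rightarrow> real" where
  "slope u c d = (u d - u c) / (d - c)"

text \<open>Nothing in this locale refers to the functional or to the obstacles: continuity and
  rigidity are all that the existence of strict extended derivatives takes from a minimizer.\<close>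

locale slope_rigid =
  fixes a b :: real and u :: "real \<Rightarrow> real"
  assumes ab: "a < b"
    and cont: "continuous_on {a..b} u"
    and rigid: "\<And>M \<delta>. 0 < \<delta> \<Longrightarrow> \<exists>\<epsilon>>0. \<forall>c d. a \<le> c \<longrightarrow> c < d \<longrightarrow> d \<le> b \<longrightarrow> d - c \<le> \<epsilon> \<longrightarrow>
       \<bar>slope u c d\<bar> \<le> M \<longrightarrow> (\<forall>x y. c \<le> x \<longrightarrow> x < y \<longrightarrow> y \<le> d \<longrightarrow> \<bar>slope u x y - slope u c d\<bar> \<le> \<delta>)"
begin

lemma continuous_on_slope:
  assumes "continuous_on S p" "continuous_on S q"
    and "\<And>t. t \<in> S \<Longrightarrow> a \<le> p t \<and> p t < q t \<and> q t \<le> b"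
  shows "continuous_on S (\<lambda>t. slope u (p t) (q t))"
proof -
  have "continuous_on S (\<lambda>t. u (p t))" "continuous_on S (\<lambda>t. u (q t))"
    using assms(3) by (auto intro!: continuous_on_compose2[OF cont] assms(1,2)) (smt (verit))+
  then show ?thesis
    unfolding slope_def using assms by (intro continuous_intros) force+
qed

text \<open>Endpoint pairs of nondegenerate intervals inside \<open>[a,b]\<close> form a convex set,
  so moving both endpoints linearly joins the two intervals through intervals of the same kind, and
  the slope is continuous along this path.\<close>

lemma slope_ivt:
  assumes "a \<le> c0" "c0 < d0" "d0 \<le> b" "a \<le> c1" "c1 < d1" "d1 \<le> b"
    and k: "(slope u c0 d0 \<le> k \<and> k \<le> slope u c1 d1) \<or> (slope u c1 d1 \<le> k \<and> k \<le> slope u c0 d0)"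
  obtains t where "0 \<le> t" "t \<le> 1"
    "slope u ((1-t) * c0 + t * c1) ((1-t) * d0 + t * d1) = k"
proof -
  let ?p = "\<lambda>t. (1-t) * c0 + t * c1" and ?q = "\<lambda>t. (1-t) * d0 + t * d1"
  have *: "a \<le> ?p t \<and> ?p t < ?q t \<and> ?q t \<le> b" if "t \<in> {0..1}" for t
  proof -
    have "?p t \<ge> (1-t) * a + t * a" "?q t \<le> (1-t) * b + t * b"
      using that assms by (intro add_mono mult_left_mono; auto)+
    moreover have "?p t < ?q t"
    proof (cases "t = 0")
      case False
      then have "t * c1 < t * d1" "(1-t) * c0 \<le> (1-t) * d0"
        using that assms by (auto intro: mult_left_mono)
      then show ?thesis by linarith
    qed (use assms in auto)
    ultimately show ?thesis by (auto simp: algebra_simps)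
  qed
  have "continuous_on {0..1} (\<lambda>t. slope u (?p t) (?q t))"
    by (intro continuous_on_slope continuous_intros *)
  then have "\<exists>t. 0 \<le> t \<and> t \<le> 1 \<and> slope u (?p t) (?q t) = k"
    using k IVT'[of "\<lambda>t. slope u (?p t) (?q t)" 0 k 1] IVT2'[of "\<lambda>t. slope u (?p t) (?q t)" 1 k 0]
    by auto
  then show ?thesis using that by blast
qed

text \<open>Rigidity on one short interval of bounded slope makes all nearby slopes agree up to
  \<open>\<delta>\<close>, provided that the interval contains a neighbourhood of \<open>x\<close>
  in \<open>[a,b]\<close>. As \<open>x\<close> may be an endpoint of it, the interval is widened a
  little, at the cost of the bound \<open>M + 1\<close>. Letting \<open>\<delta>\<close> shrink
  gives a Cauchy property.\<close>

lemma strict_derivative_finite: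
  assumes x: "x \<in> {a..b}"
    and M: "\<And>\<rho>. \<rho> > 0 \<Longrightarrow> \<exists>c d. a \<le> c \<and> c < d \<and> d \<le> b \<and> c \<le> x \<and> x \<le> d \<and> d - c < \<rho> \<and> \<bar>slope u c d\<bar> \<le> M"
  obtains l where "\<And>\<delta>. \<delta> > 0 \<Longrightarrow> \<exists>\<rho>>0. \<forall>c d. a \<le> c \<longrightarrow> c < d \<longrightarrow> d \<le> b \<longrightarrow> \<bar>c - x\<bar> < \<rho> \<longrightarrow> \<bar>d - x\<bar> < \<rho> \<longrightarrow>
      \<bar>slope u c d - l\<bar> < \<delta>"
proof -
  have claim: "\<exists>\<rho>>0. \<exists>m. \<forall>c d. a \<le> c \<longrightarrow> c < d \<longrightarrow> d \<le> b \<longrightarrow> \<bar>c - x\<bar> < \<rho> \<longrightarrow> \<bar>d - x\<bar> < \<rho> \<longrightarrow>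
      \<bar>slope u c d - m\<bar> \<le> \<delta>" if "\<delta> > 0" for \<delta>
  proof -
    from rigid[OF that, of "M+1"] obtain \<epsilon> where \<epsilon>: "\<epsilon> > 0" and
      R: "\<And>c d x y. a \<le> c \<Longrightarrow> c < d \<Longrightarrow> d \<le> b \<Longrightarrow> d - c \<le> \<epsilon> \<Longrightarrow> \<bar>slope u c d\<bar> \<le> M+1 \<Longrightarrow>
         c \<le> x \<Longrightarrow> x < y \<Longrightarrow> y \<le> d \<Longrightarrow> \<bar>slope u x y - slope u c d\<bar> \<le> \<delta>" by blast
    obtain c d where cd: "a \<le> c" "c < d" "d \<le> b" "c \<le> x" "x \<le> d" "d - c < \<epsilon>/2" "\<bar>slope u c d\<bar> \<le> M"
      using M[of "\<epsilon>/2"] \<epsilon> by auto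
    \<comment> \<open>Widening by \<open>s\<close> on both sides, clipped to \<open>[a,b]\<close>,
      changes the slope continuously, so a small positive \<open>s\<close> changes it by less than
      \<open>1\<close>.\<close>
    have "continuous_on {0..} (\<lambda>s. slope u (max a (c-s)) (min b (d+s)))"
      by (rule continuous_on_slope) (use cd in \<open>auto intro!: continuous_intros\<close>)
    then have "((\<lambda>s. slope u (max a (c-s)) (min b (d+s))) \<longlongrightarrow> slope u (max a (c-0)) (min b (d+0))) (at 0 within {0..})"
      unfolding continuous_on_def by (rule bspec) simp
    then have "((\<lambda>s. slope u (max a (c-s)) (min b (d+s))) \<longlongrightarrow> slope u c d) (at 0 within {0..})"
      using cd by auto
    then obtain r where r: "r > 0" "\<And>s. s \<in> {0..} \<Longrightarrow> s \<noteq> 0 \<Longrightarrow> dist s 0 < r \<Longrightarrow>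
       dist (slope u (max a (c-s)) (min b (d+s))) (slope u c d) < 1"
      unfolding tendsto_iff eventually_at by (metis zero_less_one)
    define s where "s = min (r/2) (\<epsilon>/4)"
    have s: "s > 0" "s < r" "s \<le> \<epsilon>/4" using r(1) \<epsilon> by (auto simp: s_def)
    let ?c = "max a (c-s)" and ?d = "min b (d+s)"
    have "\<bar>slope u ?c ?d\<bar> \<le> M + 1" using r(2)[of s] s cd by (auto simp: dist_real_def)
    then have "\<bar>slope u x' y - slope u ?c ?d\<bar> \<le> \<delta>" if "?c \<le> x'" "x' < y" "y \<le> ?d" for x' y
      using that s cd by (intro R) auto
    then have "\<forall>c d. a \<le> c \<longrightarrow> c < d \<longrightarrow> d \<le> b \<longrightarrow> \<bar>c - x\<bar> < s \<longrightarrow> \<bar>d - x\<bar> < s \<longrightarrow> \<bar>slope u c d - slope u ?c ?d\<bar> \<le> \<delta>"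
      using cd by auto
    then show ?thesis using s by blast
  qed
  \<comment> \<open>A fixed sequence of intervals that shrink to \<open>x\<close> and stay
    nondegenerate even at \<open>a\<close> and \<open>b\<close>; its slopes define the limit
    independently of \<open>\<delta>\<close>.\<close>
  define C where "C n = max a (x - 1 / real (Suc n))" for n
  define D where "D n = min b (x + 1 / real (Suc n))" for n
  have CD: "a \<le> C n" "C n < D n" "D n \<le> b" "\<bar>C n - x\<bar> \<le> 1/real (Suc n)" "\<bar>D n - x\<bar> \<le> 1/real (Suc n)" for n
  proof -
    have "1 / real (Suc n) > 0" by simp
    then show "a \<le> C n" "C n < D n" "D n \<le> b" "\<bar>C n - x\<bar> \<le> 1/real (Suc n)" "\<bar>D n - x\<bar> \<le> 1/real (Suc n)"
      using x ab unfolding C_def D_def atLeastAtMost_iff max_def min_def by (smt (verit))+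
  qed
  have claim2: "\<exists>\<rho>>0. \<exists>N. \<forall>n\<ge>N. \<forall>c d. a \<le> c \<longrightarrow> c < d \<longrightarrow> d \<le> b \<longrightarrow> \<bar>c - x\<bar> < \<rho> \<longrightarrow> \<bar>d - x\<bar> < \<rho> \<longrightarrow>
      \<bar>slope u c d - slope u (C n) (D n)\<bar> \<le> \<delta>" if "\<delta> > 0" for \<delta>
  proof -
    obtain \<rho> m where \<rho>: "\<rho> > 0" "\<forall>c d. a \<le> c \<longrightarrow> c < d \<longrightarrow> d \<le> b \<longrightarrow> \<bar>c - x\<bar> < \<rho> \<longrightarrow> \<bar>d - x\<bar> < \<rho> \<longrightarrow>
      \<bar>slope u c d - m\<bar> \<le> \<delta>/2" using claim[OF half_gt_zero[OF \<open>\<delta> > 0\<close>]] by blast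
    obtain N where N: "1 / real (Suc N) < \<rho>" using \<rho>(1) nat_approx_posE by blast
    have "\<bar>slope u c d - slope u (C n) (D n)\<bar> \<le> \<delta>"
      if n: "n \<ge> N" and "a \<le> c" "c < d" "d \<le> b" "\<bar>c - x\<bar> < \<rho>" "\<bar>d - x\<bar> < \<rho>" for n c d
    proof -
      have "1 / real (Suc n) \<le> 1 / real (Suc N)" using n by (auto simp: field_simps)
      then have "1 / real (Suc n) < \<rho>" using N by linarith
      then have "\<bar>slope u (C n) (D n) - m\<bar> \<le> \<delta>/2" using \<rho>(2) CD[of n] by auto
      moreover have "\<bar>slope u c d - m\<bar> \<le> \<delta>/2" using \<rho>(2) that by auto
      ultimately show ?thesis by linarith
    qed
    then show ?thesis using \<rho>(1) by blast
  qed
  let ?X = "\<lambda>n. slope u (C n) (D n)"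
  have "Cauchy ?X"
  proof (rule CauchyI')
    fix e :: real assume "e > 0"
    then obtain \<rho> N where \<rho>: "\<rho> > 0" "\<And>n c d. n \<ge> N \<Longrightarrow> a \<le> c \<Longrightarrow> c < d \<Longrightarrow> d \<le> b \<Longrightarrow> \<bar>c - x\<bar> < \<rho> \<Longrightarrow> \<bar>d - x\<bar> < \<rho> \<Longrightarrow>
      \<bar>slope u c d - slope u (C n) (D n)\<bar> \<le> e/2" using claim2[OF half_gt_zero[OF \<open>e > 0\<close>]] by blast
    obtain N' where N': "1 / real (Suc N') < \<rho>" using \<rho>(1) nat_approx_posE by blast
    have "dist (?X m) (?X n) < e" if "m \<ge> max N N'" "n > m" for m n
    proof -
      have "1 / real (Suc n) \<le> 1 / real (Suc N')" using that by (auto simp: field_simps)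
      then have "1 / real (Suc n) < \<rho>" using N' by linarith
      then have "\<bar>?X n - ?X m\<bar> \<le> e/2" using that CD[of n] by (intro \<rho>(2)) auto
      then show ?thesis using \<open>e > 0\<close> unfolding dist_real_def by linarith
    qed
    then show "\<exists>M. \<forall>m\<ge>M. \<forall>n>m. dist (?X m) (?X n) < e" by blast
  qed
  then obtain l where l: "?X \<longlonglongrightarrow> l" using convergent_eq_Cauchy convergent_def by blast
  show ?thesis
  proof (rule that[of l])
    fix \<delta> :: real assume "\<delta> > 0"
    then obtain \<rho> N where \<rho>: "\<rho> > 0" "\<And>n c d. n \<ge> N \<Longrightarrow> a \<le> c \<Longrightarrow> c < d \<Longrightarrow> d \<le> b \<Longrightarrow> \<bar>c - x\<bar> < \<rho> \<Longrightarrow> \<bar>d - x\<bar> < \<rho> \<Longrightarrow>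
      \<bar>slope u c d - slope u (C n) (D n)\<bar> \<le> \<delta>/2" using claim2[OF half_gt_zero[OF \<open>\<delta> > 0\<close>]] by blast
    have le: "\<bar>slope u c d - l\<bar> \<le> \<delta>/2" if "a \<le> c" "c < d" "d \<le> b" "\<bar>c - x\<bar> < \<rho>" "\<bar>d - x\<bar> < \<rho>" for c d
      by (rule tendsto_upperbound[where f="\<lambda>n. \<bar>slope u c d - ?X n\<bar>" and F=sequentially])
        (use that \<rho>(2) in \<open>auto intro!: tendsto_intros l eventually_sequentiallyI[of N]\<close>)
    show "\<exists>\<rho>>0. \<forall>c d. a \<le> c \<longrightarrow> c < d \<longrightarrow> d \<le> b \<longrightarrow> \<bar>c - x\<bar> < \<rho> \<longrightarrow> \<bar>d - x\<bar> < \<rho> \<longrightarrow>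
      \<bar>slope u c d - l\<bar> < \<delta>"
      by (intro exI[of _ \<rho>] conjI allI impI \<rho>(1) le_less_trans[OF le]) (use \<open>\<delta> > 0\<close> in auto)
  qed
qed

text \<open>Short intervals through \<open>x\<close> have slopes of a single sign, since deforming
  one into another of opposite sign would produce an interval through \<open>x\<close> of slope
  zero. For a nearby interval that may miss \<open>x\<close>, too small a signed slope is excluded
  by deforming it into its hull with \<open>x\<close>: an intermediate interval of prescribed slope
  appears, and rigidity inside it pins the slope of the original one.\<close>

lemma strict_derivative_infinite:
  assumes x: "x \<in> {a..b}"
    and M: "\<And>M. \<exists>\<rho>>0. \<forall>c d. a \<le> c \<longrightarrow> c < d \<longrightarrow> d \<le> b \<longrightarrow> c \<le> x \<longrightarrow> x \<le> d \<longrightarrow> d - c < \<rho> \<longrightarrow> \<bar>slope u c d\<bar> > M"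
  obtains s :: real where "\<bar>s\<bar> = 1"
    "\<And>M. \<exists>\<rho>>0. \<forall>c d. a \<le> c \<longrightarrow> c < d \<longrightarrow> d \<le> b \<longrightarrow> \<bar>c - x\<bar> < \<rho> \<longrightarrow> \<bar>d - x\<bar> < \<rho> \<longrightarrow> s * slope u c d > M"
proof -
  obtain \<rho>1 where \<rho>1: "\<rho>1 > 0" "\<And>c d. a \<le> c \<Longrightarrow> c < d \<Longrightarrow> d \<le> b \<Longrightarrow> c \<le> x \<Longrightarrow> x \<le> d \<Longrightarrow> d - c < \<rho>1 \<Longrightarrow> \<bar>slope u c d\<bar> > 0"
    using M[of 0] by blast
  define c0 d0 where "c0 = max a (x - \<rho>1/3)" and "d0 = min b (x + \<rho>1/3)"
  have cd0: "a \<le> c0" "c0 < d0" "d0 \<le> b" "c0 \<le> x" "x \<le> d0" "d0 - c0 < \<rho>1"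
    using x ab \<rho>1(1) unfolding c0_def d0_def by (auto simp: max_def min_def)
  define s where "s = sgn (slope u c0 d0)"
  have s: "\<bar>s\<bar> = 1" "s * s = 1" using \<rho>1(2)[of c0 d0] cd0 by (auto simp: s_def sgn_real_def)
  have pos: "s * slope u c d > 0" if cd: "a \<le> c" "c < d" "d \<le> b" "c \<le> x" "x \<le> d" "d - c < \<rho>1" for c d
  proof (rule ccontr)
    assume "\<not> ?thesis"
    then have "(slope u c0 d0 \<le> 0 \<and> 0 \<le> slope u c d) \<or> (slope u c d \<le> 0 \<and> 0 \<le> slope u c0 d0)"
      unfolding s_def by (auto simp: sgn_real_def split: if_splits)
    then obtain t where t: "0 \<le> t" "t \<le> 1" "slope u ((1-t) * c0 + t * c) ((1-t) * d0 + t * d) = 0"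
      by (rule slope_ivt[OF cd0(1-3) cd(1-3)])
    have m: "(1-t) * y0 + t * y \<le> (1-t) * z0 + t * z" if "y0 \<le> z0" "y \<le> z" for y0 y z0 z
      using that t by (intro add_mono mult_left_mono) auto
    have m': "(1-t) * y0 + t * y < (1-t) * z0 + t * z" if "y0 < z0" "y < z" for y0 y z0 z
    proof (cases "t = 0")
      case False
      then have "t * y < t * z" "(1-t) * y0 \<le> (1-t) * z0" using that t by (auto intro: mult_left_mono)
      then show ?thesis by linarith
    qed (use that in auto)
    have e: "(1-t) * y + t * y = y" for y by (simp add: algebra_simps)
    \<comment> \<open>Containing \<open>x\<close>, lying in \<open>[a,b]\<close> and being shorter
      than \<open>\<rho>1\<close> are convex conditions on the endpoints, so the intermediate
      interval inherits them.\<close>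
    have "\<bar>slope u ((1-t) * c0 + t * c) ((1-t) * d0 + t * d)\<bar> > 0"
    proof (rule \<rho>1(2))
      show "a \<le> (1-t) * c0 + t * c" using m[of a c0 a c] e cd cd0 by auto
      show "(1-t) * d0 + t * d \<le> b" using m[of d0 b d b] e cd cd0 by auto
      show "(1-t) * c0 + t * c \<le> x" using m[of c0 x c x] e cd cd0 by auto
      show "x \<le> (1-t) * d0 + t * d" using m[of x d0 x d] e cd cd0 by auto
      show "(1-t) * c0 + t * c < (1-t) * d0 + t * d" using m' cd cd0 by auto
      show "(1-t) * d0 + t * d - ((1-t) * c0 + t * c) < \<rho>1"
        using m'[of "d0 - c0" \<rho>1 "d - c" \<rho>1] e[of \<rho>1] cd cd0 by (simp add: algebra_simps)
    qed
    with t show False by simp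
  qed
  have "\<exists>\<rho>>0. \<forall>c d. a \<le> c \<longrightarrow> c < d \<longrightarrow> d \<le> b \<longrightarrow> \<bar>c - x\<bar> < \<rho> \<longrightarrow> \<bar>d - x\<bar> < \<rho> \<longrightarrow> s * slope u c d > M" for M
  proof -
    \<comment> \<open>The level \<open>K + 2\<close> lies between the value at most \<open>K\<close>
      assumed for contradiction and the value above \<open>K + 3\<close> on the hull, and its
      distance from \<open>K\<close> exceeds \<open>1\<close>, the tolerance with which rigidity is
      used.\<close>
    define K where "K = \<bar>M\<bar>"
    obtain \<epsilon> where \<epsilon>: "\<epsilon> > 0" and
      R: "\<And>c d x y. a \<le> c \<Longrightarrow> c < d \<Longrightarrow> d \<le> b \<Longrightarrow> d - c \<le> \<epsilon> \<Longrightarrow> \<bar>slope u c d\<bar> \<le> K+2 \<Longrightarrow>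
         c \<le> x \<Longrightarrow> x < y \<Longrightarrow> y \<le> d \<Longrightarrow> \<bar>slope u x y - slope u c d\<bar> \<le> 1"
      using rigid[of 1 "K+2"] by auto
    obtain \<rho>2 where \<rho>2: "\<rho>2 > 0" "\<And>c d. a \<le> c \<Longrightarrow> c < d \<Longrightarrow> d \<le> b \<Longrightarrow> c \<le> x \<Longrightarrow> x \<le> d \<Longrightarrow> d - c < \<rho>2 \<Longrightarrow> \<bar>slope u c d\<bar> > K+3"
      using M[of "K+3"] by blast
    \<comment> \<open>Halved because the hull of \<open>x\<close> and an interval with endpoints
      within \<open>\<rho>\<close> of \<open>x\<close> has length below
      \<open>2 * \<rho>\<close>.\<close>
    define \<rho> where "\<rho> = min \<rho>1 (min \<rho>2 \<epsilon>) / 2"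
    have \<rho>: "\<rho> > 0" "2 * \<rho> \<le> \<rho>1" "2 * \<rho> \<le> \<rho>2" "2 * \<rho> \<le> \<epsilon>" using \<rho>1 \<rho>2 \<epsilon> by (auto simp: \<rho>_def)
    have "s * slope u c d > M" if cd: "a \<le> c" "c < d" "d \<le> b" "\<bar>c - x\<bar> < \<rho>" "\<bar>d - x\<bar> < \<rho>" for c d
    proof (rule ccontr)
      assume "\<not> ?thesis"
      then have neg: "s * slope u c d \<le> K" by (auto simp: K_def)
      define c1 d1 where "c1 = min c x" and "d1 = max d x"
      have cd1: "a \<le> c1" "c1 < d1" "d1 \<le> b" "c1 \<le> x" "x \<le> d1" "d1 - c1 < 2 * \<rho>" "c1 \<le> c" "d \<le> d1"
        using x cd \<rho>(1) by (auto simp: c1_def d1_def min_def max_def)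
      have "s * slope u c1 d1 > 0" using pos cd1 \<rho> by auto
      moreover have "\<bar>s * slope u c1 d1\<bar> > K+3" using \<rho>2(2)[of c1 d1] cd1 \<rho> s by (auto simp: abs_mult)
      ultimately have big: "s * slope u c1 d1 > K + 3" by linarith
      have s1: "s = 1 \<or> s = -1" using s(1) by linarith
      then have "(slope u c d \<le> s * (K+2) \<and> s * (K+2) \<le> slope u c1 d1) \<or> (slope u c1 d1 \<le> s * (K+2) \<and> s * (K+2) \<le> slope u c d)"
        using neg big by auto
      then obtain t where t: "0 \<le> t" "t \<le> 1" "slope u ((1-t) * c + t * c1) ((1-t) * d + t * d1) = s * (K+2)"
        by (rule slope_ivt[OF cd(1-3) cd1(1-3)])
      define c2 d2 where "c2 = (1-t) * c + t * c1" and "d2 = (1-t) * d + t * d1"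
      have "c2 - c = t * (c1 - c)" "c2 - c1 = (1-t) * (c - c1)" "d2 - d = t * (d1 - d)" "d1 - d2 = (1-t) * (d1 - d)"
        by (simp_all add: c2_def d2_def algebra_simps)
      then have cd2: "c2 \<le> c" "c1 \<le> c2" "d \<le> d2" "d2 \<le> d1" using t cd1
        by (smt (verit) mult_nonneg_nonneg mult_nonneg_nonpos)+
      have "\<bar>slope u c d - slope u c2 d2\<bar> \<le> 1"
      proof (rule R)
        show "\<bar>slope u c2 d2\<bar> \<le> K+2" using t s by (simp add: c2_def d2_def abs_mult K_def)
      qed (use cd cd1 cd2 \<rho> in auto)
      then show False using t(3) neg s1 unfolding c2_def d2_def by auto
    qed
    then show ?thesis using \<rho>(1) by blast
  qed
  then show ?thesis using that s(1) by blast
qed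

lemma strict_derivative:
  assumes x: "x \<in> {a..b}"
  shows "\<exists>l::ereal. \<forall>V. open V \<longrightarrow> l \<in> V \<longrightarrow>
    (\<exists>\<rho>>0. \<forall>c d. a \<le> c \<longrightarrow> c < d \<longrightarrow> d \<le> b \<longrightarrow> \<bar>c - x\<bar> < \<rho> \<longrightarrow> \<bar>d - x\<bar> < \<rho> \<longrightarrow> ereal (slope u c d) \<in> V)"
proof (cases "\<exists>M. \<forall>\<rho>>0. \<exists>c d. a \<le> c \<and> c < d \<and> d \<le> b \<and> c \<le> x \<and> x \<le> d \<and> d - c < \<rho> \<and> \<bar>slope u c d\<bar> \<le> M")
  case True
  then obtain l where l: "\<And>\<delta>. \<delta> > 0 \<Longrightarrow> \<exists>\<rho>>0. \<forall>c d. a \<le> c \<longrightarrow> c < d \<longrightarrow> d \<le> b \<longrightarrow> \<bar>c - x\<bar> < \<rho> \<longrightarrow> \<bar>d - x\<bar> < \<rho> \<longrightarrow>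
      \<bar>slope u c d - l\<bar> < \<delta>"
    using strict_derivative_finite[OF x] by metis
  show ?thesis
  proof (intro exI[of _ "ereal l"] allI impI)
    fix V assume "open V" "ereal l \<in> V"
    then have "\<forall>\<^sub>F r in nhds l. ereal r \<in> V"
      using tendsto_ereal[OF filterlim_ident, of l] by (metis topological_tendstoD)
    then obtain e where "e > 0" "\<And>r. dist r l < e \<Longrightarrow> ereal r \<in> V"
      by (auto simp: eventually_nhds_metric)
    then show "\<exists>\<rho>>0. \<forall>c d. a \<le> c \<longrightarrow> c < d \<longrightarrow> d \<le> b \<longrightarrow> \<bar>c - x\<bar> < \<rho> \<longrightarrow> \<bar>d - x\<bar> < \<rho> \<longrightarrow> ereal (slope u c d) \<in> V"
      using l[of e] unfolding dist_real_def by blast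
  qed
next
  case False
  then have "\<And>M. \<exists>\<rho>>0. \<forall>c d. a \<le> c \<longrightarrow> c < d \<longrightarrow> d \<le> b \<longrightarrow> c \<le> x \<longrightarrow> x \<le> d \<longrightarrow> d - c < \<rho> \<longrightarrow> \<bar>slope u c d\<bar> > M"
    by (meson not_le)
  then obtain s :: real where s: "\<bar>s\<bar> = 1" 
    "\<And>M. \<exists>\<rho>>0. \<forall>c d. a \<le> c \<longrightarrow> c < d \<longrightarrow> d \<le> b \<longrightarrow> \<bar>c - x\<bar> < \<rho> \<longrightarrow> \<bar>d - x\<bar> < \<rho> \<longrightarrow> s * slope u c d > M"
    using strict_derivative_infinite[OF x] by metis
  show ?thesis
  \<comment> \<open>As \<open>s\<close> is a sign, the product is the infinity of that sign.\<close>
  proof (intro exI[of _ "ereal s * \<infinity>"] allI impI)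
    fix V assume V: "open V" "ereal s * \<infinity> \<in> V"
    have "s = 1 \<or> s = -1" using s(1) by linarith
    then obtain M where "\<And>r. s * r > M \<Longrightarrow> ereal r \<in> V"
    proof
      assume "s = 1"
      then show ?thesis using that V by (auto simp: open_PInfty)
          (metis greaterThan_iff less_ereal.simps(1) open_PInfty subsetD)
    next
      assume s1: "s = -1"
      then obtain M where M: "{..<ereal M} \<subseteq> V" using V open_MInfty by auto
      show ?thesis by (rule that[of "-M"]) (use M s1 in auto)
    qed
    then show "\<exists>\<rho>>0. \<forall>c d. a \<le> c \<longrightarrow> c < d \<longrightarrow> d \<le> b \<longrightarrow> \<bar>c - x\<bar> < \<rho> \<longrightarrow> \<bar>d - x\<bar> < \<rho> \<longrightarrow> ereal (slope u c d) \<in> V"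
      using s(2)[of M] by blast
  qed
qed

end

section \<open>Summation over dyadic scales\<close>

lemma enclosing_interval:
  fixes c d x y r :: real
  assumes "c \<le> x" "x < y" "y \<le> d" "y - x \<le> r" "r \<le> d - c"
  obtains x' y' where "c \<le> x'" "x' \<le> x" "y \<le> y'" "y' \<le> d" "y' - x' = r"
proof (cases "x + r \<le> d")
  case True
  then show ?thesis using that[of x "x + r"] assms by auto
next
  case False
  then show ?thesis using that[of "d - r" d] assms by auto
qed

text \<open>A subinterval of relative length at least \<open>1/2^(n+1)\<close> but below
  \<open>1/2^n\<close> is at least half of some subinterval of relative length exactly
  \<open>1/2^n\<close>. The one-step bound is therefore chained through nested intervals in
  arbitrary position, not only through the dyadic ones.\<close>

lemma rigid_if_one_step:
  assumes step: "\<And>M. \<exists>l0>0. \<exists>\<eta>. (\<forall>l>0. 0 \<le> \<eta> l) \<and>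
     (\<forall>c d x y. a \<le> c \<longrightarrow> c < d \<longrightarrow> d \<le> b \<longrightarrow> d - c \<le> l0 \<longrightarrow> \<bar>slope u c d\<bar> \<le> M \<longrightarrow>
        c \<le> x \<longrightarrow> x < y \<longrightarrow> y \<le> d \<longrightarrow> (d - c) / 2 \<le> y - x \<longrightarrow> \<bar>slope u x y - slope u c d\<bar> \<le> \<eta> (d - c)) \<and>
     (\<forall>\<delta>>0. \<exists>\<epsilon>>0. \<forall>l. 0 < l \<longrightarrow> l \<le> \<epsilon> \<longrightarrow> (\<forall>n. (\<Sum>i<n. \<eta> (l / 2^i)) \<le> \<delta>))"
    and "\<delta> > 0"
  shows "\<exists>\<epsilon>>0. \<forall>c d. a \<le> c \<longrightarrow> c < d \<longrightarrow> d \<le> b \<longrightarrow> d - c \<le> \<epsilon> \<longrightarrow>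
       \<bar>slope u c d\<bar> \<le> M \<longrightarrow> (\<forall>x y. c \<le> x \<longrightarrow> x < y \<longrightarrow> y \<le> d \<longrightarrow> \<bar>slope u x y - slope u c d\<bar> \<le> \<delta>)"
proof -
  obtain l0 \<eta> where l0: "l0 > 0" and \<eta>0: "\<And>l. l > 0 \<Longrightarrow> 0 \<le> \<eta> l" and
    \<eta>: "\<And>c d x y. a \<le> c \<Longrightarrow> c < d \<Longrightarrow> d \<le> b \<Longrightarrow> d - c \<le> l0 \<Longrightarrow> \<bar>slope u c d\<bar> \<le> M + 1 \<Longrightarrow>
        c \<le> x \<Longrightarrow> x < y \<Longrightarrow> y \<le> d \<Longrightarrow> (d - c) / 2 \<le> y - x \<Longrightarrow> \<bar>slope u x y - slope u c d\<bar> \<le> \<eta> (d - c)"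
    and sum: "\<And>\<delta>. \<delta> > 0 \<Longrightarrow> \<exists>\<epsilon>>0. \<forall>l. 0 < l \<longrightarrow> l \<le> \<epsilon> \<longrightarrow> (\<forall>n. (\<Sum>i<n. \<eta> (l / 2^i)) \<le> \<delta>)"
    using step[of "M+1"] by blast
  \<comment> \<open>The bound \<open>1\<close> keeps the slopes of all intermediate intervals within
    \<open>M + 1\<close>, the level for which the one-step estimate was obtained.\<close>
  obtain \<epsilon> where \<epsilon>: "\<epsilon> > 0" "\<And>l n. 0 < l \<Longrightarrow> l \<le> \<epsilon> \<Longrightarrow> (\<Sum>i<n. \<eta> (l / 2^i)) \<le> min \<delta> 1"
    using sum[of "min \<delta> 1"] \<open>\<delta> > 0\<close> by auto
  have main: "\<bar>slope u x y - slope u c d\<bar> \<le> (\<Sum>i<n. \<eta> ((d - c) / 2^i))"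
    if cd: "a \<le> c" "c < d" "d \<le> b" "d - c \<le> min l0 \<epsilon>" "\<bar>slope u c d\<bar> \<le> M"
      and "c \<le> x" "x < y" "y \<le> d" "(d - c) / 2^n \<le> y - x" for c d x y n
    using that(6-)
  proof (induction n arbitrary: x y)
    case 0
    then have "x = c" "y = d" by auto
    then show ?case by simp
  next
    case (Suc n)
    let ?r = "(d - c) / 2^n"
    have r: "?r > 0" "?r \<le> d - c" using cd divide_left_mono[of 1 "2^n" "d - c"] by auto
    have \<eta>r: "0 \<le> \<eta> ?r" using \<eta>0 r by auto
    show ?case
    proof (cases "?r \<le> y - x")
      case True
      then have "\<bar>slope u x y - slope u c d\<bar> \<le> (\<Sum>i<n. \<eta> ((d - c) / 2^i))" using Suc by auto
      then show ?thesis using \<eta>r by simp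
    next
      case False
      then obtain x' y' where xy: "c \<le> x'" "x' \<le> x" "y \<le> y'" "y' \<le> d" "y' - x' = ?r"
        using enclosing_interval[of c x y d ?r] Suc.prems r by auto
      have 1: "\<bar>slope u x' y' - slope u c d\<bar> \<le> (\<Sum>i<n. \<eta> ((d - c) / 2^i))" using xy Suc r by auto
      also have "\<dots> \<le> 1" using \<epsilon>(2)[of "d - c" n] cd by auto
      finally have "\<bar>slope u x' y'\<bar> \<le> M + 1" using cd by linarith
      then have "\<bar>slope u x y - slope u x' y'\<bar> \<le> \<eta> (y' - x')"
      proof (intro \<eta>)
        have "?r / 2 \<le> y - x" using Suc.prems(4) by (simp add: mult.commute)
        then show "(y' - x') / 2 \<le> y - x" using xy by simp
      qed (use xy cd Suc.prems r in linarith)+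
      then show ?thesis using 1 xy by simp
    qed
  qed
  show ?thesis
  proof (intro exI[of _ "min l0 \<epsilon>"] conjI allI impI)
    fix c d x y assume cd: "a \<le> c" "c < d" "d \<le> b" "d - c \<le> min l0 \<epsilon>" "\<bar>slope u c d\<bar> \<le> M"
      and xy: "c \<le> x" "x < y" "y \<le> d"
    obtain n where "(1/2)^n < (y - x) / (d - c)"
      using real_arch_pow_inv[of "(y - x) / (d - c)" "1/2"] cd xy by auto
    then have "(d - c) / 2^n \<le> y - x" using cd by (simp add: field_simps)
    then have "\<bar>slope u x y - slope u c d\<bar> \<le> (\<Sum>i<n. \<eta> ((d - c) / 2^i))" using main cd xy by blast
    also have "\<dots> \<le> \<delta>" using \<epsilon>(2)[of "d - c" n] cd by auto
    finally show "\<bar>slope u x y - slope u c d\<bar> \<le> \<delta>" .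
  qed (use l0 \<epsilon> in auto)
qed

text \<open>\<open>modulus\<close> is a real \<open>Sup\<close>, which obeys the usual order laws
  only for bounded sets; compactness of \<open>[a,b]\<close> bounds this one.\<close>

lemma bdd_above_modulus:
  fixes h :: "real \<Rightarrow> real"
  assumes "continuous_on {a..b} h"
  shows "bdd_above {\<bar>h x - h y\<bar> | x y. x \<in> {a..b} \<and> y \<in> {a..b} \<and> \<bar>x - y\<bar> \<le> \<epsilon>}"
proof -
  have "bounded (h ` {a..b})"
    using assms compact_imp_bounded compact_continuous_image compact_Icc by blast
  then obtain K where K: "\<And>x. x \<in> {a..b} \<Longrightarrow> \<bar>h x\<bar> \<le> K" unfolding bounded_iff real_norm_def by (metis imageI)
  show ?thesis
  proof (rule bdd_aboveI[of _ "2 * K"], clarify)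
    fix x y assume "x \<in> {a..b}" "y \<in> {a..b}"
    then show "\<bar>h x - h y\<bar> \<le> 2 * K" using K[of x] K[of y] by linarith
  qed
qed

lemma abs_diff_le_modulus:
  assumes "continuous_on {a..b} h" "x \<in> {a..b}" "y \<in> {a..b}" "\<bar>x - y\<bar> \<le> \<epsilon>"
  shows "\<bar>h x - h y\<bar> \<le> modulus a b h \<epsilon>"
  unfolding modulus_def using assms by (intro cSup_upper bdd_above_modulus) auto

lemma modulus_mono:
  assumes "continuous_on {a..b} h" "a \<le> b" "0 \<le> \<epsilon>" "\<epsilon> \<le> \<epsilon>'"
  shows "modulus a b h \<epsilon> \<le> modulus a b h \<epsilon>'"
  unfolding modulus_def
proof (rule cSup_subset_mono[OF _ bdd_above_modulus[OF assms(1)]])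
  show "{\<bar>h x - h y\<bar> |x y. x \<in> {a..b} \<and> y \<in> {a..b} \<and> \<bar>x - y\<bar> \<le> \<epsilon>} \<noteq> {}"
    using assms by (auto intro!: exI[of _ a])
  show "{\<bar>h x - h y\<bar> |x y. x \<in> {a..b} \<and> y \<in> {a..b} \<and> \<bar>x - y\<bar> \<le> \<epsilon>} \<subseteq>
      {\<bar>h x - h y\<bar> |x y. x \<in> {a..b} \<and> y \<in> {a..b} \<and> \<bar>x - y\<bar> \<le> \<epsilon>'}"
    using assms(4) order_trans by blast
qed

lemma modulus_nonneg:
  assumes "continuous_on {a..b} h" "a \<le> b" "0 \<le> \<epsilon>"
  shows "0 \<le> modulus a b h \<epsilon>"
  using abs_diff_le_modulus[OF assms(1), of a a \<epsilon>] assms by auto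

text \<open>On \<open>]l/2^i, 2l/2^i]\<close>, an interval of length \<open>l/2^i\<close>,
  monotonicity of the modulus bounds the integrand below by its value at \<open>l/2^i\<close>
  divided by \<open>2l/2^i\<close>, so the interval contributes at least half of the
  \<open>i\<close>-th modulus. These intervals are disjoint and lie in \<open>]0, 2l]\<close>, which
  is part of the domain of integration because \<open>2 \<le> exp 1\<close>.\<close>

lemma sum_modulus_le_integral:
  assumes h: "continuous_on {a..b} h" "a \<le> b" and l: "l > 0"
  shows "(\<Sum>i<n. ennreal (modulus a b h (l / 2^i) / 2)) \<le>
    (\<integral>\<^sup>+\<xi>\<in>{0<..exp 1 * l}. ennreal (modulus a b h (\<xi> + 1 * sqrt \<xi>) powr 1 / \<xi>) \<partial>lborel)"
proof -
  let ?m = "\<lambda>i::nat. modulus a b h (l / 2^i)"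
  let ?A = "\<lambda>i::nat. {l / 2^i <.. 2 * (l / 2^i)}"
  have m0: "0 \<le> ?m i" for i using modulus_nonneg h l by simp
  have disj: "\<xi> \<notin> ?A j" if "\<xi> \<in> ?A i" "i < j" for \<xi> i j
  proof -
    have "(2::real) ^ Suc i \<le> 2 ^ j" using that by (intro power_increasing) auto
    then have "2 * (l / 2 ^ j) \<le> l / 2 ^ i" using l by (simp add: field_simps)
    then show ?thesis using that by auto
  qed
  have "(\<Sum>i<n. ennreal (?m i / 2)) = (\<Sum>i<n. \<integral>\<^sup>+\<xi>. ennreal (?m i / (2 * (l / 2^i))) * indicator (?A i) \<xi> \<partial>lborel)"
  proof (rule sum.cong[OF refl])
    fix i
    show "ennreal (?m i / 2) = (\<integral>\<^sup>+\<xi>. ennreal (?m i / (2 * (l / 2^i))) * indicator (?A i) \<xi> \<partial>lborel)"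
    proof -
      have "emeasure lborel (?A i) = ennreal (l / 2^i)" using l by (subst emeasure_lborel_Ioc) (auto simp: field_simps)
      then show ?thesis using l m0[of i] by (simp add: nn_integral_cmult_indicator ennreal_mult'[symmetric] del: times_divide_eq_right)
    qed
  qed
  also have "\<dots> = (\<integral>\<^sup>+\<xi>. (\<Sum>i<n. ennreal (?m i / (2 * (l / 2^i))) * indicator (?A i) \<xi>) \<partial>lborel)"
    by (subst nn_integral_sum) auto
  also have "\<dots> \<le> (\<integral>\<^sup>+\<xi>\<in>{0<..exp 1 * l}. ennreal (modulus a b h (\<xi> + 1 * sqrt \<xi>) powr 1 / \<xi>) \<partial>lborel)"
  proof (rule nn_integral_mono)
    fix \<xi>
    show "(\<Sum>i<n. ennreal (?m i / (2 * (l / 2^i))) * indicator (?A i) \<xi>)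
       \<le> ennreal (modulus a b h (\<xi> + 1 * sqrt \<xi>) powr 1 / \<xi>) * indicator {0<..exp 1 * l} \<xi>"
    proof (cases "\<exists>k<n. \<xi> \<in> ?A k")
      case False
      then have "(\<Sum>i<n. ennreal (?m i / (2 * (l / 2^i))) * indicator (?A i) \<xi>) = 0"
        by (intro sum.neutral) auto
      then show ?thesis by (metis zero_le)
    next
      case True
      then obtain k where k: "k < n" "\<xi> \<in> ?A k" by blast
      have lk: "l / 2 ^ k > 0" "l / 2^k \<le> l" using l divide_left_mono[of 1 "2^k" l] by auto
      have e2: "2 \<le> exp (1::real)" using exp_ge_add_one_self[of 1] by simp
      have "2 * (l / 2 ^ k) \<le> exp 1 * l" using mult_mono[OF e2, of "l / 2^k" l] lk by auto
      then have \<xi>: "0 < \<xi>" "\<xi> \<le> exp 1 * l" using k lk by auto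
      have "(\<Sum>i<n. ennreal (?m i / (2 * (l / 2^i))) * indicator (?A i) \<xi>)
          = (\<Sum>i\<in>{k}. ennreal (?m i / (2 * (l / 2^i))) * indicator (?A i) \<xi>)"
      proof (rule sum.mono_neutral_right)
        show "\<forall>i\<in>{..<n} - {k}. ennreal (?m i / (2 * (l / 2^i))) * indicator (?A i) \<xi> = 0"
        proof
          fix i assume "i \<in> {..<n} - {k}"
          then have "\<xi> \<notin> ?A i" using disj[of \<xi> k i] disj[of \<xi> i k] k by (metis DiffE linorder_neqE_nat singletonI)
          then show "ennreal (?m i / (2 * (l / 2^i))) * indicator (?A i) \<xi> = 0" by simp
        qed
      qed (use k in auto)
      also have "\<dots> = ennreal (?m k / (2 * (l / 2^k)))" using k by simp
      also have "\<dots> \<le> ennreal (modulus a b h (\<xi> + 1 * sqrt \<xi>) powr 1 / \<xi>)"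
      proof (rule ennreal_leI)
        have "l / 2^k \<le> \<xi> + sqrt \<xi>" using k \<xi> by (smt (verit) greaterThanAtMost_iff real_sqrt_gt_zero)
        then have "?m k \<le> modulus a b h (\<xi> + sqrt \<xi>)" using modulus_mono[OF h, of "l / 2^k"] lk by auto
        then have "?m k / (2 * (l / 2^k)) \<le> modulus a b h (\<xi> + sqrt \<xi>) / \<xi>"
          using m0[of k] k \<xi> by (intro frac_le) auto
        moreover have "modulus a b h (\<xi> + sqrt \<xi>) \<ge> 0" using modulus_nonneg h \<xi> by auto
        ultimately show "?m k / (2 * (l / 2^k)) \<le> modulus a b h (\<xi> + 1 * sqrt \<xi>) powr 1 / \<xi>" by simp
      qed
      finally show ?thesis using \<xi> by simp
    qed
  qed
  finally show ?thesis .
qed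

lemma sum_modulus_small:
  assumes h: "continuous_on {a..b} h" "a \<le> b" and dini: "dini_condition a b h 1 1" and \<delta>: "\<delta> > 0"
  shows "\<exists>\<epsilon>>0. \<forall>l. 0 < l \<longrightarrow> l \<le> \<epsilon> \<longrightarrow> (\<forall>n. (\<Sum>i<n. modulus a b h (l / 2^i)) \<le> \<delta>)"
proof -
  have "\<forall>\<^sub>F l in at_right 0. (\<integral>\<^sup>+\<xi>\<in>{0<..exp 1 * l}. ennreal (modulus a b h (\<xi> + 1 * sqrt \<xi>) powr 1 / \<xi>) \<partial>lborel) < ennreal (\<delta> / 2)"
    using dini \<delta> unfolding dini_condition_def by (intro order_tendstoD(2)) auto
  then obtain e where e: "e > 0" "\<And>l. 0 < l \<Longrightarrow> l < e \<Longrightarrow> 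
     (\<integral>\<^sup>+\<xi>\<in>{0<..exp 1 * l}. ennreal (modulus a b h (\<xi> + 1 * sqrt \<xi>) powr 1 / \<xi>) \<partial>lborel) < ennreal (\<delta> / 2)"
    unfolding eventually_at_right_field by auto
  have "(\<Sum>i<n. modulus a b h (l / 2^i)) \<le> \<delta>" if "0 < l" "l \<le> e / 2" for l n
  proof -
    have "(\<Sum>i<n. ennreal (modulus a b h (l / 2^i) / 2)) \<le> ennreal (\<delta> / 2)"
      by (rule order_trans[OF sum_modulus_le_integral[OF h that(1)] less_imp_le[OF e(2)]]) (use that e(1) in simp_all)
    also have "(\<Sum>i<n. ennreal (modulus a b h (l / 2^i) / 2)) = ennreal (\<Sum>i<n. modulus a b h (l / 2^i) / 2)"
      using modulus_nonneg[OF h] that by (intro sum_ennreal) auto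
    finally have "(\<Sum>i<n. modulus a b h (l / 2^i) / 2) \<le> \<delta> / 2" using \<delta> by simp
    then show ?thesis by (simp add: sum_divide_distrib[symmetric])
  qed
  then show ?thesis using e(1) by (intro exI[of _ "e/2"]) auto
qed

lemma sum_powr_small:
  fixes \<beta> \<delta> :: real
  assumes \<beta>: "\<beta> > 0" and \<delta>: "\<delta> > 0"
  shows "\<exists>\<epsilon>>0. \<forall>l. 0 < l \<longrightarrow> l \<le> \<epsilon> \<longrightarrow> (\<forall>n. (\<Sum>i<n. (l / 2^i) powr \<beta>) \<le> \<delta>)"
proof -
  define q :: real where "q = 2 powr - \<beta>"
  have q: "0 < q" "q < 1" using \<beta> by (auto simp: q_def powr_less_one)
  \<comment> \<open>Chosen so that the geometric series with first term
    \<open>\<epsilon> powr \<beta>\<close> and ratio \<open>q\<close> has sum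
    \<open>\<delta>\<close>.\<close>
  define \<epsilon> where "\<epsilon> = (\<delta> * (1 - q)) powr (1 / \<beta>)"
  have \<epsilon>: "\<epsilon> > 0" using q \<delta> by (simp add: \<epsilon>_def)
  have "(\<Sum>i<n. (l / 2^i) powr \<beta>) \<le> \<delta>" if l: "0 < l" "l \<le> \<epsilon>" for l n
  proof -
    have eq: "(l / 2^i) powr \<beta> = l powr \<beta> * q ^ i" for i
    proof -
      have "(2^i) powr \<beta> = (2 powr \<beta>) ^ i"
        by (simp add: powr_realpow[symmetric] powr_powr mult.commute)
      moreover have "(l / 2^i) powr \<beta> = l powr \<beta> / (2^i) powr \<beta>" using l by (simp add: powr_divide)
      ultimately show ?thesis by (simp add: q_def powr_minus divide_inverse power_inverse)
    qed
    have "l powr \<beta> \<le> \<epsilon> powr \<beta>" using l \<beta> by (intro powr_mono2) auto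
    also have "\<dots> = \<delta> * (1 - q)" using \<beta> \<delta> q by (simp add: \<epsilon>_def powr_powr)
    finally have le: "l powr \<beta> \<le> \<delta> * (1 - q)" .
    have "(\<Sum>i<n. q ^ i) \<le> 1 / (1 - q)"
      using sum_le_suminf[of "\<lambda>i. q^i" "{..<n}"] q by (simp add: suminf_geometric)
    then have "l powr \<beta> * (\<Sum>i<n. q ^ i) \<le> \<delta> * (1 - q) * (1 / (1 - q))"
      using le q \<delta> by (intro mult_mono) (auto intro!: sum_nonneg)
    then show ?thesis using q by (simp add: eq sum_distrib_left)
  qed
  then show ?thesis using \<epsilon> by blast
qed

section \<open>Weak derivatives and absolutely continuous functions\<close>

definition tent :: "real \<Rightarrow> real" where
  "tent t = 4 * (max 0 t - 2 * max 0 (t - 1/2) + max 0 (t - 1))"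

text \<open>The primitive of \<open>tent\<close>, a hat on \<open>[0,1]\<close> whose peak
  \<open>2\<close> at \<open>1/2\<close> gives it unit integral. Truncated squares make it
  continuously differentiable, as \<open>test_fun\<close> demands.\<close>

definition smooth_step :: "real \<Rightarrow> real" where
  "smooth_step t = 2 * ((max 0 t)\<^sup>2 - 2 * (max 0 (t - 1/2))\<^sup>2 + (max 0 (t - 1))\<^sup>2)"

lemma max_0_squared_deriv: "((\<lambda>t::real. (max 0 t)\<^sup>2) has_field_derivative 2 * max 0 t) (at t)"
proof -
  consider "t > 0" | "t < 0" | "t = 0" by linarith
  then show ?thesis
  proof cases
    case 1
    have "((\<lambda>t::real. t\<^sup>2) has_field_derivative 2 * t) (at t)" by (auto intro!: derivative_eq_intros)
    then show ?thesis using 1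
      by (subst DERIV_cong_ev[OF refl _ refl, of _ "\<lambda>t. t\<^sup>2"]) (auto intro!: eventually_mono[OF eventually_nhds_in_open[of "{0<..}"]])
  next
    case 2
    then show ?thesis
      by (subst DERIV_cong_ev[OF refl _ refl, of _ "\<lambda>t. 0"]) (auto intro!: eventually_mono[OF eventually_nhds_in_open[of "{..<0}"]])
  next
    case 3
    have "((\<lambda>h::real. (max 0 h)\<^sup>2 / h) \<longlongrightarrow> 0) (at 0)"
    proof (rule Lim_null_comparison)
      show "\<forall>\<^sub>F h::real in at 0. norm ((max 0 h)\<^sup>2 / h) \<le> \<bar>h\<bar>"
        by (auto simp: eventually_at_filter max_def power2_eq_square)
      show "((\<lambda>h::real. \<bar>h\<bar>) \<longlongrightarrow> 0) (at 0)" by (rule tendsto_eq_intros refl)+ simp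
    qed
    then show ?thesis using 3 by (simp add: DERIV_def)
  qed
qed

lemma smooth_step_deriv: "(smooth_step has_field_derivative tent t) (at t)"
proof -
  have sh: "((\<lambda>t. (max 0 (t - c))\<^sup>2) has_field_derivative 2 * max 0 (t - c)) (at t)" for c :: real
  proof -
    have "((\<lambda>t. (max 0 (t - c))\<^sup>2) has_field_derivative (2 * max 0 (t - c)) * 1) (at t)"
      by (rule DERIV_chain2[where f="\<lambda>t. (max 0 t)\<^sup>2" and g="\<lambda>t. t - c"], rule max_0_squared_deriv)
        (auto intro!: derivative_eq_intros)
    then show ?thesis by simp
  qed
  show ?thesis
    unfolding smooth_step_def[abs_def] tent_def
    by (rule derivative_eq_intros max_0_squared_deriv sh refl)+ (simp add: algebra_simps)
qed

lemma smooth_step_values: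
  shows "t \<le> 0 \<Longrightarrow> smooth_step t = 0" "1 \<le> t \<Longrightarrow> smooth_step t = 1"
  unfolding smooth_step_def by (auto simp: max_def power2_eq_square algebra_simps)

lemma tent_nonneg: "0 \<le> tent t"
  unfolding tent_def by (auto simp: max_def)

lemma tent_outside: "t \<le> 0 \<or> 1 \<le> t \<Longrightarrow> tent t = 0"
  unfolding tent_def by (auto simp: max_def)

lemma continuous_on_tent [continuous_intros]:
  "continuous_on S f \<Longrightarrow> continuous_on S (\<lambda>x. tent (f x))"
  unfolding tent_def by (intro continuous_intros)

lemma scaled_step_deriv:
  "((\<lambda>x. smooth_step (n * (x - p))) has_field_derivative n * tent (n * (x - p))) (at x within S)"
proof -
  have "((\<lambda>x. smooth_step (n * (x - p))) has_field_derivative tent (n * (x - p)) * n) (at x)"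
    by (rule DERIV_chain2[OF smooth_step_deriv]) (auto intro!: derivative_eq_intros)
  then show ?thesis by (simp add: mult.commute has_field_derivative_at_within)
qed

text \<open>The kernel \<open>n * tent (n * (x - p))\<close> is nonnegative, has integral
  \<open>1\<close> and lives on \<open>[p, p + 1/n]\<close>, so integrating \<open>z\<close> against
  it averages values of \<open>z\<close> just to the right of \<open>p\<close>.\<close>

lemma bump_average:
  assumes n: "n > 0" and p: "a < p" "p + 1 / n < b" and z: "continuous_on {a..b} z"
    and \<eta>: "\<And>x. p \<le> x \<Longrightarrow> x \<le> p + 1 / n \<Longrightarrow> \<bar>z x - z p\<bar> \<le> \<eta>"
  shows "\<bar>integral {a..b} (\<lambda>x. z x * (n * tent (n * (x - p)))) - z p\<bar> \<le> \<eta>"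
proof -
  let ?k = "\<lambda>x. n * tent (n * (x - p))"
  have k: "continuous_on {a..b} ?k" by (intro continuous_intros)
  have "1 / n < b - p" using p by linarith
  then have "1 < n * (b - p)" using n by (simp add: field_simps)
  moreover have "n * (a - p) \<le> 0" using n p by (simp add: mult_nonneg_nonpos)
  moreover have "1 / n > 0" using n by simp
  then have ab: "a \<le> b" using p by linarith
  ultimately have hi: "(?k has_integral 1) {a..b}"
    using fundamental_theorem_of_calculus[of a b "\<lambda>x. smooth_step (n * (x - p))" ?k]
      scaled_step_deriv[of n p] smooth_step_values
    by (simp add: has_real_derivative_iff_has_vector_derivative[symmetric])
  have i1: "((\<lambda>x. z p * ?k x) has_integral z p * 1) {a..b}" using hi by (rule has_integral_mult_right)
  have i2: "(\<lambda>x. z x * ?k x) integrable_on {a..b}"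
    by (intro integrable_continuous_real continuous_intros z)
  have i3: "((\<lambda>x. z x * ?k x - z p * ?k x) has_integral (integral {a..b} (\<lambda>x. z x * ?k x) - z p)) {a..b}"
    using has_integral_diff[OF integrable_integral[OF i2] i1] by simp
  have "norm (integral {a..b} (\<lambda>x. z x * ?k x) - z p) \<le> integral {a..b} (\<lambda>x. \<eta> * ?k x)"
    unfolding integral_unique[OF i3, symmetric]
  proof (rule integral_norm_bound_integral)
    show "(\<lambda>x. \<eta> * ?k x) integrable_on {a..b}" by (intro integrable_continuous_real continuous_intros)
    show "(\<lambda>x. z x * ?k x - z p * ?k x) integrable_on {a..b}" using i3 by blast
    fix x
    have k0: "0 \<le> ?k x" using n tent_nonneg by simp
    show "norm (z x * ?k x - z p * ?k x) \<le> \<eta> * ?k x"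
    proof (cases "p \<le> x \<and> x \<le> p + 1/n")
      case True
      have "norm (z x * ?k x - z p * ?k x) = \<bar>z x - z p\<bar> * ?k x"
        by (simp only: left_diff_distrib[symmetric] real_norm_def abs_mult[of "z x - z p"] abs_of_nonneg[OF k0])
      also have "\<dots> \<le> \<eta> * ?k x" using \<eta> True k0 by (intro mult_right_mono) auto
      finally show ?thesis .
    next
      case False
      then have "n * (x - p) \<le> 0 \<or> 1 \<le> n * (x - p)"
      proof (cases "x < p")
        case False
        then have "1 / n \<le> x - p" using \<open>\<not> (p \<le> x \<and> x \<le> p + 1/n)\<close> by linarith
        then show ?thesis using n by (simp add: field_simps)
      qed (use n in \<open>simp add: mult_nonneg_nonpos\<close>)
      then show ?thesis using tent_outside by simp
    qed
  qed
  also have "\<dots> = \<eta>" using integral_unique[OF has_integral_mult_right[OF hi, of \<eta>]] by simp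
  finally show ?thesis by simp
qed

lemma test_fun_deriv:
  assumes "test_fun a b \<phi>"
  shows "(\<phi> has_field_derivative deriv \<phi> x) (at x)"
  using assms unfolding test_fun_def by (simp add: DERIV_deriv_iff_real_differentiable)

text \<open>The test function is a step up at \<open>p\<close> minus the same step up at
  \<open>q\<close>. Its derivative is a difference of two averaging kernels, so the averages of
  \<open>z\<close> next to \<open>p\<close> and next to \<open>q\<close> agree, and shrinking the
  kernels gives \<open>z p = z q\<close>. The steps have equal height, so the test function vanishes
  again to the right of both. Continuity carries the identity to \<open>a\<close> and
  \<open>b\<close>.\<close>

lemma constant_if_weak_deriv_zero:
  fixes z :: "real \<Rightarrow> real"
  assumes z: "continuous_on {a..b} z"
    and zero: "\<And>\<phi>. test_fun a b \<phi> \<Longrightarrow> integral {a..b} (\<lambda>x. z x * deriv \<phi> x) = 0"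
    and x: "x \<in> {a..b}" "y \<in> {a..b}"
  shows "z x = z y"
proof -
  have le: "\<bar>z p - z q\<bar> \<le> 2 * \<eta>" if pq: "a < p" "p < b" "a < q" "q < b" and \<eta>: "\<eta> > 0" for p q \<eta>
  proof -
    have "continuous (at r within {a..b}) z" if "r \<in> {p, q}" for r
      using z pq that by (auto simp: continuous_on_eq_continuous_within)
    then have "\<forall>r\<in>{p,q}. \<exists>d>0. \<forall>x\<in>{a..b}. dist x r < d \<longrightarrow> dist (z x) (z r) < \<eta>"
      using \<eta> unfolding continuous_within_eps_delta by blast
    then obtain dp dq where d: "dp > 0" "dq > 0" "\<And>x. x \<in> {a..b} \<Longrightarrow> dist x p < dp \<Longrightarrow> dist (z x) (z p) < \<eta>"
      "\<And>x. x \<in> {a..b} \<Longrightarrow> dist x q < dq \<Longrightarrow> dist (z x) (z q) < \<eta>" by auto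
    define m where "m = min (min dp dq) (min (b - p) (b - q)) / 2"
    have m: "m > 0" "m < dp" "m < dq" "p + m < b" "q + m < b" using d pq by (auto simp: m_def min_def field_simps)
    define n where "n = 1 / m"
    have n: "n > 0" "1 / n = m" using m by (auto simp: n_def)
    let ?k = "\<lambda>p x. n * tent (n * (x - p))"
    define \<phi> where "\<phi> x = smooth_step (n * (x - p)) - smooth_step (n * (x - q))" for x
    have D: "(\<phi> has_field_derivative (?k p x - ?k q x)) (at x)" for x
      unfolding \<phi>_def[abs_def] by (intro derivative_intros scaled_step_deriv)
    have dphi: "deriv \<phi> = (\<lambda>x. ?k p x - ?k q x)" using D DERIV_imp_deriv by blast
    have "test_fun a b \<phi>"
      unfolding test_fun_def
    proof (intro conjI allI)
      show "\<phi> differentiable (at x)" for x using D real_differentiable_def by blast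
      show "continuous_on UNIV (deriv \<phi>)" unfolding dphi by (intro continuous_intros)
      show "\<exists>K. compact K \<and> K \<subseteq> {a<..<b} \<and> (\<forall>x. x \<notin> K \<longrightarrow> \<phi> x = 0)"
      proof (intro exI[of _ "{min p q..max p q + m}"] conjI allI impI)
        fix x assume "x \<notin> {min p q..max p q + m}"
        then consider "x \<le> p" "x \<le> q" | "x - p \<ge> m" "x - q \<ge> m" by (auto simp: min_def max_def split: if_splits)
        then show "\<phi> x = 0"
        proof cases
          case 1
          then have "n * (x - p) \<le> 0" "n * (x - q) \<le> 0" using n by (auto simp: mult_nonneg_nonpos)
          then show ?thesis using smooth_step_values by (simp add: \<phi>_def)
        next
          case 2
          then have "1 \<le> n * (x - p)" "1 \<le> n * (x - q)" using n m by (auto simp: n_def field_simps)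
          then show ?thesis using smooth_step_values by (simp add: \<phi>_def)
        qed
      qed (use pq m in auto)
    qed
    then have "integral {a..b} (\<lambda>x. z x * (?k p x - ?k q x)) = 0" using zero dphi by metis
    moreover have "integral {a..b} (\<lambda>x. z x * (?k p x - ?k q x)) =
      integral {a..b} (\<lambda>x. z x * ?k p x) - integral {a..b} (\<lambda>x. z x * ?k q x)"
      unfolding right_diff_distrib by (intro Henstock_Kurzweil_Integration.integral_diff integrable_continuous_real continuous_intros z)
    moreover have "\<bar>integral {a..b} (\<lambda>x. z x * ?k p x) - z p\<bar> \<le> \<eta>"
      using pq m n d(3) by (intro bump_average z) (force simp: dist_real_def intro: less_imp_le)+
    moreover have "\<bar>integral {a..b} (\<lambda>x. z x * ?k q x) - z q\<bar> \<le> \<eta>"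
      using pq m n d(4) by (intro bump_average z) (force simp: dist_real_def intro: less_imp_le)+
    ultimately show ?thesis by linarith
  qed
  have inner: "z p = z q" if "a < p" "p < b" "a < q" "q < b" for p q
  proof (rule ccontr)
    assume "z p \<noteq> z q"
    then show False using le[OF that, of "\<bar>z p - z q\<bar> / 4"] by simp
  qed
  show ?thesis
  proof (cases "a < b")
    case True
    then have cl: "closure {a<..<b} = {a..b}" by simp
    let ?m = "(a + b) / 2"
    have "z t = z ?m" if "t \<in> {a..b}" for t
    proof (rule continuous_constant_on_closure[of "{a<..<b}" z])
      show "z s = z ?m" if "s \<in> {a<..<b}" for s using that True by (intro inner) auto
    qed (use z cl that in simp_all)
    then show ?thesis using x by metis
  next
    case False
    then have "x = y" using x by auto
    then show ?thesis by simp
  qed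
qed

section \<open>Primitives of integrable functions\<close>

lemma integral_indefinite_diff:
  fixes w :: "real \<Rightarrow> real"
  assumes "w integrable_on {a..b}" "a \<le> x" "x \<le> y" "y \<le> b"
  shows "integral {a..y} w - integral {a..x} w = integral {x..y} w"
proof -
  have "w integrable_on {a..y}" by (rule integrable_subinterval_real[OF assms(1)]) (use assms in auto)
  then show ?thesis using Henstock_Kurzweil_Integration.integral_combine[where a=a and c=x and b=y and f=w] assms by simp
qed

lemma integration_by_parts_indefinite:
  fixes w v \<phi> \<phi>' :: "real \<Rightarrow> real"
  assumes ab: "a \<le> b" and w: "w absolutely_integrable_on {a..b}"
    and v: "\<And>x. x \<in> {a..b} \<Longrightarrow> v x = v a + integral {a..x} w"
    and \<phi>: "\<And>x. x \<in> {a..b} \<Longrightarrow> (\<phi> has_field_derivative \<phi>' x) (at x within {a..b})"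
    and \<phi>': "continuous_on {a..b} \<phi>'"
  shows "((\<lambda>x. w x * \<phi> x + v x * \<phi>' x) has_integral (v b * \<phi> b - v a * \<phi> a)) {a..b}"
proof -
  let ?f = "\<lambda>x. w x * \<phi> x + v x * \<phi>' x"
  let ?F = "\<lambda>x. integral {a..x} (\<lambda>t. \<bar>w t\<bar>)"
  define P where "P x = v x * \<phi> x - integral {a..x} ?f" for x
  have wi: "w integrable_on {a..b}" and awi: "(\<lambda>t. \<bar>w t\<bar>) integrable_on {a..b}"
    using w unfolding absolutely_integrable_on_def by auto
  have c\<phi>: "continuous_on {a..b} \<phi>"
    using \<phi> by (meson DERIV_continuous_on)
  have cv: "continuous_on {a..b} v"
    by (rule continuous_on_eq[of _ "\<lambda>x. v a + integral {a..x} w"])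
      (auto intro!: continuous_intros indefinite_integral_continuous_1 wi v[symmetric])
  have wg: "(\<lambda>x. w x * g x) integrable_on {a..b}" if "continuous_on {a..b} g" for g
  proof -
    have "(\<lambda>x. g x * w x) absolutely_integrable_on {a..b}"
      using that w by (intro absolutely_integrable_bounded_measurable_product_real
          continuous_imp_measurable_on_sets_lebesgue compact_imp_bounded compact_continuous_image) auto
    then show ?thesis by (simp add: absolutely_integrable_on_def mult.commute)
  qed
  have fi: "?f integrable_on {a..b}"
    by (intro integrable_add wg c\<phi> integrable_continuous_real continuous_intros cv \<phi>')
  obtain K where K: "K \<ge> 0" "\<And>x. x \<in> {a..b} \<Longrightarrow> \<bar>\<phi>' x\<bar> \<le> K"
  proof -
    have "bounded (\<phi>' ` {a..b})" by (intro compact_imp_bounded compact_continuous_image \<phi>') auto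
    then obtain K where "\<forall>x\<in>{a..b}. \<bar>\<phi>' x\<bar> \<le> K" unfolding bounded_iff by auto
    then show ?thesis using that[of "max K 0"] by fastforce
  qed
  have key: "\<bar>P y - P x\<bar> \<le> 2 * K * (y - x) * (?F y - ?F x)" if xy: "a \<le> x" "x \<le> y" "y \<le> b" for x y
  proof -
    have sub: "{x..y} \<subseteq> {a..b}" using xy by auto
    note isub = integrable_subinterval_real[OF _ sub]
    let ?A = "integral {x..y} (\<lambda>t. \<bar>w t\<bar>)"
    have \<phi>i: "(\<phi>' has_integral (\<phi> y - \<phi> x)) {x..y}"
      using xy sub by (intro fundamental_theorem_of_calculus)
        (auto simp: has_real_derivative_iff_has_vector_derivative[symmetric] intro!: DERIV_subset[OF \<phi>])
    have vy: "v t - v x = integral {x..t} w" if "x \<le> t" "t \<le> y" for t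
      using integral_indefinite_diff[OF wi, of x t] v[of x] v[of t] xy that by simp
    \<comment> \<open>Freezing \<open>\<phi>\<close> at \<open>y\<close> and \<open>v\<close> at
      \<open>x\<close> gives an integrand whose integral is exactly
      \<open>v y * \<phi> y - v x * \<phi> x\<close>. Each of the two freezing errors is at most
      \<open>K * (y - x)\<close> times the integral of \<open>\<bar>w\<bar>\<close>, whence the
      factor \<open>2\<close>.\<close>
    have "(?f has_integral integral {x..y} ?f) {x..y}" using isub[OF fi] by blast
    moreover have "((\<lambda>t. w t * \<phi> y) has_integral (v y - v x) * \<phi> y) {x..y}"
      using has_integral_mult_left[OF integrable_integral[OF isub[OF wi]], of "\<phi> y"] vy[of y] xy by simp
    moreover have "((\<lambda>t. v x * \<phi>' t) has_integral v x * (\<phi> y - \<phi> x)) {x..y}"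
      using \<phi>i by (rule has_integral_mult_right)
    ultimately have "((\<lambda>t. (w t * \<phi> y + v x * \<phi>' t) - ?f t) has_integral
       ((v y - v x) * \<phi> y + v x * (\<phi> y - \<phi> x)) - integral {x..y} ?f) {x..y}"
      by (intro has_integral_diff has_integral_add)
    moreover have "((v y - v x) * \<phi> y + v x * (\<phi> y - \<phi> x)) - integral {x..y} ?f = P y - P x"
      using integral_indefinite_diff[OF fi xy] unfolding P_def by (simp add: algebra_simps)
    ultimately have Pi: "((\<lambda>t. (w t * \<phi> y + v x * \<phi>' t) - ?f t) has_integral (P y - P x)) {x..y}" by simp
    have "norm (P y - P x) \<le> integral {x..y} (\<lambda>t. \<bar>w t\<bar> * (K * (y - x)) + ?A * K)"
      unfolding integral_unique[OF Pi, symmetric]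
    proof (rule integral_norm_bound_integral)
      show "(\<lambda>t. \<bar>w t\<bar> * (K * (y - x)) + ?A * K) integrable_on {x..y}"
        by (intro integrable_add integrable_on_mult_left isub[OF awi] integrable_const_ivl)
      show "(\<lambda>t. (w t * \<phi> y + v x * \<phi>' t) - ?f t) integrable_on {x..y}" using Pi by blast
      fix t assume t: "t \<in> {x..y}"
      have "((\<phi>') has_integral (\<phi> y - \<phi> t)) {t..y}"
        using xy sub t by (intro fundamental_theorem_of_calculus)
          (auto simp: has_real_derivative_iff_has_vector_derivative[symmetric] intro!: DERIV_subset[OF \<phi>])
      then have "norm (\<phi> y - \<phi> t) \<le> K * (y - t)"
        using has_integral_bound_real[OF K(1), of "{}" \<phi>' "\<phi> y - \<phi> t" t y] K(2) t xy by auto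
      also have "\<dots> \<le> K * (y - x)" using t K by (intro mult_left_mono) auto
      finally have 1: "\<bar>\<phi> y - \<phi> t\<bar> \<le> K * (y - x)" by simp
      have "\<bar>v t - v x\<bar> \<le> integral {x..t} (\<lambda>t. \<bar>w t\<bar>)"
      proof -
        have sub': "{x..t} \<subseteq> {a..b}" using xy t by auto
        show ?thesis using vy[of t] t integral_norm_bound_integral[of w "{x..t}" "\<lambda>t. \<bar>w t\<bar>"]
          integrable_subinterval_real[OF wi sub'] integrable_subinterval_real[OF awi sub'] by simp
      qed
      also have "\<dots> \<le> ?A"
        using t xy by (intro integral_subset_le integrable_subinterval_real[OF awi]) auto
      finally have 2: "\<bar>v t - v x\<bar> \<le> ?A" .
      have "(w t * \<phi> y + v x * \<phi>' t) - ?f t = w t * (\<phi> y - \<phi> t) - (v t - v x) * \<phi>' t" by (simp add: algebra_simps)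
      then have "norm ((w t * \<phi> y + v x * \<phi>' t) - ?f t) \<le> \<bar>w t\<bar> * \<bar>\<phi> y - \<phi> t\<bar> + \<bar>v t - v x\<bar> * \<bar>\<phi>' t\<bar>"
        using abs_triangle_ineq4[of "w t * (\<phi> y - \<phi> t)" "(v t - v x) * \<phi>' t"] by (simp add: abs_mult)
      also have "\<dots> \<le> \<bar>w t\<bar> * (K * (y - x)) + ?A * K"
        using 1 2 K(2)[of t] t xy by (intro add_mono mult_mono) auto
      finally show "norm ((w t * \<phi> y + v x * \<phi>' t) - ?f t) \<le> \<bar>w t\<bar> * (K * (y - x)) + ?A * K" .
    qed
    also have "\<dots> = ?A * (K * (y - x)) + (y - x) * (?A * K)"
      using xy by (subst Henstock_Kurzweil_Integration.integral_add) (auto intro!: integrable_on_mult_left isub[OF awi])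
    also have "\<dots> = 2 * K * (y - x) * (?F y - ?F x)"
      using integral_indefinite_diff[OF awi xy] by (simp add: algebra_simps)
    finally show ?thesis by simp
  qed
  have cF: "continuous_on {a..b} ?F" by (rule indefinite_integral_continuous_1[OF awi])
  have "(P has_field_derivative 0) (at x within {a..b})" if x: "x \<in> {a..b}" for x
    unfolding has_field_derivative_iff
  proof (rule Lim_null_comparison)
    show "((\<lambda>y. 2 * K * \<bar>?F y - ?F x\<bar>) \<longlongrightarrow> 0) (at x within {a..b})"
      using cF x by (intro tendsto_eq_intros) (auto simp: continuous_on_def intro!: tendsto_eq_intros)
    have "norm ((P y - P x) / (y - x)) \<le> 2 * K * \<bar>?F y - ?F x\<bar>" if y: "y \<in> {a..b}" "y \<noteq> x" for y
    proof -
      have "\<bar>P y - P x\<bar> \<le> 2 * K * \<bar>y - x\<bar> * \<bar>?F y - ?F x\<bar>"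
      proof (cases "x \<le> y")
        case True
        then have "2 * K * (y - x) * (?F y - ?F x) \<le> 2 * K * \<bar>y - x\<bar> * \<bar>?F y - ?F x\<bar>"
          using K True by (subst abs_of_nonneg[of "y - x"]) (auto intro!: mult_left_mono)
        then show ?thesis using key[of x y] True x y by auto
      next
        case False
        then have "2 * K * (x - y) * (?F x - ?F y) \<le> 2 * K * \<bar>y - x\<bar> * \<bar>?F y - ?F x\<bar>"
          using K False by (subst abs_minus_commute[of y x], subst abs_minus_commute[of "?F y"], subst abs_of_nonneg[of "x - y"])
            (auto intro!: mult_left_mono)
        then show ?thesis using key[of y x] False x y by auto
      qed
      then show ?thesis using y by (simp add: field_simps abs_divide)
    qed
    then show "\<forall>\<^sub>F y in at x within {a..b}. norm ((P y - P x) / (y - x)) \<le> 2 * K * \<bar>?F y - ?F x\<bar>"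
      by (auto simp: eventually_at_filter)
  qed
  then obtain c where "\<forall>x\<in>{a..b}. P x = c"
    using has_field_derivative_zero_constant[of "{a..b}" P] by auto
  then have "P b = P a" using ab by auto
  then have "integral {a..b} ?f = v b * \<phi> b - v a * \<phi> a" unfolding P_def by simp
  then show ?thesis using fi by (metis integrable_integral)
qed

text \<open>Truncating \<open>\<bar>w\<bar>\<close> at a height \<open>k\<close> leaves a remainder
  of small integral, by dominated convergence. The truncated part contributes at most
  \<open>k\<close> times the total length, the remainder at most its whole integral because the
  intervals do not overlap.\<close>

lemma abs_cont_on_indefinite_integral:
  fixes w v :: "real \<Rightarrow> real"
  assumes w: "w absolutely_integrable_on {a..b}"
    and v: "\<And>x. x \<in> {a..b} \<Longrightarrow> v x = v a + integral {a..x} w"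
  shows "abs_cont_on a b v"
  unfolding abs_cont_on_def
proof (intro allI impI)
  fix \<epsilon> :: real assume \<epsilon>: "\<epsilon> > 0"
  have wi: "w integrable_on {a..b}" and awi: "(\<lambda>t. \<bar>w t\<bar>) integrable_on {a..b}"
    using w unfolding absolutely_integrable_on_def by auto
  let ?g = "\<lambda>k::nat. \<lambda>t. min \<bar>w t\<bar> (real k)"
  have gi: "?g k integrable_on {a..b}" for k
  proof -
    have "?g k absolutely_integrable_on {a..b}"
      by (rule absolutely_integrable_min_1) (use set_integrable_abs[OF w] in auto)
    then show ?thesis by (simp add: absolutely_integrable_on_def)
  qed
  have "(\<lambda>k. integral {a..b} (?g k)) \<longlonglongrightarrow> integral {a..b} (\<lambda>t. \<bar>w t\<bar>)"
  proof (rule dominated_convergence(2)[OF gi awi])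
    fix x
    have "\<forall>\<^sub>F k in sequentially. \<bar>w x\<bar> \<le> real k"
      using filterlim_real_sequentially by (auto simp: filterlim_at_top)
    then have "\<forall>\<^sub>F k in sequentially. ?g k x = \<bar>w x\<bar>" by (auto elim!: eventually_mono)
    then show "(\<lambda>k. ?g k x) \<longlonglongrightarrow> \<bar>w x\<bar>" by (rule tendsto_eventually)
  qed auto
  then have "\<forall>\<^sub>F k in sequentially. dist (integral {a..b} (?g k)) (integral {a..b} (\<lambda>t. \<bar>w t\<bar>)) < \<epsilon>/2"
    using \<epsilon> by (intro tendstoD) auto
  then obtain k where k: "\<bar>integral {a..b} (?g k) - integral {a..b} (\<lambda>t. \<bar>w t\<bar>)\<bar> < \<epsilon>/2"
    by (auto simp: eventually_sequentially dist_real_def)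
  let ?h = "\<lambda>t. \<bar>w t\<bar> - ?g k t"
  have hi: "?h integrable_on {a..b}" by (intro integrable_diff awi gi)
  have h0: "0 \<le> ?h t" for t by auto
  have hsmall: "integral {a..b} ?h < \<epsilon>/2"
    using k Henstock_Kurzweil_Integration.integral_diff[OF awi gi[of k]] by linarith
  \<comment> \<open>The witness divides by \<open>k + 1\<close> rather than \<open>k\<close> to
    cover \<open>k = 0\<close>.\<close>
  show "\<exists>\<delta>>0. \<forall>(n::nat) s t. (\<forall>i<n. a \<le> s i \<and> s i \<le> t i \<and> t i \<le> b) \<longrightarrow>
        (\<forall>i<n. \<forall>j<n. i \<noteq> j \<longrightarrow> {s i<..<t i} \<inter> {s j<..<t j} = {}) \<longrightarrow>
        (\<Sum>i<n. t i - s i) < \<delta> \<longrightarrow> (\<Sum>i<n. \<bar>v (t i) - v (s i)\<bar>) < \<epsilon>"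
  proof (intro exI[of _ "\<epsilon> / 2 / (real k + 1)"] conjI allI impI)
    fix n :: nat and s t :: "nat \<Rightarrow> real"
    assume st: "\<forall>i<n. a \<le> s i \<and> s i \<le> t i \<and> t i \<le> b"
      and disj: "\<forall>i<n. \<forall>j<n. i \<noteq> j \<longrightarrow> {s i<..<t i} \<inter> {s j<..<t j} = {}"
      and small: "(\<Sum>i<n. t i - s i) < \<epsilon> / 2 / (real k + 1)"
    let ?r = "\<lambda>i x. if x \<in> {s i<..<t i} then ?h x else 0"
    have one: "\<bar>v (t i) - v (s i)\<bar> \<le> integral {a..b} (?r i) + real k * (t i - s i)" if i: "i < n" for i
    proof -
      have sub: "{s i..t i} \<subseteq> {a..b}" and sti: "a \<le> s i" "s i \<le> t i" "t i \<le> b" using st i by auto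
      note isub = integrable_subinterval_real[OF _ sub]
      have "v (t i) - v (s i) = integral {s i..t i} w"
        using integral_indefinite_diff[OF wi sti] v[of "t i"] v[of "s i"] sti by simp
      also have "norm \<dots> \<le> integral {s i..t i} (\<lambda>x. ?h x + real k)"
        by (intro integral_norm_bound_integral isub[OF wi] integrable_add isub[OF hi] integrable_const_ivl) auto
      also have "\<dots> = integral {s i..t i} ?h + real k * (t i - s i)"
        using sti by (subst Henstock_Kurzweil_Integration.integral_add) (auto intro!: isub[OF hi])
      \<comment> \<open>Only the open intervals are assumed disjoint; the endpoints carry no
        integral.\<close>
      also have "integral {s i..t i} ?h = integral {s i<..<t i} ?h"
        by (metis integral_open_interval_real)
      also have "\<dots> = integral {a..b} (?r i)"
      proof -
        have "{s i<..<t i} \<inter> {a..b} = {s i<..<t i}" using sti by auto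
        then show ?thesis using Henstock_Kurzweil_Integration.integral_restrict_Int[where T="{a..b}" and S="{s i<..<t i}" and f="?h"] by metis
      qed
      finally show ?thesis by simp
    qed
    have ri: "?r i integrable_on {a..b}" if i: "i < n" for i
    proof -
      have "{s i<..<t i} \<inter> {a..b} = {s i<..<t i}" using st i by auto
      moreover have "?h integrable_on {s i<..<t i}"
        using integrable_subinterval_real[OF hi, of "s i" "t i"] st i
        by (simp add: integrable_on_open_interval_real)
      ultimately show ?thesis using integrable_restrict_Int[where T="{a..b}" and S="{s i<..<t i}" and f="?h"] by metis
    qed
    have "(\<Sum>i<n. integral {a..b} (?r i)) = integral {a..b} (\<lambda>x. \<Sum>i<n. ?r i x)"
      using ri by (intro integral_sum[symmetric]) auto
    also have "\<dots> \<le> integral {a..b} ?h"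
    proof (rule integral_le)
      fix x
      show "(\<Sum>i<n. ?r i x) \<le> ?h x"
      proof (cases "\<exists>j<n. x \<in> {s j<..<t j}")
        case True
        then obtain j where j: "j < n" "x \<in> {s j<..<t j}" by blast
        have "(\<Sum>i<n. ?r i x) = (\<Sum>i\<in>{j}. ?r i x)"
        proof (rule sum.mono_neutral_right)
          show "\<forall>i\<in>{..<n} - {j}. ?r i x = 0" 
          proof
            fix i assume "i \<in> {..<n} - {j}"
            then have "{s i<..<t i} \<inter> {s j<..<t j} = {}" using disj j by simp
            then have "x \<notin> {s i<..<t i}" using j by blast
            then show "?r i x = 0" by (rule if_not_P)
          qed
        qed (use j in auto)
        then show ?thesis using j by simp
      next
        case False
        then have "(\<Sum>i<n. ?r i x) = 0" by (intro sum.neutral) auto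
        then show ?thesis using h0[of x] by linarith
      qed
    qed (use ri in \<open>auto intro!: integrable_sum hi\<close>)
    finally have A: "(\<Sum>i<n. integral {a..b} (?r i)) < \<epsilon>/2" using hsmall by linarith
    have "0 \<le> (\<Sum>i<n. t i - s i)" using st by (intro sum_nonneg) auto
    then have "real k * (\<Sum>i<n. t i - s i) \<le> (real k + 1) * (\<Sum>i<n. t i - s i)" by (simp add: mult_right_mono)
    also have "\<dots> < \<epsilon>/2" using small by (simp add: field_simps)
    finally have B: "real k * (\<Sum>i<n. t i - s i) < \<epsilon>/2" .
    have "(\<Sum>i<n. \<bar>v (t i) - v (s i)\<bar>) \<le> (\<Sum>i<n. integral {a..b} (?r i) + real k * (t i - s i))"
      using one by (intro sum_mono) auto
    also have "\<dots> = (\<Sum>i<n. integral {a..b} (?r i)) + real k * (\<Sum>i<n. t i - s i)"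
      by (simp add: sum.distrib sum_distrib_left)
    finally show "(\<Sum>i<n. \<bar>v (t i) - v (s i)\<bar>) < \<epsilon>" using A B by linarith
  qed (use \<epsilon> in auto)
qed

lemma at_within_Icc_neq_bot:
  fixes x :: real
  assumes "a < b" "x \<in> {a..b}"
  shows "at x within {a..b} \<noteq> bot"
  using assms connected_imp_perfect[of "{a..b}" x] by (auto simp: trivial_limit_within)

lemma integrable_lebesgue_on_iff_absolutely_integrable:
  fixes w :: "real \<Rightarrow> real"
  shows "integrable (lebesgue_on {a..b}) w \<longleftrightarrow> w absolutely_integrable_on {a..b}"
  by (simp add: integrable_restrict_space set_integrable_def)

text \<open>The boundary terms vanish since the support of \<open>\<phi>\<close> lies in the open
  interval. The integrability claim allows gauge and Lebesgue integrals of the product to be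
  exchanged.\<close>

lemma weak_deriv_indefinite_integral:
  fixes w v :: "real \<Rightarrow> real"
  assumes ab: "a \<le> b" and w: "w absolutely_integrable_on {a..b}"
    and v: "\<And>x. x \<in> {a..b} \<Longrightarrow> v x = v a + integral {a..x} w"
    and \<phi>: "test_fun a b \<phi>"
  shows "integral {a..b} (\<lambda>x. v x * deriv \<phi> x) = - integral {a..b} (\<lambda>x. w x * \<phi> x)"
    and "(\<lambda>x. w x * \<phi> x) absolutely_integrable_on {a..b}"
proof -
  have wi: "w integrable_on {a..b}" using w unfolding absolutely_integrable_on_def by auto
  have d\<phi>: "continuous_on {a..b} (deriv \<phi>)" using \<phi> unfolding test_fun_def by (meson continuous_on_subset subset_UNIV)
  have D: "(\<phi> has_field_derivative deriv \<phi> x) (at x within S)" for x S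
    using test_fun_deriv[OF \<phi>] has_field_derivative_at_within by blast
  have c\<phi>: "continuous_on {a..b} \<phi>" using D by (meson DERIV_continuous_on)
  have zero: "\<phi> a = 0" "\<phi> b = 0" using \<phi> unfolding test_fun_def by (metis greaterThanLessThan_iff less_irrefl subsetD)+
  have cv: "continuous_on {a..b} v"
    by (rule continuous_on_eq[of _ "\<lambda>x. v a + integral {a..x} w"])
      (auto intro!: continuous_intros indefinite_integral_continuous_1 wi v[symmetric])
  have "(\<lambda>x. \<phi> x * w x) absolutely_integrable_on {a..b}"
    using c\<phi> w by (intro absolutely_integrable_bounded_measurable_product_real
        continuous_imp_measurable_on_sets_lebesgue compact_imp_bounded compact_continuous_image) auto
  then show wp: "(\<lambda>x. w x * \<phi> x) absolutely_integrable_on {a..b}" by (simp add: mult.commute)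
  have "((\<lambda>x. w x * \<phi> x + v x * deriv \<phi> x) has_integral (v b * \<phi> b - v a * \<phi> a)) {a..b}"
    by (intro integration_by_parts_indefinite[OF ab w v] D d\<phi>)
  then have "integral {a..b} (\<lambda>x. w x * \<phi> x + v x * deriv \<phi> x) = 0" using zero by (simp add: integral_unique)
  moreover have "integral {a..b} (\<lambda>x. w x * \<phi> x + v x * deriv \<phi> x) =
     integral {a..b} (\<lambda>x. w x * \<phi> x) + integral {a..b} (\<lambda>x. v x * deriv \<phi> x)"
  proof (rule Henstock_Kurzweil_Integration.integral_add)
    show "(\<lambda>x. w x * \<phi> x) integrable_on {a..b}" using wp by (simp add: absolutely_integrable_on_def)
  qed (intro integrable_continuous_real continuous_intros cv d\<phi>)
  ultimately show "integral {a..b} (\<lambda>x. v x * deriv \<phi> x) = - integral {a..b} (\<lambda>x. w x * \<phi> x)" by simp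
qed

text \<open>Supplies the Sobolev regularity of competitors, which are always given together with an
  integrable derivative.\<close>

lemma indefinite_integral_in_W11:
  fixes w v :: "real \<Rightarrow> real"
  assumes ab: "a \<le> b" and w: "w absolutely_integrable_on {a..b}"
    and v: "\<And>x. x \<in> {a..b} \<Longrightarrow> v x = v a + integral {a..x} w"
  shows "v \<in> W11 a b"
proof -
  have wi: "w integrable_on {a..b}" using w unfolding absolutely_integrable_on_def by auto
  have cv: "continuous_on {a..b} v"
    by (rule continuous_on_eq[of _ "\<lambda>x. v a + integral {a..x} w"])
      (auto intro!: continuous_intros indefinite_integral_continuous_1 wi v[symmetric])
  have "weak_deriv a b v w"
    unfolding weak_deriv_def
  proof (intro allI impI)
    fix \<phi> assume \<phi>: "test_fun a b \<phi>"
    have d\<phi>: "continuous_on {a..b} (deriv \<phi>)" using \<phi> unfolding test_fun_def by (meson continuous_on_subset subset_UNIV)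
    note * = weak_deriv_indefinite_integral[OF ab w v \<phi>]
    have "(LINT x|lebesgue_on {a..b}. v x * deriv \<phi> x) = integral {a..b} (\<lambda>x. v x * deriv \<phi> x)"
      by (intro lebesgue_integral_eq_integral continuous_imp_integrable_real continuous_intros cv d\<phi>) auto
    moreover have "(LINT x|lebesgue_on {a..b}. w x * \<phi> x) = integral {a..b} (\<lambda>x. w x * \<phi> x)"
      by (intro lebesgue_integral_eq_integral absolutely_integrable_imp_integrable *(2)) auto
    ultimately show "(LINT x|lebesgue_on {a..b}. v x * deriv \<phi> x) = - (LINT x|lebesgue_on {a..b}. w x * \<phi> x)"
      using *(1) by simp
  qed
  then show ?thesis
    unfolding W11_def using abs_cont_on_indefinite_integral[OF w v] continuous_imp_integrable_real[OF cv] w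
    by (auto simp: integrable_lebesgue_on_iff_absolutely_integrable)
qed

lemma abs_cont_on_imp_continuous_on:
  assumes "abs_cont_on a b u"
  shows "continuous_on {a..b} u"
  unfolding continuous_on_iff
proof (intro ballI allI impI)
  fix x \<epsilon> :: real assume x: "x \<in> {a..b}" and "\<epsilon> > 0"
  then obtain \<delta> where \<delta>: "\<delta> > 0" "\<And>(n::nat) s t. (\<forall>i<n. a \<le> s i \<and> s i \<le> t i \<and> t i \<le> b) \<Longrightarrow>
        (\<forall>i<n. \<forall>j<n. i \<noteq> j \<longrightarrow> {s i<..<t i} \<inter> {s j<..<t j} = {}) \<Longrightarrow>
        (\<Sum>i<n. t i - s i) < \<delta> \<Longrightarrow> (\<Sum>i<n. \<bar>u (t i) - u (s i)\<bar>) < \<epsilon>"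
    using assms unfolding abs_cont_on_def by meson
  have "dist (u y) (u x) < \<epsilon>" if "y \<in> {a..b}" "dist y x < \<delta>" for y
    using \<delta>(2)[of 1 "\<lambda>_. min x y" "\<lambda>_. max x y"] x that by (cases "x \<le> y") (auto simp: dist_real_def)
  then show "\<exists>d>0. \<forall>x'\<in>{a..b}. dist x' x < d \<longrightarrow> dist (u x') (u x) < \<epsilon>" using \<delta>(1) by blast
qed

text \<open>A primitive of a weak derivative \<open>w\<close> of \<open>u\<close> again has weak
  derivative \<open>w\<close>, so its difference from \<open>u\<close> has weak derivative zero and
  is constant.\<close>

lemma W11_indefinite_integral:
  assumes ab: "a \<le> b" and u: "u \<in> W11 a b"
  obtains w where "w absolutely_integrable_on {a..b}" "\<And>x. x \<in> {a..b} \<Longrightarrow> u x = u a + integral {a..x} w"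
proof -
  obtain w where w: "w absolutely_integrable_on {a..b}" and wd: "weak_deriv a b u w"
    using u by (auto simp: W11_def integrable_lebesgue_on_iff_absolutely_integrable)
  have cu: "continuous_on {a..b} u" using u abs_cont_on_imp_continuous_on by (auto simp: W11_def)
  define U where "U x = integral {a..x} w" for x
  have U: "U x = U a + integral {a..x} w" for x by (simp add: U_def)
  have wi: "w integrable_on {a..b}" using w unfolding absolutely_integrable_on_def by auto
  have cU: "continuous_on {a..b} U" unfolding U_def[abs_def] by (rule indefinite_integral_continuous_1[OF wi])
  let ?z = "\<lambda>x. u x - U x"
  have "?z x = ?z a" if "x \<in> {a..b}" for x
  proof (rule constant_if_weak_deriv_zero[where z="?z" and a=a and b=b])
    show "continuous_on {a..b} ?z" by (intro continuous_intros cu cU)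
    show "x \<in> {a..b}" "a \<in> {a..b}" using that ab by auto
    fix \<phi> assume \<phi>: "test_fun a b \<phi>"
    have d\<phi>: "continuous_on {a..b} (deriv \<phi>)" using \<phi> unfolding test_fun_def by (meson continuous_on_subset subset_UNIV)
    note * = weak_deriv_indefinite_integral[OF ab w U \<phi>]
    have "integral {a..b} (\<lambda>x. u x * deriv \<phi> x) = (LINT x|lebesgue_on {a..b}. u x * deriv \<phi> x)"
      by (intro lebesgue_integral_eq_integral[symmetric] continuous_imp_integrable_real continuous_intros cu d\<phi>) auto
    also have "\<dots> = - (LINT x|lebesgue_on {a..b}. w x * \<phi> x)" using wd \<phi> unfolding weak_deriv_def by blast
    also have "(LINT x|lebesgue_on {a..b}. w x * \<phi> x) = integral {a..b} (\<lambda>x. w x * \<phi> x)"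
      by (intro lebesgue_integral_eq_integral absolutely_integrable_imp_integrable *(2)) auto
    finally have "integral {a..b} (\<lambda>x. u x * deriv \<phi> x) = integral {a..b} (\<lambda>x. U x * deriv \<phi> x)" using *(1) by simp
    moreover have "integral {a..b} (\<lambda>x. ?z x * deriv \<phi> x) = integral {a..b} (\<lambda>x. u x * deriv \<phi> x) - integral {a..b} (\<lambda>x. U x * deriv \<phi> x)"
      unfolding left_diff_distrib
      by (intro Henstock_Kurzweil_Integration.integral_diff integrable_continuous_real continuous_intros cu cU d\<phi>)
    ultimately show "integral {a..b} (\<lambda>x. ?z x * deriv \<phi> x) = 0" by simp
  qed
  then have "u x = u a + integral {a..x} w" if "x \<in> {a..b}" for x
    using that by (auto simp: U_def) (smt (verit) atLeastAtMost_iff that)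
  then show ?thesis using w that by blast
qed

section \<open>Lebesgue differentiation of primitives\<close>

lemma right_derivative_indefinite_integral:
  fixes w :: "real \<Rightarrow> real"
  assumes "w integrable_on {a..b}"
  obtains N where "negligible N"
    "\<And>x e. x \<in> {a..<b} - N \<Longrightarrow> 0 < e \<Longrightarrow> \<exists>d>0. \<forall>h. 0 < h \<and> h < d \<longrightarrow> \<bar>integral {x..x+h} w / h - w x\<bar> < e"
proof -
  \<comment> \<open>Extension by zero makes \<open>w\<close> locally integrable on the line. In
    dimension one the cubes with lower corner \<open>x\<close> are the intervals
    \<open>[x, x + h]\<close>, so the density theorem yields right averages only.\<close>
  let ?f = "\<lambda>x. if x \<in> {a..b} then w x else 0"
  have "?f integrable_on cbox c d" for c d
  proof -
    have "?f integrable_on UNIV" using assms by (subst integrable_restrict_UNIV)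
    then show ?thesis using integrable_on_subcbox by blast
  qed
  then obtain N where N: "negligible N"
    "\<And>x e. x \<notin> N \<Longrightarrow> 0 < e \<Longrightarrow> \<exists>d>0. \<forall>h. 0 < h \<and> h < d \<longrightarrow>
                         norm (integral (cbox x (x + h *\<^sub>R One)) ?f /\<^sub>R h ^ DIM(real) - ?f x) < e"
    by (rule integrable_ccontinuous_explicit) blast
  have "\<exists>d>0. \<forall>h. 0 < h \<and> h < d \<longrightarrow> \<bar>integral {x..x+h} w / h - w x\<bar> < e"
    if x: "x \<in> {a..<b} - N" and e: "0 < e" for x e
  proof -
    obtain d where d: "d > 0" "\<And>h. 0 < h \<Longrightarrow> h < d \<Longrightarrow>
        norm (integral (cbox x (x + h *\<^sub>R One)) ?f /\<^sub>R h ^ DIM(real) - ?f x) < e"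
      using N(2)[of x e] x e by auto
    have "\<bar>integral {x..x+h} w / h - w x\<bar> < e" if h: "0 < h" "h < min d (b - x)" for h
    proof -
      have "integral {x..x+h} ?f = integral {x..x+h} w"
        using x h by (intro Henstock_Kurzweil_Integration.integral_cong) auto
      then show ?thesis using d(2)[of h] h x by (simp add: divide_inverse mult.commute)
    qed
    then show ?thesis using d(1) x by (intro exI[of _ "min d (b - x)"]) auto
  qed
  then show ?thesis using N(1) that by blast
qed

text \<open>Reflection about \<open>0\<close> turns left averages into right averages and, being
  differentiable, preserves null sets.\<close>

lemma left_derivative_indefinite_integral:
  fixes w :: "real \<Rightarrow> real"
  assumes "w integrable_on {a..b}"
  obtains N where "negligible N"
    "\<And>x e. x \<in> {a<..b} - N \<Longrightarrow> 0 < e \<Longrightarrow> \<exists>d>0. \<forall>h. 0 < h \<and> h < d \<longrightarrow> \<bar>integral {x-h..x} w / h - w x\<bar> < e"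
proof -
  obtain N where N: "negligible N"
    "\<And>x e. x \<in> {-b..<-a} - N \<Longrightarrow> 0 < e \<Longrightarrow> \<exists>d>0. \<forall>h. 0 < h \<and> h < d \<longrightarrow> \<bar>integral {x..x+h} (\<lambda>x. w (-x)) / h - w (-x)\<bar> < e"
    using right_derivative_indefinite_integral[of "\<lambda>x. w (-x)" "-b" "-a"] assms by auto
  have "negligible (uminus ` N)"
    by (rule negligible_differentiable_image_negligible[OF _ N(1)]) (auto intro!: derivative_intros)
  moreover have "\<exists>d>0. \<forall>h. 0 < h \<and> h < d \<longrightarrow> \<bar>integral {x-h..x} w / h - w x\<bar> < e"
    if x: "x \<in> {a<..b} - uminus ` N" and e: "0 < e" for x e
  proof -
    have "-x \<notin> N" using x by (metis DiffD2 image_eqI minus_minus)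
    then obtain d where "d > 0" "\<And>h. 0 < h \<Longrightarrow> h < d \<Longrightarrow> \<bar>integral {-x..-x+h} (\<lambda>x. w (-x)) / h - w x\<bar> < e"
      using N(2)[of "-x" e] x e by auto
    moreover have "integral {-x..-x+h} (\<lambda>x. w (-x)) = integral {x-h..x} w" for h
      using Henstock_Kurzweil_Integration.integral_reflect_real[of x "x-h" w] by simp
    ultimately show ?thesis by auto
  qed
  ultimately show ?thesis using that by blast
qed

lemma derivI_indefinite_integral:
  fixes w v :: "real \<Rightarrow> real"
  assumes ab: "a < b" and wi: "w integrable_on {a..b}"
    and v: "\<And>x. x \<in> {a..b} \<Longrightarrow> v x = v a + integral {a..x} w"
  obtains N where "negligible N" "\<And>x. x \<in> {a..b} - N \<Longrightarrow> derivI a b v x = w x"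
proof -
  obtain N1 N2 where N: "negligible N1" "negligible N2"
    and N1: "\<And>x e. x \<in> {a..<b} - N1 \<Longrightarrow> 0 < e \<Longrightarrow> \<exists>d>0. \<forall>h. 0 < h \<and> h < d \<longrightarrow> \<bar>integral {x..x+h} w / h - w x\<bar> < e"
    and N2: "\<And>x e. x \<in> {a<..b} - N2 \<Longrightarrow> 0 < e \<Longrightarrow> \<exists>d>0. \<forall>h. 0 < h \<and> h < d \<longrightarrow> \<bar>integral {x-h..x} w / h - w x\<bar> < e"
    using right_derivative_indefinite_integral[OF wi] left_derivative_indefinite_integral[OF wi] by metis
  \<comment> \<open>The endpoints join the exceptional set, since at each of them only one of the
    two one-sided statements applies.\<close>
  let ?N = "N1 \<union> N2 \<union> {a, b}"
  have "derivI a b v x = w x" if x: "x \<in> {a..b} - ?N" for x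
  proof -
    have "((\<lambda>y. (v y - v x) / (y - x)) \<longlongrightarrow> w x) (at x within {a..b})"
    proof (rule tendstoI)
      fix e :: real assume e: "e > 0"
      obtain d1 where d1: "d1 > 0" "\<And>h. 0 < h \<Longrightarrow> h < d1 \<Longrightarrow> \<bar>integral {x..x+h} w / h - w x\<bar> < e"
        using N1[of x e] x e by auto
      obtain d2 where d2: "d2 > 0" "\<And>h. 0 < h \<Longrightarrow> h < d2 \<Longrightarrow> \<bar>integral {x-h..x} w / h - w x\<bar> < e"
        using N2[of x e] x e by auto
      have "dist ((v y - v x) / (y - x)) (w x) < e" if y: "y \<in> {a..b}" "y \<noteq> x" "dist y x < min d1 d2" for y
      proof (cases "x < y")
        case True
        then have "v y - v x = integral {x..x + (y - x)} w"
          using integral_indefinite_diff[OF wi, of x y] v[of x] v[of y] x y by simp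
        then show ?thesis using d1(2)[of "y - x"] True y by (simp add: dist_real_def)
      next
        case False
        then have "- (v y - v x) = integral {x - (x - y)..x} w"
          using integral_indefinite_diff[OF wi, of y x] v[of x] v[of y] x y by simp
        moreover have "(v y - v x) / (y - x) = - (v y - v x) / (x - y)" by (metis minus_diff_eq minus_divide_divide)
        ultimately show ?thesis using d2(2)[of "x - y"] False y by (simp add: dist_real_def)
      qed
      then show "\<forall>\<^sub>F y in at x within {a..b}. dist ((v y - v x) / (y - x)) (w x) < e"
        unfolding eventually_at using d1(1) d2(1) by (metis min_less_iff_conj)
    qed
    then have "(v has_field_derivative w x) (at x within {a..b})" by (simp add: has_field_derivative_iff)
    then have "(v has_vector_derivative w x) (at x within {a..b})" by (simp add: has_real_derivative_iff_has_vector_derivative)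
    then show ?thesis
      unfolding derivI_def using x ab by (intro vector_derivative_within at_within_Icc_neq_bot) auto
  qed
  moreover have "negligible ?N" using N by simp
  ultimately show ?thesis using that by blast
qed

text \<open>\<open>J\<close> evaluates the pointwise derivative, whereas \<open>W11\<close> provides
  a weak one. They agree almost everywhere, so the pointwise derivative inherits integrability and
  recovers \<open>u\<close>.\<close>

lemma W11_derivI:
  assumes ab: "a < b" and u: "u \<in> W11 a b"
  shows "derivI a b u absolutely_integrable_on {a..b}"
    and "\<And>x. x \<in> {a..b} \<Longrightarrow> u x = u a + integral {a..x} (derivI a b u)"
proof -
  obtain w where w: "w absolutely_integrable_on {a..b}" "\<And>x. x \<in> {a..b} \<Longrightarrow> u x = u a + integral {a..x} w"
    using W11_indefinite_integral[of a b u] ab u by auto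
  have wi: "w integrable_on {a..b}" using w unfolding absolutely_integrable_on_def by auto
  obtain N where N: "negligible N" "\<And>x. x \<in> {a..b} - N \<Longrightarrow> derivI a b u x = w x"
    using derivI_indefinite_integral[OF ab wi w(2)] by blast
  show "derivI a b u absolutely_integrable_on {a..b}"
    by (rule absolutely_integrable_spike[OF w(1) N])
  show "u x = u a + integral {a..x} (derivI a b u)" if "x \<in> {a..b}" for x
  proof -
    have "integral {a..x} w = integral {a..x} (derivI a b u)"
      by (rule integral_spike[OF N(1)]) (use that N in auto)
    then show ?thesis using w(2)[OF that] by simp
  qed
qed

section \<open>Strict extended derivatives\<close>

text \<open>All slopes near \<open>x\<close> lie in \<open>V\<close>, and the limit at each nearby
  \<open>y\<close> is a limit of such slopes, hence lies in \<open>closure V\<close>; this makes the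
  limit function \<open>l\<close> continuous. Differentiability of \<open>u\<close> at
  \<open>x\<close> amounts to finiteness of \<open>l x\<close>, an open condition.\<close>

theorem tonelli_partial_regularity_if_strict_derivative:
  assumes ab: "a < b"
    and strict: "\<And>x. x \<in> {a..b} \<Longrightarrow> \<exists>l::ereal. \<forall>V. open V \<longrightarrow> l \<in> V \<longrightarrow>
    (\<exists>\<rho>>0. \<forall>c d. a \<le> c \<longrightarrow> c < d \<longrightarrow> d \<le> b \<longrightarrow> \<bar>c - x\<bar> < \<rho> \<longrightarrow> \<bar>d - x\<bar> < \<rho> \<longrightarrow> ereal (slope u c d) \<in> V)"
  shows "tonelli_partial_regularity a b u"
proof -
  obtain l where l: "\<And>x V. x \<in> {a..b} \<Longrightarrow> open V \<Longrightarrow> l x \<in> V \<Longrightarrow>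
     \<exists>\<rho>>0. \<forall>c d. a \<le> c \<longrightarrow> c < d \<longrightarrow> d \<le> b \<longrightarrow> \<bar>c - x\<bar> < \<rho> \<longrightarrow> \<bar>d - x\<bar> < \<rho> \<longrightarrow> ereal (slope u c d) \<in> V"
    using strict by metis
  have nb: "at x within {a..b} \<noteq> bot" if "x \<in> {a..b}" for x
    using at_within_Icc_neq_bot ab that .
  have ext: "has_ext_deriv a b u x (l x)" if x: "x \<in> {a..b}" for x
    unfolding has_ext_deriv_def
  proof (rule topological_tendstoI)
    fix V assume "open V" "l x \<in> V"
    then obtain \<rho> where \<rho>: "\<rho> > 0" "\<And>c d. a \<le> c \<Longrightarrow> c < d \<Longrightarrow> d \<le> b \<Longrightarrow> \<bar>c - x\<bar> < \<rho> \<Longrightarrow> \<bar>d - x\<bar> < \<rho> \<Longrightarrow> ereal (slope u c d) \<in> V"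
      using l[OF x] by metis
    have "ereal ((u y - u x) / (y - x)) \<in> V" if y: "y \<in> {a..b}" "y \<noteq> x" "dist y x < \<rho>" for y
    proof (cases "x < y")
      case True
      then show ?thesis using \<rho>(2)[of x y] x y \<rho>(1) by (auto simp: slope_def dist_real_def)
    next
      case False
      have "(u y - u x) / (y - x) = slope u y x" unfolding slope_def by (metis minus_diff_eq minus_divide_divide)
      then show ?thesis using \<rho>(2)[of y x] x y \<rho>(1) False by (auto simp: dist_real_def)
    qed
    then show "\<forall>\<^sub>F y in at x within {a..b}. ereal ((u y - u x) / (y - x)) \<in> V"
      unfolding eventually_at using \<rho>(1) by blast
  qed
  have unique: "m = l x" if "x \<in> {a..b}" "has_ext_deriv a b u x m" for x m
    using tendsto_unique[OF nb[OF that(1)]] ext that unfolding has_ext_deriv_def by blast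
  have ext_eq: "ext_deriv a b u x = l x" if "x \<in> {a..b}" for x
    unfolding ext_deriv_def using tendsto_Lim[OF nb[OF that]] ext[OF that] unfolding has_ext_deriv_def by blast
  have near: "\<exists>c d. a \<le> c \<and> c < d \<and> d \<le> b \<and> \<bar>c - x\<bar> < \<rho> \<and> \<bar>d - x\<bar> < \<rho>" if "\<rho> > 0" "x \<in> {a..b}" for x \<rho>
    using that ab by (intro exI[of _ "max a (x - \<rho>/2)"] exI[of _ "min b (x + \<rho>/2)"]) (auto simp: max_def min_def)
  have inside: "l y \<in> closure V" if y: "y \<in> {a..b}" "\<bar>y - x\<bar> < \<rho>" and
     V: "\<And>c d. a \<le> c \<Longrightarrow> c < d \<Longrightarrow> d \<le> b \<Longrightarrow> \<bar>c - x\<bar> < \<rho> \<Longrightarrow> \<bar>d - x\<bar> < \<rho> \<Longrightarrow> ereal (slope u c d) \<in> V" for x y \<rho> V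
  proof (rule ccontr)
    assume "l y \<notin> closure V"
    then obtain r where r: "r > 0" "\<And>c d. a \<le> c \<Longrightarrow> c < d \<Longrightarrow> d \<le> b \<Longrightarrow> \<bar>c - y\<bar> < r \<Longrightarrow> \<bar>d - y\<bar> < r \<Longrightarrow> ereal (slope u c d) \<in> - closure V"
      using l[OF y(1), of "- closure V"] by (metis ComplI closed_closure open_Compl)
    obtain c d where cd: "a \<le> c \<and> c < d \<and> d \<le> b \<and> \<bar>c - y\<bar> < min r (\<rho> - \<bar>y - x\<bar>) \<and> \<bar>d - y\<bar> < min r (\<rho> - \<bar>y - x\<bar>)"
      using near[of "min r (\<rho> - \<bar>y - x\<bar>)" y] y r(1) by auto
    then have "ereal (slope u c d) \<in> V" by (intro V) auto
    moreover have "ereal (slope u c d) \<in> - closure V" using cd by (intro r(2)) auto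
    ultimately show False using closure_subset by auto
  qed
  have ev: "\<forall>\<^sub>F y in at x within {a..b}. l y \<in> closure V" if xV: "x \<in> {a..b}" "open V" "l x \<in> V" for x V
  proof -
    obtain \<rho> where \<rho>: "\<rho> > 0" "\<And>c d. a \<le> c \<Longrightarrow> c < d \<Longrightarrow> d \<le> b \<Longrightarrow> \<bar>c - x\<bar> < \<rho> \<Longrightarrow> \<bar>d - x\<bar> < \<rho> \<Longrightarrow> ereal (slope u c d) \<in> V"
      using l[OF xV] by metis
    then show ?thesis unfolding eventually_at dist_real_def using inside[of _ x \<rho> V] by blast
  qed
  have cont: "continuous_on {a..b} l"
    unfolding continuous_on_def
  proof (intro ballI order_tendstoI)
    fix x k assume x: "x \<in> {a..b}" "k < l x"
    \<comment> \<open>An intermediate level leaves room for passing from the half-line to its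
      closure.\<close>
    then obtain k' where k': "k < k'" "k' < l x" using dense by blast
    have "closure {k'<..} \<subseteq> {k'..}" by (rule closure_minimal) auto
    then show "\<forall>\<^sub>F y in at x within {a..b}. k < l y"
      using x k' by (intro eventually_mono[OF ev[of x "{k'<..}"]]) (auto intro: less_le_trans)
  next
    fix x k assume x: "x \<in> {a..b}" "l x < k"
    then obtain k' where k': "k' < k" "l x < k'" using dense by blast
    have "closure {..<k'} \<subseteq> {..k'}" by (rule closure_minimal) auto
    then show "\<forall>\<^sub>F y in at x within {a..b}. l y < k"
      using x k' by (intro eventually_mono[OF ev[of x "{..<k'}"]]) (auto intro: le_less_trans)
  qed
  have diff: "u differentiable (at x within {a..b}) \<longleftrightarrow> \<bar>l x\<bar> \<noteq> \<infinity>" if x: "x \<in> {a..b}" for x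
  proof
    assume "u differentiable (at x within {a..b})"
    then obtain D where "(u has_field_derivative D) (at x within {a..b})" by (auto simp: real_differentiable_def)
    then have "has_ext_deriv a b u x (ereal D)"
      unfolding has_ext_deriv_def by (simp add: has_field_derivative_iff tendsto_ereal)
    then show "\<bar>l x\<bar> \<noteq> \<infinity>" using unique[OF x] by fastforce
  next
    assume "\<bar>l x\<bar> \<noteq> \<infinity>"
    then obtain r where "l x = ereal r" by auto
    then have "(u has_field_derivative r) (at x within {a..b})"
      using ext[OF x] by (simp add: has_field_derivative_iff has_ext_deriv_def)
    then show "u differentiable (at x within {a..b})" by (auto simp: real_differentiable_def)
  qed
  have dp: "diff_points a b u = {a..b} \<inter> l -` {-\<infinity><..<\<infinity>}"
    unfolding diff_points_def using diff by auto
  show ?thesis unfolding tonelli_partial_regularity_def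
  proof (intro conjI)
    show "openin (top_of_set {a..b}) (diff_points a b u)"
      unfolding dp by (intro continuous_openin_preimage_gen cont) auto
    show "{a..b} - diff_points a b u = {x \<in> {a..b}. has_ext_deriv a b u x (-\<infinity>) \<or> has_ext_deriv a b u x \<infinity>}"
    proof -
      have "\<bar>l x\<bar> = \<infinity> \<longleftrightarrow> has_ext_deriv a b u x (-\<infinity>) \<or> has_ext_deriv a b u x \<infinity>" if "x \<in> {a..b}" for x
      proof -
        have "\<bar>l x\<bar> = \<infinity> \<longleftrightarrow> l x = -\<infinity> \<or> l x = \<infinity>" by (cases "l x") auto
        then show ?thesis using ext[OF that] unique[OF that] by metis
      qed
      then show ?thesis unfolding diff_points_def using diff by auto
    qed
    show "continuous_on {a..b} (ext_deriv a b u)"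
      by (rule continuous_on_eq[OF cont]) (simp add: ext_eq)
  qed
qed

section \<open>The functional\<close>

text \<open>The Lagrange form of the remainder works with mere existence of the second derivative;
  the weak bounds on \<open>t\<close> admit \<open>v = p\<close>.\<close>

lemma second_order_Taylor:
  fixes \<psi> :: "real \<Rightarrow> real"
  assumes "\<And>v. \<psi> differentiable (at v)" "\<And>v. deriv \<psi> differentiable (at v)"
  obtains t where "min p v \<le> t" "t \<le> max p v"
    "\<psi> v = \<psi> p + deriv \<psi> p * (v - p) + deriv (deriv \<psi>) t / 2 * (v - p)\<^sup>2"
proof (cases "v = p")
  case True
  then show ?thesis using that[of p] by simp
next
  case False
  define D where "D m = (deriv ^^ m) \<psi>" for m :: nat
  have "\<forall>m t. m < 2 \<and> min p v \<le> t \<and> t \<le> max p v \<longrightarrow> DERIV (D m) t :> D (Suc m) t"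
  proof (intro allI impI)
    fix m t assume "m < (2::nat) \<and> min p v \<le> t \<and> t \<le> max p v"
    then have "m = 0 \<or> m = 1" by auto
    then show "DERIV (D m) t :> D (Suc m) t"
      using assms by (auto simp: D_def DERIV_deriv_iff_real_differentiable)
  qed
  then have "\<exists>t. (if v < p then v < t \<and> t < p else p < t \<and> t < v) \<and>
      \<psi> v = (\<Sum>m<2. D m p / fact m * (v - p) ^ m) + D 2 t / fact 2 * (v - p) ^ 2"
    using False by (intro Taylor[of 2 D \<psi> "min p v" "max p v"]) (auto simp: D_def)
  then obtain t where t: "if v < p then v < t \<and> t < p else p < t \<and> t < v"
    "\<psi> v = (\<Sum>m<2. D m p / fact m * (v - p) ^ m) + D 2 t / fact 2 * (v - p) ^ 2" by blast
  show ?thesis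
  proof (rule that[of t])
    show "\<psi> v = \<psi> p + deriv \<psi> p * (v - p) + deriv (deriv \<psi>) t / 2 * (v - p)\<^sup>2"
      using t(2) by (simp add: D_def numeral_2_eq_2 fact_numeral)
  qed (use t(1) in \<open>auto split: if_splits\<close>)
qed

lemma absolutely_integrable_restrict_Icc:
  fixes h :: "real \<Rightarrow> real"
  assumes "h absolutely_integrable_on {c..d}" "{c..d} \<subseteq> S"
  shows "(\<lambda>x. if x \<in> {c..d} then h x else 0) absolutely_integrable_on S"
proof -
  have "{c..d} \<inter> S = {c..d}" using assms by blast
  then have "(\<lambda>x. if x \<in> {c..d} then h x else 0) integrable_on S"
     "(\<lambda>x. if x \<in> {c..d} then norm (h x) else 0) integrable_on S"
    using assms integrable_restrict_Int[of "{c..d}" h S] integrable_restrict_Int[of "{c..d}" "\<lambda>x. norm (h x)" S]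
    unfolding absolutely_integrable_on_def by metis+
  moreover have "(\<lambda>x. norm (if x \<in> {c..d} then h x else 0)) = (\<lambda>x. if x \<in> {c..d} then norm (h x) else 0)" by auto
  ultimately show ?thesis unfolding absolutely_integrable_on_def by metis
qed

lemma C1_on_derivI:
  assumes "C1_on a b f" "x \<in> {a..b}"
  shows "(f has_field_derivative derivI a b f x) (at x within {a..b})"
  using assms unfolding C1_on_def derivI_def
  by (simp add: has_real_derivative_iff_has_vector_derivative vector_derivative_works[symmetric])

lemma derivI_eq:
  assumes "a < b" "x \<in> {a..b}" "(v has_field_derivative y) (at x within {a..b})"
  shows "derivI a b v x = y"
  unfolding derivI_def using assms
  by (intro vector_derivative_within at_within_Icc_neq_bot) (auto simp: has_real_derivative_iff_has_vector_derivative)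

lemma integral_has_field_derivative:
  fixes v v' :: "real \<Rightarrow> real"
  assumes "\<And>x. x \<in> {c..d} \<Longrightarrow> (v has_field_derivative v' x) (at x within {c..d})"
    and "c \<le> x" "x \<le> y" "y \<le> d"
  shows "(v' has_integral (v y - v x)) {x..y}"
  using assms by (intro fundamental_theorem_of_calculus)
    (auto simp: has_real_derivative_iff_has_vector_derivative[symmetric] intro!: DERIV_subset[OF assms(1)])

text \<open>The deviation is the average over \<open>t\<close> in \<open>[c,d]\<close> of
  \<open>derivI a b h x - derivI a b h t\<close>, and each of these differences is bounded by the
  modulus at \<open>d - c\<close>.\<close>

lemma derivI_close_to_slope:
  assumes h: "C1_on a b h" and cd: "a \<le> c" "c < d" "d \<le> b" and x: "x \<in> {c..d}"
  shows "\<bar>derivI a b h x - slope h c d\<bar> \<le> modulus a b (derivI a b h) (d - c)"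
proof -
  let ?h' = "derivI a b h"
  have h': "continuous_on {a..b} ?h'" using h by (simp add: C1_on_def)
  have D: "(h has_field_derivative ?h' t) (at t within {c..d})" if "t \<in> {c..d}" for t
    by (rule DERIV_subset[OF C1_on_derivI[OF h]]) (use that cd in auto)
  have "(?h' has_integral (h d - h c)) {c..d}"
    by (rule integral_has_field_derivative[OF D]) (use cd in auto)
  then have "((\<lambda>t. ?h' x - ?h' t) has_integral (d - c) * ?h' x - (h d - h c)) {c..d}"
    using has_integral_diff[OF has_integral_const_real[of "?h' x" c d]] cd by simp
  moreover have "norm (?h' x - ?h' t) \<le> modulus a b ?h' (d - c)" if "t \<in> {c..d}" for t
    using abs_diff_le_modulus[OF h', of x t "d - c"] x that cd by auto
  moreover have "0 \<le> modulus a b ?h' (d - c)" using modulus_nonneg[OF h'] cd by simp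
  ultimately have "\<bar>(d - c) * ?h' x - (h d - h c)\<bar> \<le> modulus a b ?h' (d - c) * (d - c)"
    using has_integral_bound_real[of "modulus a b ?h' (d - c)" "{}" "\<lambda>t. ?h' x - ?h' t" _ c d] cd by auto
  moreover have "(d - c) * ?h' x - (h d - h c) = (d - c) * (?h' x - slope h c d)"
  proof -
    have "h d - h c = (d - c) * slope h c d" using cd by (simp add: slope_def)
    then show ?thesis by (simp only: right_diff_distrib)
  qed
  ultimately show ?thesis using cd by (simp add: abs_mult mult.commute)
qed

lemma C1_in_W11:
  fixes v v' :: "real \<Rightarrow> real"
  assumes "a \<le> b" "\<And>x. x \<in> {a..b} \<Longrightarrow> (v has_field_derivative v' x) (at x within {a..b})"
    and "continuous_on {a..b} v'"
  shows "v \<in> W11 a b"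
proof (rule indefinite_integral_in_W11)
  show "v' absolutely_integrable_on {a..b}" using assms absolutely_integrable_continuous_real by blast
  show "v x = v a + integral {a..x} v'" if "x \<in> {a..b}" for x
    using integral_has_field_derivative[OF assms(2), of a x] that by (auto dest: integral_unique)
qed (use assms in auto)

definition lagr :: "(real \<Rightarrow> real \<Rightarrow> real \<Rightarrow> real) \<Rightarrow> real \<Rightarrow> real \<Rightarrow> (real \<Rightarrow> real) \<Rightarrow> real \<Rightarrow> real" where
  "lagr L a b u x = L x (u x) (derivI a b u x)"

lemma J_eq_integral:
  assumes "lagr L a b v absolutely_integrable_on {a..b}"
  shows "J L a b v = ereal (integral {a..b} (lagr L a b v))"
proof -
  let ?M = "lebesgue_on {a..b}" and ?F = "lagr L a b v"
  have F: "integrable ?M ?F" using assms by (simp add: integrable_lebesgue_on_iff_absolutely_integrable)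
  then have fin: "(\<integral>\<^sup>+x. ennreal (?F x) \<partial>?M) \<noteq> \<infinity>" "(\<integral>\<^sup>+x. ennreal (- ?F x) \<partial>?M) \<noteq> \<infinity>"
    by (auto simp: real_integrable_def)
  have "ereal (integral {a..b} ?F) = ereal (integral\<^sup>L ?M ?F)"
    using lebesgue_integral_eq_integral[OF F] by simp
  also have "\<dots> = ereal (enn2real (\<integral>\<^sup>+x. ennreal (?F x) \<partial>?M) - enn2real (\<integral>\<^sup>+x. ennreal (- ?F x) \<partial>?M))"
    using real_lebesgue_integral_def[OF F] by simp
  also have "\<dots> = J L a b v"
    using fin unfolding J_def lagr_def
    by (cases "\<integral>\<^sup>+x. ennreal (?F x) \<partial>?M"; cases "\<integral>\<^sup>+x. ennreal (- ?F x) \<partial>?M") (auto simp: lagr_def)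
  finally show ?thesis by simp
qed

text \<open>On a bounded interval the lower bound makes the integral of the negative part finite, so
  a value of \<open>J\<close> below infinity forces the positive part to be integrable as
  well.\<close>

lemma absolutely_integrable_if_J_finite:
  assumes meas: "lagr L a b v \<in> borel_measurable (lebesgue_on {a..b})"
    and low: "\<And>x. x \<in> {a..b} \<Longrightarrow> - C \<le> lagr L a b v x"
    and fin: "J L a b v < \<infinity>"
  shows "lagr L a b v absolutely_integrable_on {a..b}"
proof -
  let ?M = "lebesgue_on {a..b}" and ?F = "lagr L a b v"
  have "(\<integral>\<^sup>+x. ennreal (- ?F x) \<partial>?M) \<le> (\<integral>\<^sup>+x. ennreal C \<partial>?M)"
    using low by (intro nn_integral_mono ennreal_leI) fastforce
  also have "\<dots> < \<infinity>" by (simp add: emeasure_restrict_space ennreal_mult_less_top emeasure_lborel_Icc_eq)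
  finally have neg: "(\<integral>\<^sup>+x. ennreal (- ?F x) \<partial>?M) \<noteq> \<infinity>" by simp
  have pos: "(\<integral>\<^sup>+x. ennreal (?F x) \<partial>?M) \<noteq> \<infinity>"
  proof
    assume "(\<integral>\<^sup>+x. ennreal (?F x) \<partial>?M) = \<infinity>"
    then have "J L a b v = \<infinity>" using neg unfolding J_def
      by (cases "\<integral>\<^sup>+x. ennreal (- ?F x) \<partial>?M") (auto simp: lagr_def)
    then show False using fin by simp
  qed
  show ?thesis using meas neg pos
    by (simp add: integrable_lebesgue_on_iff_absolutely_integrable[symmetric] real_integrable_def)
qed

text \<open>\<open>L\<close> is continuous only over the strip above \<open>[a,b]\<close>. Clamping
  its first argument gives a function continuous on the whole space, hence a Borel function that may
  be composed with measurable maps.\<close>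

lemma borel_measurable_lagr:
  assumes L: "continuous_on ({a..b} \<times> UNIV \<times> UNIV) (\<lambda>(x, u, v). L x u v)" and ab: "a \<le> b"
    and "continuous_on {a..b} v" "derivI a b v absolutely_integrable_on {a..b}"
  shows "lagr L a b v \<in> borel_measurable (lebesgue_on {a..b})"
proof -
  let ?M = "lebesgue_on {a..b}"
  let ?L = "\<lambda>(x, u, v). L (max a (min b x)) u v"
  have "continuous_on UNIV ((\<lambda>(x, u, v). L x u v) \<circ> (\<lambda>(x, u, v). (max a (min b x), u, v)))"
    using ab by (intro continuous_on_compose continuous_on_subset[OF L])
      (auto simp: case_prod_unfold intro!: continuous_intros)
  then have c: "?L \<in> borel_measurable borel"
    by (intro borel_measurable_continuous_onI) (simp add: o_def case_prod_unfold)
  have "v \<in> borel_measurable ?M" using assms by (intro continuous_imp_measurable_on_sets_lebesgue) auto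
  moreover have "derivI a b v \<in> borel_measurable ?M"
    using assms by (simp add: integrable_lebesgue_on_iff_absolutely_integrable[symmetric])
  moreover have "(\<lambda>x. x) \<in> borel_measurable ?M" by (intro continuous_imp_measurable_on_sets_lebesgue) auto
  ultimately have "(\<lambda>x. (x, v x, derivI a b v x)) \<in> borel_measurable ?M"
    by (intro borel_measurable_Pair) auto
  then have "(\<lambda>x. ?L (x, v x, derivI a b v x)) \<in> borel_measurable ?M"
    using measurable_compose[OF _ c] by blast
  then show ?thesis by (rule measurable_cong[THEN iffD1, rotated]) (auto simp: lagr_def)
qed

lemma compact_box3:
  "compact ({a..b} \<times> {-R..R} \<times> {-M..M :: real} :: (real \<times> real \<times> real) set)"
  by (intro compact_Times compact_Icc)

lemma bounded_on_box3:
  fixes H :: "real \<Rightarrow> real \<Rightarrow> real \<Rightarrow> real"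
  assumes "continuous_on ({a..b} \<times> UNIV \<times> UNIV) (\<lambda>(x, u, v). H x u v)"
  obtains B where "B > 0" "\<And>x u v. x \<in> {a..b} \<Longrightarrow> \<bar>u\<bar> \<le> R \<Longrightarrow> \<bar>v\<bar> \<le> M \<Longrightarrow> \<bar>H x u v\<bar> \<le> B"
proof -
  let ?G = "{a..b} \<times> {-R..R} \<times> {-M..M}"
  have "continuous_on ?G (\<lambda>(x, u, v). H x u v)" by (rule continuous_on_subset[OF assms]) auto
  then have "bounded ((\<lambda>(x, u, v). H x u v) ` ?G)"
    by (intro compact_imp_bounded compact_continuous_image compact_box3)
  then obtain B where B: "B > 0" "\<And>y. y \<in> (\<lambda>(x, u, v). H x u v) ` ?G \<Longrightarrow> \<bar>y\<bar> \<le> B"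
    unfolding bounded_pos real_norm_def by blast
  show ?thesis
  proof (rule that[OF B(1)])
    fix x u v assume "x \<in> {a..b}" "\<bar>u\<bar> \<le> R" "\<bar>v\<bar> \<le> M"
    then have "H x u v \<in> (\<lambda>(x, u, v). H x u v) ` ?G" by (intro image_eqI[of _ _ "(x, u, v)"]) auto
    then show "\<bar>H x u v\<bar> \<le> B" using B(2) by blast
  qed
qed

lemma L_vv_Taylor:
  assumes "L_vv_exists L a b" "x \<in> {a..b}"
  obtains t where "min p v \<le> t" "t \<le> max p v"
    "L x u v = L x u p + deriv (L x u) p * (v - p) + L_vv L x u t / 2 * (v - p)\<^sup>2"
  using second_order_Taylor[of "L x u" p v] assms unfolding L_vv_exists_def L_vv_def by blast

text \<open>Hoelder continuity of the \<open>v\<close>-derivative comes from interpolation.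
  Replacing it by a difference quotient of step \<open>t\<close> costs an error of order
  \<open>t\<close>, as \<open>L_vv\<close> is bounded; Hoelder continuity of \<open>L\<close> bounds
  the change of the quotient by a multiple of \<open>D powr (2 * \<beta>) / t\<close>, with
  \<open>D\<close> the distance of the base points. The choice \<open>t = D powr \<beta>\<close>
  balances the two and halves the exponent.\<close>

lemma Lagrangian_constants:
  assumes L_cont: "continuous_on ({a..b} \<times> UNIV \<times> UNIV) (\<lambda>(x, u, v). L x u v)"
    and L_holder: "\<And>G :: (real \<times> real \<times> real) set.
          compact G \<Longrightarrow> G \<subseteq> {a..b} \<times> UNIV \<times> UNIV \<Longrightarrow>
          \<exists>C>0. \<exists>\<alpha>>0. \<forall>(x1, u1, v1)\<in>G. \<forall>(x2, u2, v2)\<in>G.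
            \<bar>L x1 u1 v1 - L x2 u2 v2\<bar> \<le> C * (\<bar>x1 - x2\<bar> + \<bar>u1 - u2\<bar> + \<bar>v1 - v2\<bar>) powr \<alpha>"
    and L_vv_ex: "L_vv_exists L a b"
    and L_vv_cont: "continuous_on ({a..b} \<times> UNIV \<times> UNIV) (\<lambda>(x, u, v). L_vv L x u v)"
  obtains K \<beta> where "K > 0" "0 < \<beta>" "\<beta> \<le> 1/2"
    "\<And>x1 u1 x2 u2 v. x1 \<in> {a..b} \<Longrightarrow> x2 \<in> {a..b} \<Longrightarrow> \<bar>u1\<bar> \<le> R \<Longrightarrow> \<bar>u2\<bar> \<le> R \<Longrightarrow> \<bar>v\<bar> \<le> M \<Longrightarrow>
       \<bar>L x1 u1 v - L x2 u2 v\<bar> \<le> K * (\<bar>x1 - x2\<bar> + \<bar>u1 - u2\<bar>) powr (2 * \<beta>)"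
    "\<And>x1 u1 x2 u2 v. x1 \<in> {a..b} \<Longrightarrow> x2 \<in> {a..b} \<Longrightarrow> \<bar>u1\<bar> \<le> R \<Longrightarrow> \<bar>u2\<bar> \<le> R \<Longrightarrow> \<bar>v\<bar> \<le> M \<Longrightarrow>
       \<bar>deriv (L x1 u1) v - deriv (L x2 u2) v\<bar> \<le> K * (\<bar>x1 - x2\<bar> + \<bar>u1 - u2\<bar>) powr \<beta>"
    "\<And>x u v. x \<in> {a..b} \<Longrightarrow> \<bar>u\<bar> \<le> R \<Longrightarrow> \<bar>v\<bar> \<le> M + 1 \<Longrightarrow> \<bar>L_vv L x u v\<bar> \<le> K"
    "\<And>x u v. x \<in> {a..b} \<Longrightarrow> \<bar>u\<bar> \<le> R \<Longrightarrow> \<bar>v\<bar> \<le> M \<Longrightarrow> \<bar>L x u v\<bar> \<le> K"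
    "\<And>x u v. x \<in> {a..b} \<Longrightarrow> \<bar>u\<bar> \<le> R \<Longrightarrow> \<bar>v\<bar> \<le> M \<Longrightarrow> \<bar>deriv (L x u) v\<bar> \<le> K"
proof -
  \<comment> \<open>The margin \<open>1\<close> in the last argument accommodates steps
    \<open>t \<le> 1\<close> starting from \<open>\<bar>v\<bar> \<le> M\<close>.\<close>
  let ?G = "{a..b} \<times> {-R..R} \<times> {-(M+1)..M+1}"
  obtain C \<alpha> where C: "C > 0" "\<alpha> > 0" "\<forall>(x1, u1, v1)\<in>?G. \<forall>(x2, u2, v2)\<in>?G.
            \<bar>L x1 u1 v1 - L x2 u2 v2\<bar> \<le> C * (\<bar>x1 - x2\<bar> + \<bar>u1 - u2\<bar> + \<bar>v1 - v2\<bar>) powr \<alpha>"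
  proof -
    have "?G \<subseteq> {a..b} \<times> UNIV \<times> UNIV" by auto
    then show ?thesis using L_holder[OF compact_box3] that by blast
  qed
  obtain B where B: "B > 0" "\<And>x u v. x \<in> {a..b} \<Longrightarrow> \<bar>u\<bar> \<le> R \<Longrightarrow> \<bar>v\<bar> \<le> M+1 \<Longrightarrow> \<bar>L x u v\<bar> \<le> B"
    using bounded_on_box3[OF L_cont] by blast
  obtain N where N: "N > 0" "\<And>x u v. x \<in> {a..b} \<Longrightarrow> \<bar>u\<bar> \<le> R \<Longrightarrow> \<bar>v\<bar> \<le> M+1 \<Longrightarrow> \<bar>L_vv L x u v\<bar> \<le> N"
    using bounded_on_box3[OF L_vv_cont] by blast
  \<comment> \<open>The cap gives \<open>2 * \<beta> \<le> 1\<close>, so that the power of the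
    oscillation grows at most linearly in the energy estimate.\<close>
  define \<beta> where "\<beta> = min \<alpha> 1 / 2"
  have \<beta>: "0 < \<beta>" "\<beta> \<le> 1/2" "2 * \<beta> \<le> \<alpha>" using C by (auto simp: \<beta>_def)
  \<comment> \<open>The summand \<open>2 * B\<close> serves base points at distance above
    \<open>1\<close>, where the bound on \<open>L\<close> replaces its Hoelder continuity.\<close>
  define C' where "C' = C + 2 * B"
  have taylor: "\<bar>L x u (v + t) - L x u v - deriv (L x u) v * t\<bar> \<le> N / 2 * t\<^sup>2"
    if x: "x \<in> {a..b}" "\<bar>u\<bar> \<le> R" "\<bar>v\<bar> \<le> M" and t: "0 \<le> t" "t \<le> 1" for x u v t
  proof -
    obtain s where s: "min v (v + t) \<le> s" "s \<le> max v (v + t)"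
      "L x u (v + t) = L x u v + deriv (L x u) v * (v + t - v) + L_vv L x u s / 2 * (v + t - v)\<^sup>2"
      by (rule L_vv_Taylor[OF L_vv_ex x(1)])
    have "\<bar>L_vv L x u s\<bar> \<le> N" using s t x by (intro N) auto
    then have "\<bar>L_vv L x u s\<bar> / 2 * t\<^sup>2 \<le> N / 2 * t\<^sup>2" by (intro mult_right_mono) auto
    then show ?thesis using s(3) by (simp add: abs_mult)
  qed
  have dB: "\<bar>deriv (L x u) v\<bar> \<le> 2 * B + N" if x: "x \<in> {a..b}" "\<bar>u\<bar> \<le> R" "\<bar>v\<bar> \<le> M" for x u v
  proof -
    have "\<bar>L x u (v+1)\<bar> \<le> B" "\<bar>L x u v\<bar> \<le> B" using x by (auto intro!: B)
    moreover have "\<bar>L x u (v+1) - L x u v - deriv (L x u) v\<bar> \<le> N / 2" using taylor[OF x, of 1] by simp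
    ultimately show ?thesis using N(1) by linarith
  qed
  have D1: "D powr \<alpha> \<le> D powr (2 * \<beta>)" if "0 \<le> D" "D \<le> 1" for D :: real
  proof (cases "D = 0")
    case False
    then show ?thesis using that \<beta> by (intro powr_mono') auto
  qed simp
  have H1: "\<bar>L x1 u1 v - L x2 u2 v\<bar> \<le> C' * (\<bar>x1 - x2\<bar> + \<bar>u1 - u2\<bar>) powr (2 * \<beta>)"
    if x: "x1 \<in> {a..b}" "x2 \<in> {a..b}" "\<bar>u1\<bar> \<le> R" "\<bar>u2\<bar> \<le> R" "\<bar>v\<bar> \<le> M + 1" for x1 u1 x2 u2 v
  proof -
    let ?D = "\<bar>x1 - x2\<bar> + \<bar>u1 - u2\<bar>"
    show ?thesis
    proof (cases "?D \<le> 1")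
      case True
      have "(x1, u1, v) \<in> ?G" "(x2, u2, v) \<in> ?G" using x by auto
      then have "\<bar>L x1 u1 v - L x2 u2 v\<bar> \<le> C * ?D powr \<alpha>" 
        using bspec[OF C(3), of "(x1, u1, v)"] bspec[of ?G _ "(x2, u2, v)"] by (smt (verit) add_0_right abs_zero case_prod_conv diff_self)
      also have "\<dots> \<le> C' * ?D powr (2 * \<beta>)"
        using C(1) B(1) D1[of ?D] True by (intro mult_mono) (auto simp: C'_def)
      finally show ?thesis .
    next
      case False
      have "\<bar>L x1 u1 v\<bar> \<le> B" "\<bar>L x2 u2 v\<bar> \<le> B" using x by (auto intro!: B)
      then have "\<bar>L x1 u1 v - L x2 u2 v\<bar> \<le> C' * 1" using C(1) by (simp add: C'_def)
      also have "\<dots> \<le> C' * ?D powr (2 * \<beta>)"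
        using False \<beta> C(1) B(1) by (intro mult_left_mono ge_one_powr_ge_zero) (auto simp: C'_def)
      finally show ?thesis .
    qed
  qed
  define K where "K = 2 * C' + 4 * B + 2 * N"
  have K: "K > 0" "C' \<le> K" "N \<le> K" "B \<le> K" "2 * B + N \<le> K" "2 * C' + N \<le> K" "4 * B + 2 * N \<le> K"
    using C(1) B(1) N(1) by (auto simp: K_def C'_def)
  have H2: "\<bar>deriv (L x1 u1) v - deriv (L x2 u2) v\<bar> \<le> K * (\<bar>x1 - x2\<bar> + \<bar>u1 - u2\<bar>) powr \<beta>"
    if x: "x1 \<in> {a..b}" "x2 \<in> {a..b}" "\<bar>u1\<bar> \<le> R" "\<bar>u2\<bar> \<le> R" "\<bar>v\<bar> \<le> M" for x1 u1 x2 u2 v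
  proof -
    let ?D = "\<bar>x1 - x2\<bar> + \<bar>u1 - u2\<bar>"
    consider "?D = 0" | "0 < ?D" "?D \<le> 1" | "?D > 1" by linarith
    then show ?thesis
    proof cases
      case 1
      then have "x1 = x2" "u1 = u2" by auto
      then show ?thesis by simp
    next
      case 2
      define t where "t = ?D powr \<beta>"
      have t: "0 < t" "t \<le> 1" using 2 \<beta> by (auto simp: t_def powr_le1)
      have t2: "?D powr (2 * \<beta>) = t\<^sup>2" using 2 by (simp add: t_def power2_eq_square powr_add[symmetric])
      have v1: "\<bar>v + t\<bar> \<le> M + 1" "\<bar>v\<bar> \<le> M + 1" using x t by auto
      have "\<bar>L x1 u1 (v+t) - L x2 u2 (v+t)\<bar> \<le> C' * t\<^sup>2" "\<bar>L x1 u1 v - L x2 u2 v\<bar> \<le> C' * t\<^sup>2"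
        using H1[OF x(1-4) v1(1)] H1[OF x(1-4) v1(2)] t2 by auto
      moreover have "\<bar>L x1 u1 (v + t) - L x1 u1 v - deriv (L x1 u1) v * t\<bar> \<le> N / 2 * t\<^sup>2"
        "\<bar>L x2 u2 (v + t) - L x2 u2 v - deriv (L x2 u2) v * t\<bar> \<le> N / 2 * t\<^sup>2"
        using taylor x t by auto
      moreover have "(deriv (L x1 u1) v - deriv (L x2 u2) v) * t = deriv (L x1 u1) v * t - deriv (L x2 u2) v * t"
        by (simp add: left_diff_distrib)
      ultimately have "\<bar>(deriv (L x1 u1) v - deriv (L x2 u2) v) * t\<bar> \<le> 2 * (C' * t\<^sup>2) + 2 * (N / 2 * t\<^sup>2)" by linarith
      also have "\<dots> = (2 * C' + N) * t\<^sup>2" by (simp add: algebra_simps)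
      also have "\<dots> \<le> K * t\<^sup>2" using K by (intro mult_right_mono) auto
      finally have "\<bar>deriv (L x1 u1) v - deriv (L x2 u2) v\<bar> * t \<le> (K * t) * t"
        using t by (simp add: abs_mult power2_eq_square mult.assoc)
      then show ?thesis using t unfolding t_def[symmetric] by simp
    next
      case 3
      have "\<bar>deriv (L x1 u1) v - deriv (L x2 u2) v\<bar> \<le> K * 1"
        using dB[of x1 u1 v] dB[of x2 u2 v] x K by auto
      also have "\<dots> \<le> K * ?D powr \<beta>"
        using 3 \<beta> K by (intro mult_left_mono ge_one_powr_ge_zero) auto
      finally show ?thesis .
    qed
  qed
  show ?thesis
  proof (rule that[OF K(1) \<beta>(1,2) _ H2])
    show "\<bar>L x1 u1 v - L x2 u2 v\<bar> \<le> K * (\<bar>x1 - x2\<bar> + \<bar>u1 - u2\<bar>) powr (2 * \<beta>)"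
      if "x1 \<in> {a..b}" "x2 \<in> {a..b}" "\<bar>u1\<bar> \<le> R" "\<bar>u2\<bar> \<le> R" "\<bar>v\<bar> \<le> M" for x1 u1 x2 u2 v
      using H1[OF that(1-4), of v] that(5) K(2) by (smt (verit) mult_right_mono powr_ge_zero)
    show "\<bar>L_vv L x u v\<bar> \<le> K" if "x \<in> {a..b}" "\<bar>u\<bar> \<le> R" "\<bar>v\<bar> \<le> M + 1" for x u v
      using N(2)[OF that] K by linarith
    show "\<bar>L x u v\<bar> \<le> K" if "x \<in> {a..b}" "\<bar>u\<bar> \<le> R" "\<bar>v\<bar> \<le> M" for x u v
      using B(2)[of x u v] that K by linarith
    show "\<bar>deriv (L x u) v\<bar> \<le> K" if "x \<in> {a..b}" "\<bar>u\<bar> \<le> R" "\<bar>v\<bar> \<le> M" for x u v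
      using dB[OF that] K by linarith
  qed
qed

section \<open>Comparison with obstacle-shaped competitors\<close>

locale obstacle_minimizer =
  fixes a b A B :: real
    and L :: "real \<Rightarrow> real \<Rightarrow> real \<Rightarrow> real"
    and f g u :: "real \<Rightarrow> real"
    and \<mu> :: real
  assumes ab: "a < b"
    and L_cont: "continuous_on ({a..b} \<times> UNIV \<times> UNIV) (\<lambda>(x, u, v). L x u v)"
    and L_holder: "\<And>G :: (real \<times> real \<times> real) set.
          compact G \<Longrightarrow> G \<subseteq> {a..b} \<times> UNIV \<times> UNIV \<Longrightarrow>
          \<exists>C>0. \<exists>\<alpha>>0. \<forall>(x1, u1, v1)\<in>G. \<forall>(x2, u2, v2)\<in>G.
            \<bar>L x1 u1 v1 - L x2 u2 v2\<bar> \<le> C * (\<bar>x1 - x2\<bar> + \<bar>u1 - u2\<bar> + \<bar>v1 - v2\<bar>) powr \<alpha>"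
    and L_vv_ex: "L_vv_exists L a b"
    and L_vv_cont: "continuous_on ({a..b} \<times> UNIV \<times> UNIV) (\<lambda>(x, u, v). L_vv L x u v)"
    and \<mu>: "\<mu> > 0" "\<And>x u v. x \<in> {a..b} \<Longrightarrow> L_vv L x u v \<ge> \<mu>"
    and f_C1: "C1_on a b f"
    and g_C1: "C1_on a b g"
    and f_less_g: "\<And>x. x \<in> {a..b} \<Longrightarrow> f x < g x"
    and u_min: "is_minimizer L a b (admissible a b A B f g) u"
begin

lemma u_admissible:
  shows "u \<in> W11 a b" "u a = A" "u b = B" "\<And>x. x \<in> {a..b} \<Longrightarrow> f x \<le> u x \<and> u x \<le> g x"
  using u_min unfolding is_minimizer_def admissible_def by auto

lemma u_derivI:
  shows "derivI a b u absolutely_integrable_on {a..b}" "derivI a b u integrable_on {a..b}"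
    "\<And>x. x \<in> {a..b} \<Longrightarrow> u x = u a + integral {a..x} (derivI a b u)"
proof -
  show ai: "derivI a b u absolutely_integrable_on {a..b}" by (rule W11_derivI(1)[OF ab u_admissible(1)])
  then show "derivI a b u integrable_on {a..b}" unfolding absolutely_integrable_on_def by blast
  show "u x = u a + integral {a..x} (derivI a b u)" if "x \<in> {a..b}" for x
    by (rule W11_derivI(2)[OF ab u_admissible(1) that])
qed

lemma continuous_on_obstacles: "continuous_on {a..b} f" "continuous_on {a..b} g" "continuous_on {a..b} u"
proof -
  show "continuous_on {a..b} f" by (rule DERIV_continuous_on[OF C1_on_derivI[OF f_C1]])
  show "continuous_on {a..b} g" by (rule DERIV_continuous_on[OF C1_on_derivI[OF g_C1]])
  have "abs_cont_on a b u" using u_admissible(1) unfolding W11_def by blast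
  then show "continuous_on {a..b} u" by (rule abs_cont_on_imp_continuous_on)
qed

lemma derivI_u_integral:
  assumes "a \<le> c" "c \<le> d" "d \<le> b"
  shows "(derivI a b u has_integral (u d - u c)) {c..d}"
proof -
  have "derivI a b u integrable_on {c..d}"
    by (rule integrable_subinterval_real[OF u_derivI(2)]) (use assms in auto)
  moreover have "integral {c..d} (derivI a b u) = u d - u c"
    using integral_indefinite_diff[OF u_derivI(2) assms] u_derivI(3)[of c] u_derivI(3)[of d] assms by simp
  ultimately show ?thesis by (metis integrable_integral)
qed

section \<open>Integrability of the Lagrangian and local minimality\<close>

lemma convex_lower_bound:
  assumes "x \<in> {a..b}"
  shows "L x r p + deriv (L x r) p * (v - p) + \<mu> / 2 * (v - p)\<^sup>2 \<le> L x r v"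
proof -
  obtain t where t: "L x r v = L x r p + deriv (L x r) p * (v - p) + L_vv L x r t / 2 * (v - p)\<^sup>2"
    by (rule L_vv_Taylor[OF L_vv_ex assms])
  have "\<mu> / 2 * (v - p)\<^sup>2 \<le> L_vv L x r t / 2 * (v - p)\<^sup>2"
    using \<mu>(2)[OF assms] by (intro mult_right_mono) auto
  then show ?thesis using t by simp
qed

text \<open>Provides one range for the second argument of \<open>L\<close> that serves the minimizer
  and all competitors, so that the constants of \<open>L\<close> come from a fixed box.\<close>

lemma obstacle_bound:
  obtains R where "R > 0" "\<And>x r. x \<in> {a..b} \<Longrightarrow> f x \<le> r \<Longrightarrow> r \<le> g x \<Longrightarrow> \<bar>r\<bar> \<le> R"
proof -
  have "bounded (f ` {a..b})" "bounded (g ` {a..b})"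
    using continuous_on_obstacles by (auto intro!: compact_imp_bounded compact_continuous_image)
  then obtain R1 R2 where R: "R1 > 0" "\<forall>x\<in>{a..b}. \<bar>f x\<bar> \<le> R1" "\<forall>x\<in>{a..b}. \<bar>g x\<bar> \<le> R2"
    by (auto simp: bounded_pos)
  show ?thesis
  proof (rule that[of "R1 + \<bar>R2\<bar>"])
    fix x r assume x: "x \<in> {a..b}" "f x \<le> r" "r \<le> g x"
    then have "\<bar>f x\<bar> \<le> R1" "\<bar>g x\<bar> \<le> R2" using R by auto
    then show "\<bar>r\<bar> \<le> R1 + \<bar>R2\<bar>" using x by linarith
  qed (use R in auto)
qed

text \<open>Convexity bounds the Lagrangian below by a parabola in \<open>v\<close> expanded at
  \<open>v = 0\<close>, which is why the constants are taken with \<open>M = 0\<close>; completing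
  the square bounds the parabola uniformly in \<open>x\<close>.\<close>

lemma lagr_bounded_below:
  "\<exists>C. \<forall>x\<in>{a..b}. - C \<le> lagr L a b u x"
proof -
  obtain R where R: "\<And>x. x \<in> {a..b} \<Longrightarrow> \<bar>u x\<bar> \<le> R" 
    by (rule obstacle_bound) (use u_admissible(4) in blast)
  obtain K where K: "K > 0"
    "\<And>x u v. x \<in> {a..b} \<Longrightarrow> \<bar>u\<bar> \<le> R \<Longrightarrow> \<bar>v\<bar> \<le> 0 \<Longrightarrow> \<bar>L x u v\<bar> \<le> K"
    "\<And>x u v. x \<in> {a..b} \<Longrightarrow> \<bar>u\<bar> \<le> R \<Longrightarrow> \<bar>v\<bar> \<le> 0 \<Longrightarrow> \<bar>deriv (L x u) v\<bar> \<le> K"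
    by (rule Lagrangian_constants[OF L_cont L_holder L_vv_ex L_vv_cont, where R=R and M=0]) blast+
  have "- (K + K\<^sup>2 / (2 * \<mu>)) \<le> lagr L a b u x" if x: "x \<in> {a..b}" for x
  proof -
    let ?v = "derivI a b u x" and ?l = "deriv (L x (u x)) 0"
    have l: "\<bar>?l\<bar> \<le> K" and 0: "\<bar>L x (u x) 0\<bar> \<le> K" using K R x by auto
    have "0 \<le> (\<mu> * ?v + ?l)\<^sup>2 / (2 * \<mu>)" using \<mu> by simp
    also have "\<dots> = \<mu> / 2 * ?v\<^sup>2 + ?l * ?v + ?l\<^sup>2 / (2 * \<mu>)"
      using \<mu> by (simp add: field_simps power2_eq_square)
    finally have "- (?l\<^sup>2 / (2 * \<mu>)) \<le> ?l * ?v + \<mu> / 2 * ?v\<^sup>2" by linarith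
    moreover have "?l\<^sup>2 / (2 * \<mu>) \<le> K\<^sup>2 / (2 * \<mu>)"
      using l \<mu> K by (intro divide_right_mono) (auto simp: abs_le_square_iff[symmetric])
    ultimately show ?thesis using convex_lower_bound[OF x, of "u x" 0 ?v] 0 unfolding lagr_def by simp
  qed
  then show ?thesis by blast
qed

text \<open>A minimizer could a priori have infinite energy; a continuously differentiable
  competitor excludes this. It interpolates between the obstacles with an affine weight
  \<open>\<theta>\<close> whose values at \<open>a\<close> and \<open>b\<close> are the relative
  heights of \<open>A\<close> and \<open>B\<close> between them.\<close>

lemma lagr_absolutely_integrable: "lagr L a b u absolutely_integrable_on {a..b}"
proof -
  have meas: "lagr L a b u \<in> borel_measurable (lebesgue_on {a..b})"
    using ab by (intro borel_measurable_lagr L_cont continuous_on_obstacles u_derivI) auto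
  obtain C where low: "\<And>x. x \<in> {a..b} \<Longrightarrow> - C \<le> lagr L a b u x"
    using lagr_bounded_below by blast
  define \<theta>a \<theta>b where "\<theta>a = (A - f a) / (g a - f a)" and "\<theta>b = (B - f b) / (g b - f b)"
  have fa: "f a < g a" "f b < g b" using f_less_g ab by auto
  have uab: "f a \<le> A" "A \<le> g a" "f b \<le> B" "B \<le> g b" using u_admissible(4)[of a] u_admissible(4)[of b] u_admissible(2,3) ab by auto
  have \<theta>: "0 \<le> \<theta>a" "\<theta>a \<le> 1" "0 \<le> \<theta>b" "\<theta>b \<le> 1" using fa uab by (auto simp: \<theta>a_def \<theta>b_def)
  define s where "s = (\<theta>b - \<theta>a) / (b - a)"
  define \<theta> where "\<theta> x = \<theta>a + s * (x - a)" for x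
  have \<theta>x: "0 \<le> \<theta> x \<and> \<theta> x \<le> 1" if "x \<in> {a..b}" for x
  proof -
    define r where "r = (x - a) / (b - a)"
    have r: "0 \<le> r" "r \<le> 1" using that ab by (auto simp: r_def)
    have "\<theta> x = (1 - r) * \<theta>a + r * \<theta>b" 
    proof -
      have "s * (x - a) = (\<theta>b - \<theta>a) * r" by (simp add: s_def r_def)
      then show ?thesis unfolding \<theta>_def by (simp add: algebra_simps)
    qed
    moreover have "0 \<le> (1 - r) * \<theta>a + r * \<theta>b" using r \<theta> by auto
    moreover have "(1 - r) * \<theta>a + r * \<theta>b \<le> (1 - r) * 1 + r * 1" using r \<theta> by (intro add_mono mult_left_mono) auto
    ultimately show ?thesis by simp
  qed
  let ?f' = "derivI a b f" and ?g' = "derivI a b g"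
  define v where "v x = f x + \<theta> x * (g x - f x)" for x
  define v' where "v' x = ?f' x + (s * (g x - f x) + \<theta> x * (?g' x - ?f' x))" for x
  have v': "(v has_field_derivative v' x) (at x within {a..b})" if "x \<in> {a..b}" for x
    unfolding v_def[abs_def] v'_def \<theta>_def
    by (rule derivative_eq_intros C1_on_derivI[OF f_C1 that] C1_on_derivI[OF g_C1 that] refl)+ (simp add: algebra_simps)
  have cv': "continuous_on {a..b} v'"
    using f_C1 g_C1 unfolding v'_def[abs_def] \<theta>_def C1_on_def
    by (intro continuous_intros continuous_on_obstacles) auto
  have cv: "continuous_on {a..b} v" using v' DERIV_continuous_on by blast
  have "v \<in> W11 a b" using C1_in_W11[OF _ v' cv'] ab by simp
  moreover have "\<theta> a = \<theta>a" "\<theta> b = \<theta>b" using ab by (auto simp: \<theta>_def s_def)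
  then have "v a = A" "v b = B" using fa by (auto simp: v_def \<theta>a_def \<theta>b_def)
  moreover have "f x \<le> v x \<and> v x \<le> g x" if "x \<in> {a..b}" for x
  proof -
    have t: "0 \<le> \<theta> x" "\<theta> x \<le> 1" and d: "0 \<le> g x - f x" using \<theta>x[OF that] f_less_g[OF that] by auto
    have "0 \<le> \<theta> x * (g x - f x)" by (rule mult_nonneg_nonneg[OF t(1) d])
    moreover have "\<theta> x * (g x - f x) \<le> g x - f x" by (rule mult_left_le_one_le[OF d t])
    ultimately show ?thesis unfolding v_def by linarith
  qed
  ultimately have adm: "v \<in> admissible a b A B f g" unfolding admissible_def by simp
  have "continuous_on {a..b} ((\<lambda>(x, u, v). L x u v) \<circ> (\<lambda>x. (x, v x, v' x)))"
    by (intro continuous_on_compose continuous_on_subset[OF L_cont] continuous_intros cv cv') auto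
  moreover have "lagr L a b v x = ((\<lambda>(x, u, v). L x u v) \<circ> (\<lambda>x. (x, v x, v' x))) x" if "x \<in> {a..b}" for x
    using derivI_eq[OF ab that v'[OF that]] by (simp add: lagr_def)
  ultimately have "continuous_on {a..b} (lagr L a b v)" by (rule continuous_on_eq[OF _ sym])
  then have "J L a b v = ereal (integral {a..b} (lagr L a b v))"
    by (intro J_eq_integral absolutely_integrable_continuous_real)
  then have "J L a b v < \<infinity>" by simp
  moreover have "J L a b u \<le> J L a b v" using u_min adm unfolding is_minimizer_def by blast
  ultimately have "J L a b u < \<infinity>" by (rule le_less_trans[rotated])
  then show ?thesis using absolutely_integrable_if_J_finite meas low by blast
qed

text \<open>Splicing \<open>w\<close> into \<open>u\<close> over \<open>[c,d]\<close> gives an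
  admissible function because the values match at both ends. Outside \<open>[c,d]\<close> the two
  Lagrangians agree almost everywhere, and since the energy of \<open>u\<close> is finite the common
  part cancels.\<close>

lemma local_minimality:
  assumes cd: "a \<le> c" "c < d" "d \<le> b"
    and w: "\<And>x. x \<in> {c..d} \<Longrightarrow> (w has_field_derivative w' x) (at x within {c..d})"
    and w': "continuous_on {c..d} w'"
    and ends: "w c = u c" "w d = u d"
    and between: "\<And>x. x \<in> {c..d} \<Longrightarrow> f x \<le> w x \<and> w x \<le> g x"
  shows "integral {c..d} (lagr L a b u) \<le> integral {c..d} (\<lambda>x. L x (w x) (w' x))"
proof -
  let ?u' = "derivI a b u" and ?F = "lagr L a b u" and ?G = "\<lambda>x. L x (w x) (w' x)"
  let ?res = "\<lambda>h x. if x \<in> {c..d} then h x else (0::real)"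
  have sub: "{c..d} \<subseteq> {a..b}" using cd by auto
  define v where "v x = (if x \<in> {c..d} then w x else u x)" for x
  \<comment> \<open>The derivative of the spliced function, written as \<open>derivI a b u\<close>
    plus a correction supported on \<open>[c,d]\<close>, whose integral up to \<open>x\<close> is
    exactly \<open>v x - u x\<close>.\<close>
  define z where "z x = ?u' x + ?res (\<lambda>x. w' x - ?u' x) x" for x
  have ai: "?u' absolutely_integrable_on {c..d}" "?F absolutely_integrable_on {c..d}"
    using u_derivI(1) lagr_absolutely_integrable sub absolutely_integrable_on_subinterval cd by blast+
  have w'ai: "w' absolutely_integrable_on {c..d}" using w' absolutely_integrable_continuous_real by blast
  then have h_ai: "(\<lambda>x. w' x - ?u' x) absolutely_integrable_on {c..d}"
    by (intro set_integral_diff ai)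
  then have h_i: "(\<lambda>x. w' x - ?u' x) integrable_on {c..d}" by (simp add: absolutely_integrable_on_def)
  have r_ai: "?res (\<lambda>x. w' x - ?u' x) absolutely_integrable_on {a..b}"
    by (rule absolutely_integrable_restrict_Icc[OF h_ai sub])
  then have z_ai: "z absolutely_integrable_on {a..b}"
    unfolding z_def[abs_def] by (intro set_integral_add u_derivI)
  have int_h: "integral {c..y} (\<lambda>x. w' x - ?u' x) = w y - u y" if "y \<in> {c..d}" for y
  proof -
    have "((\<lambda>x. w' x - ?u' x) has_integral (w y - w c) - (u y - u c)) {c..y}"
      using that cd by (intro has_integral_diff integral_has_field_derivative[OF w] derivI_u_integral) auto
    then show ?thesis using ends by (simp add: integral_unique)
  qed
  have v_eq: "v x = v a + integral {a..x} z" if x: "x \<in> {a..b}" for x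
  proof -
    have sub': "{a..x} \<subseteq> {a..b}" using x by auto
    have i1: "?u' integrable_on {a..x}" by (rule integrable_subinterval_real[OF u_derivI(2) sub'])
    have "?res (\<lambda>x. w' x - ?u' x) integrable_on {a..b}" using r_ai unfolding absolutely_integrable_on_def by blast
    then have i2: "?res (\<lambda>x. w' x - ?u' x) integrable_on {a..x}" by (rule integrable_subinterval_real[OF _ sub'])
    have "integral {a..x} z = integral {a..x} ?u' + integral {a..x} (?res (\<lambda>x. w' x - ?u' x))"
      unfolding z_def by (rule Henstock_Kurzweil_Integration.integral_add[OF i1 i2])
    also have "integral {a..x} (?res (\<lambda>x. w' x - ?u' x)) = integral ({c..d} \<inter> {a..x}) (\<lambda>x. w' x - ?u' x)"
      by (rule Henstock_Kurzweil_Integration.integral_restrict_Int)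
    also have "\<dots> = v x - u x"
    proof -
      consider "x < c" | "x \<in> {c..d}" | "d < x" unfolding atLeastAtMost_iff by linarith
      then show ?thesis
      proof cases
        case 1
        then have "{c..d} \<inter> {a..x} = {}" by auto
        then show ?thesis using 1 by (simp add: v_def)
      next
        case 2
        then have "{c..d} \<inter> {a..x} = {c..x}" using cd by auto
        then show ?thesis using 2 int_h by (simp add: v_def)
      next
        case 3
        then have "{c..d} \<inter> {a..x} = {c..d}" using cd by auto
        then show ?thesis using 3 int_h[of d] ends cd by (simp add: v_def)
      qed
    qed
    finally show ?thesis using u_derivI(3)[OF x] ends cd by (auto simp: v_def)
  qed
  have "v \<in> W11 a b" using indefinite_integral_in_W11[OF _ z_ai v_eq] ab by simp
  moreover have "v a = A" "v b = B" using u_admissible(2,3) ends cd by (auto simp: v_def)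
  moreover have "f x \<le> v x \<and> v x \<le> g x" if "x \<in> {a..b}" for x
    using u_admissible(4)[OF that] between by (simp add: v_def)
  ultimately have adm: "v \<in> admissible a b A B f g" unfolding admissible_def by simp
  obtain N where N: "negligible N" "\<And>x. x \<in> {a..b} - N \<Longrightarrow> derivI a b v x = z x"
    using derivI_indefinite_integral[OF ab _ v_eq] z_ai unfolding absolutely_integrable_on_def by blast
  have cw: "continuous_on {c..d} w" using w DERIV_continuous_on by blast
  have "continuous_on {c..d} ((\<lambda>(x, u, v). L x u v) \<circ> (\<lambda>x. (x, w x, w' x)))"
    by (intro continuous_on_compose continuous_on_subset[OF L_cont] continuous_intros cw w') (use sub in auto)
  then have "continuous_on {c..d} ?G" by (simp add: o_def)
  then have G_ai: "?G absolutely_integrable_on {c..d}" by (rule absolutely_integrable_continuous_real)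
  have d_ai: "(\<lambda>x. ?G x - ?F x) absolutely_integrable_on {c..d}" by (intro set_integral_diff G_ai ai)
  have rd_ai: "?res (\<lambda>x. ?G x - ?F x) absolutely_integrable_on {a..b}"
    by (rule absolutely_integrable_restrict_Icc[OF d_ai sub])
  have eq: "lagr L a b v x = ?F x + ?res (\<lambda>x. ?G x - ?F x) x" if "x \<in> {a..b} - N" for x
    using N(2)[OF that] by (auto simp: lagr_def v_def z_def)
  have sum_ai: "(\<lambda>x. ?F x + ?res (\<lambda>x. ?G x - ?F x) x) absolutely_integrable_on {a..b}"
    by (intro set_integral_add lagr_absolutely_integrable rd_ai)
  have v_ai: "lagr L a b v absolutely_integrable_on {a..b}"
    by (rule absolutely_integrable_spike[OF sum_ai N(1) eq])
  have "integral {a..b} (lagr L a b v) = integral {a..b} (\<lambda>x. ?F x + ?res (\<lambda>x. ?G x - ?F x) x)"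
    by (rule integral_spike[OF N(1)]) (use eq in auto)
  also have "\<dots> = integral {a..b} ?F + integral {a..b} (?res (\<lambda>x. ?G x - ?F x))"
    using lagr_absolutely_integrable rd_ai unfolding absolutely_integrable_on_def
    by (intro Henstock_Kurzweil_Integration.integral_add) auto
  also have "integral {a..b} (?res (\<lambda>x. ?G x - ?F x)) = integral ({c..d} \<inter> {a..b}) (\<lambda>x. ?G x - ?F x)"
    by (rule Henstock_Kurzweil_Integration.integral_restrict_Int)
  also have "{c..d} \<inter> {a..b} = {c..d}" using sub by auto
  also have "integral {c..d} (\<lambda>x. ?G x - ?F x) = integral {c..d} ?G - integral {c..d} ?F"
    using G_ai ai(2) unfolding absolutely_integrable_on_def
    by (intro Henstock_Kurzweil_Integration.integral_diff) auto
  finally have "integral {a..b} (lagr L a b v) = integral {a..b} ?F + (integral {c..d} ?G - integral {c..d} ?F)" .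
  moreover have "J L a b u \<le> J L a b v" using u_min adm unfolding is_minimizer_def by blast
  ultimately show ?thesis
    using J_eq_integral[OF v_ai] J_eq_integral[OF lagr_absolutely_integrable] by simp
qed

end

text \<open>Removes the unknown \<open>m\<close> from the right-hand side of the energy inequality.
  If \<open>m\<close> exceeded the claimed multiple of \<open>y = t + \<omega>\<close>, then
  \<open>y \<le> m\<close>, and \<open>t\<^sup>2 * m\<close>, \<open>t\<^sup>2 * (M + 2)\<close> and
  \<open>\<omega>\<^sup>2\<close> would all be at most a constant times \<open>y * m\<close>;
  dividing by \<open>m\<close> contradicts the excess.\<close>

lemma quadratic_absorption:
  fixes m t \<omega> K M :: real
  assumes "0 \<le> m" "0 \<le> t" "t \<le> 1" "0 \<le> \<omega>" "0 \<le> K" "0 \<le> M"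
    and le: "m\<^sup>2 \<le> K * (t\<^sup>2 * (m + M + 2) + \<omega>\<^sup>2)"
  shows "m \<le> (K + K * (M + 3) + 1) * (t + \<omega>)"
proof (rule ccontr)
  define y where "y = t + \<omega>"
  define Q where "Q = K + K * (M + 3) + 1"
  assume "\<not> ?thesis"
  then have gt: "Q * y < m" by (simp add: y_def Q_def)
  have y: "0 \<le> y" "t \<le> y" "\<omega> \<le> y" and Q: "1 \<le> Q" using assms by (auto simp: y_def Q_def)
  have "0 \<le> Q * y" using y Q by simp
  then have m: "0 < m" using gt by linarith
  have ym: "y \<le> m" using mult_right_mono[of 1 Q y] gt y Q by linarith
  have "t\<^sup>2 * m \<le> y * m"
  proof -
    have "t * t \<le> 1 * y" using assms y by (intro mult_mono) auto
    then show ?thesis using m by (simp add: power2_eq_square mult_right_mono)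
  qed
  moreover have "t\<^sup>2 * (M + 2) \<le> y * m * (M + 2)"
  proof -
    have "t * t \<le> y * m" using assms y ym by (intro mult_mono) auto
    then show ?thesis using assms by (simp add: power2_eq_square mult_right_mono)
  qed
  moreover have "\<omega>\<^sup>2 \<le> y * m"
    using assms y ym unfolding power2_eq_square by (intro mult_mono) auto
  ultimately have "t\<^sup>2 * (m + M + 2) + \<omega>\<^sup>2 \<le> y * m + y * m * (M + 2) + y * m" by (simp add: algebra_simps)
  then have "K * (t\<^sup>2 * (m + M + 2) + \<omega>\<^sup>2) \<le> K * (y * m + y * m * (M + 2) + y * m)"
    using assms by (intro mult_left_mono) auto
  also have "\<dots> = (Q - 1) * y * m" by (simp add: Q_def algebra_simps)
  also have "\<dots> \<le> Q * y * m" using y m by (intro mult_right_mono) auto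
  also have "\<dots> < m * m" using gt m by (intro mult_strict_right_mono) auto
  finally show False using le by (simp add: power2_eq_square)
qed

text \<open>The weight spends \<open>\<mu> / 4\<close>, half of the quadratic gain
  \<open>\<mu> / 2\<close> from convexity, on the error made by freezing the
  \<open>v\<close>-derivative.\<close>

lemma weighted_Young:
  fixes \<mu> k t y :: real
  assumes "\<mu> > 0"
  shows "k * t * \<bar>y\<bar> \<le> \<mu> / 4 * y\<^sup>2 + k\<^sup>2 / \<mu> * t\<^sup>2"
proof -
  define r where "r = \<bar>y\<bar>"
  have "0 \<le> (\<mu> * r - 2 * k * t)\<^sup>2 / (4 * \<mu>)" using assms by simp
  also have "\<dots> = \<mu> / 4 * r\<^sup>2 - k * t * r + k\<^sup>2 / \<mu> * t\<^sup>2"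
    using assms by (simp add: field_simps power2_eq_square)
  finally show ?thesis by (simp add: r_def)
qed

text \<open>The tangent to the parabola at \<open>m\<close>. When \<open>m\<close> is the mean of
  \<open>\<bar>y\<bar>\<close>, integrating the left side gives \<open>\<mu> / 4 * m\<^sup>2\<close>
  per unit length, as Jensen's inequality would, but \<open>y\<^sup>2\<close> need not be
  integrable.\<close>

lemma square_above_tangent:
  fixes \<mu> m y :: real
  assumes "\<mu> > 0"
  shows "\<mu> / 2 * m * \<bar>y\<bar> - \<mu> / 4 * m\<^sup>2 \<le> \<mu> / 4 * y\<^sup>2"
proof -
  define r where "r = \<bar>y\<bar>"
  have "0 \<le> \<mu> / 4 * (r - m)\<^sup>2" using assms by simp
  also have "\<dots> = \<mu> / 4 * r\<^sup>2 - \<mu> / 2 * m * r + \<mu> / 4 * m\<^sup>2"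
    by (simp add: power2_eq_square algebra_simps)
  finally show ?thesis by (simp add: r_def)
qed

section \<open>Energy comparison and the one-step estimate\<close>

context obstacle_minimizer
begin

lemma energy_estimate:
  assumes M: "M \<ge> 0"
  obtains K \<beta> where "K > 0" "\<beta> > 0"
    "\<And>c d w w' \<omega>. \<lbrakk>a \<le> c; c < d; d \<le> b; d - c \<le> 1; \<bar>slope u c d\<bar> \<le> M; 0 \<le> \<omega>; \<omega> \<le> 1;
       \<And>x. x \<in> {c..d} \<Longrightarrow> (w has_field_derivative w' x) (at x within {c..d});
       continuous_on {c..d} w'; w c = u c; w d = u d;
       \<And>x. x \<in> {c..d} \<Longrightarrow> f x \<le> w x \<and> w x \<le> g x;
       \<And>x. x \<in> {c..d} \<Longrightarrow> \<bar>w' x - slope u c d\<bar> \<le> \<omega>\<rbrakk> \<Longrightarrow>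
       integral {c..d} (\<lambda>x. \<bar>derivI a b u x - slope u c d\<bar>) \<le> K * ((d - c) powr \<beta> + \<omega>) * (d - c)"
proof -
  obtain R where R: "\<And>x r. x \<in> {a..b} \<Longrightarrow> f x \<le> r \<Longrightarrow> r \<le> g x \<Longrightarrow> \<bar>r\<bar> \<le> R" using obstacle_bound by blast
  obtain K \<beta> where K: "K > 0" "0 < \<beta>" "\<beta> \<le> 1/2"
    and H1: "\<And>x1 u1 x2 u2 v. x1 \<in> {a..b} \<Longrightarrow> x2 \<in> {a..b} \<Longrightarrow> \<bar>u1\<bar> \<le> R \<Longrightarrow> \<bar>u2\<bar> \<le> R \<Longrightarrow> \<bar>v\<bar> \<le> M \<Longrightarrow>
       \<bar>L x1 u1 v - L x2 u2 v\<bar> \<le> K * (\<bar>x1 - x2\<bar> + \<bar>u1 - u2\<bar>) powr (2 * \<beta>)"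
    and H2: "\<And>x1 u1 x2 u2 v. x1 \<in> {a..b} \<Longrightarrow> x2 \<in> {a..b} \<Longrightarrow> \<bar>u1\<bar> \<le> R \<Longrightarrow> \<bar>u2\<bar> \<le> R \<Longrightarrow> \<bar>v\<bar> \<le> M \<Longrightarrow>
       \<bar>deriv (L x1 u1) v - deriv (L x2 u2) v\<bar> \<le> K * (\<bar>x1 - x2\<bar> + \<bar>u1 - u2\<bar>) powr \<beta>"
    and H3: "\<And>x u v. x \<in> {a..b} \<Longrightarrow> \<bar>u\<bar> \<le> R \<Longrightarrow> \<bar>v\<bar> \<le> M + 1 \<Longrightarrow> \<bar>L_vv L x u v\<bar> \<le> K"
    by (rule Lagrangian_constants[OF L_cont L_holder L_vv_ex L_vv_cont, where R=R and M=M]) blast+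
  \<comment> \<open>The freezing error \<open>E\<close> enters with
    \<open>K + K\<^sup>2 / \<mu>\<close> in the lower bound and \<open>3 / 2 * K\<close> in the
    upper one; \<open>4 * K + K\<^sup>2 / \<mu>\<close> dominates their sum and also the coefficient
    \<open>K\<close> of \<open>\<omega>\<^sup>2\<close>. The factor \<open>4 / \<mu>\<close> clears
    the coefficient of \<open>m\<^sup>2\<close>.\<close>
  define K1 where "K1 = 4 / \<mu> * (4 * K + K\<^sup>2 / \<mu>)"
  have K1: "K1 > 0" 
  proof -
    have "0 < 4 * K + K\<^sup>2 / \<mu>" using K(1) \<mu>(1) by (intro add_pos_nonneg) auto
    then show ?thesis unfolding K1_def using \<mu>(1) by (intro mult_pos_pos) auto
  qed
  define K2 where "K2 = K1 + K1 * (M + 3) + 1"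
  have K2: "K2 > 0" 
  proof -
    have "0 < K1 * (M + 3)" using K1 M by simp
    then show ?thesis unfolding K2_def using K1 by linarith
  qed
  show ?thesis
  proof (rule that[OF K2 K(2)])
    fix c d w w' \<omega>
    assume cd: "a \<le> c" "c < d" "d \<le> b" "d - c \<le> 1" and p: "\<bar>slope u c d\<bar> \<le> M" and \<omega>: "0 \<le> \<omega>" "\<omega> \<le> 1"
      and w: "\<And>x. x \<in> {c..d} \<Longrightarrow> (w has_field_derivative w' x) (at x within {c..d})"
      and w': "continuous_on {c..d} w'" and ends: "w c = u c" "w d = u d"
      and between: "\<And>x. x \<in> {c..d} \<Longrightarrow> f x \<le> w x \<and> w x \<le> g x"
      and close: "\<And>x. x \<in> {c..d} \<Longrightarrow> \<bar>w' x - slope u c d\<bar> \<le> \<omega>"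
    define l where "l = d - c"
    define p where "p = slope u c d"
    define z where "z = derivI a b u"
    define S where "S = integral {c..d} (\<lambda>x. \<bar>z x - p\<bar>)"
    define m where "m = S / l"
    have l: "0 < l" "l \<le> 1" using cd by (auto simp: l_def)
    have pM: "\<bar>p\<bar> \<le> M" using p by (simp add: p_def)
    have pl: "p * l = u d - u c" using l by (simp add: p_def slope_def l_def)
    have sub: "{c..d} \<subseteq> {a..b}" using cd by auto
    have z_ai: "z absolutely_integrable_on {c..d}"
      using u_derivI(1) sub absolutely_integrable_on_subinterval unfolding z_def by blast
    have zp_ai: "(\<lambda>x. z x - p) absolutely_integrable_on {c..d}"
      by (intro set_integral_diff z_ai absolutely_integrable_on_const) simp
    then have zp_i: "(\<lambda>x. \<bar>z x - p\<bar>) integrable_on {c..d}"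
      unfolding absolutely_integrable_on_def by simp
    have S_int: "((\<lambda>x. \<bar>z x - p\<bar>) has_integral S) {c..d}" unfolding S_def by (rule integrable_integral[OF zp_i])
    have zp_int: "((\<lambda>x. z x - p) has_integral (u y - u c - p * (y - c))) {c..y}" if "y \<in> {c..d}" for y
      using has_integral_diff[OF derivI_u_integral has_integral_const_real[of p c y]] that cd
      by (simp add: z_def mult.commute)
    have S0: "0 \<le> S" using S_int by (rule has_integral_nonneg) simp
    have m0: "0 \<le> m" and Sm: "S = m * l" using S0 l by (auto simp: m_def)
    \<comment> \<open>\<open>M\<close> bounds only the mean slope, so the oscillation of
      \<open>u\<close> is estimated by the total deviation \<open>S = m * l\<close>; this is how the
      unknown \<open>m\<close> enters the freezing errors.\<close>
    have u_close: "\<bar>u x - u c\<bar> \<le> l * (m + M)" if x: "x \<in> {c..d}" for x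
    proof -
      have "\<bar>u x - u c - p * (x - c)\<bar> \<le> integral {c..x} (\<lambda>x. \<bar>z x - p\<bar>)"
      proof -
        have "norm (integral {c..x} (\<lambda>x. z x - p)) \<le> integral {c..x} (\<lambda>x. \<bar>z x - p\<bar>)"
          using zp_int[OF x] x by (intro integral_norm_bound_integral integrable_subinterval_real[OF zp_i]) auto
        then show ?thesis using zp_int[OF x] by (simp add: integral_unique)
      qed
      also have "\<dots> \<le> S" unfolding S_def
        using x by (intro integral_subset_le integrable_subinterval_real[OF zp_i] zp_i) auto
      finally have 1: "\<bar>u x - u c - p * (x - c)\<bar> \<le> m * l" using Sm by simp
      have "\<bar>p * (x - c)\<bar> \<le> M * l" using pM x M unfolding abs_mult l_def by (intro mult_mono) auto
      then have "\<bar>u x - u c\<bar> \<le> m * l + M * l" using 1 by linarith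
      then show ?thesis by (simp add: algebra_simps)
    qed
    have w_close: "\<bar>w x - u c\<bar> \<le> l * (M + 1)" if x: "x \<in> {c..d}" for x
    proof -
      have "(w' has_integral (w x - w c)) {c..x}" using x by (intro integral_has_field_derivative[OF w]) auto
      moreover have "norm (w' t) \<le> M + 1" if "t \<in> {c..x}" for t
      proof -
        have "t \<in> {c..d}" using x that by auto
        then show ?thesis using close[of t] pM \<omega> unfolding p_def real_norm_def by linarith
      qed
      ultimately have "norm (w x - w c) \<le> (M + 1) * (x - c)"
        using has_integral_bound_real[of "M+1" "{}" w' "w x - w c" c x] M x by auto
      also have "\<dots> \<le> (M + 1) * l" using x M by (intro mult_left_mono) (auto simp: l_def)
      finally show ?thesis using ends by (simp add: mult.commute)
    qed
    \<comment> \<open>\<open>D\<close> dominates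
      \<open>\<bar>x - c\<bar> + \<bar>r - u c\<bar>\<close> for \<open>r = u x\<close> and for
      \<open>r = w x\<close> alike: the first summand is at most \<open>l\<close>, the second at
      most \<open>l * (m + M + 1)\<close>.\<close>
    define D where "D = l * (m + M + 2)"
    define E where "E = D powr (2 * \<beta>)"
    have D0: "0 < D" using l m0 M by (simp add: D_def)
    have E0: "0 \<le> E" by (simp add: E_def)
    have E_sq: "(D powr \<beta>)\<^sup>2 = E" using D0 by (simp add: E_def power2_eq_square powr_add[symmetric])
    have c_in: "c \<in> {a..b}" using cd by auto
    have uc: "\<bar>u c\<bar> \<le> R" using R u_admissible(4) c_in by blast
    define L0 where "L0 = L c (u c) p"
    define \<kappa> where "\<kappa> = deriv (L c (u c)) p"
    have near: "\<bar>L x r p - L0\<bar> \<le> K * E" "\<bar>deriv (L x r) p - \<kappa>\<bar> \<le> K * D powr \<beta>"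
      if x: "x \<in> {c..d}" and r: "f x \<le> r" "r \<le> g x" "\<bar>r - u c\<bar> \<le> l * (m + M + 1)" for x r
    proof -
      have x': "x \<in> {a..b}" using x sub by blast
      have rR: "\<bar>r\<bar> \<le> R" using R[OF x'] r by blast
      have "\<bar>x - c\<bar> \<le> l" using x by (auto simp: l_def)
      then have le: "\<bar>x - c\<bar> + \<bar>r - u c\<bar> \<le> D" using r(3) unfolding D_def by (simp add: algebra_simps)
      have "\<bar>L x r p - L0\<bar> \<le> K * (\<bar>x - c\<bar> + \<bar>r - u c\<bar>) powr (2 * \<beta>)"
        unfolding L0_def by (rule H1[OF x' c_in rR uc pM])
      also have "\<dots> \<le> K * E" unfolding E_def using le K by (intro mult_left_mono powr_mono2) auto
      finally show "\<bar>L x r p - L0\<bar> \<le> K * E" .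
      have "\<bar>deriv (L x r) p - \<kappa>\<bar> \<le> K * (\<bar>x - c\<bar> + \<bar>r - u c\<bar>) powr \<beta>"
        unfolding \<kappa>_def by (rule H2[OF x' c_in rR uc pM])
      also have "\<dots> \<le> K * D powr \<beta>" using le K by (intro mult_left_mono powr_mono2) auto
      finally show "\<bar>deriv (L x r) p - \<kappa>\<bar> \<le> K * D powr \<beta>" .
    qed
    \<comment> \<open>Both bounds are combinations of functions with known integral over
      \<open>[c,d]\<close>: constants, terms of mean zero and, in the lower bound,
      \<open>\<bar>z x - p\<bar>\<close>.\<close>
    let ?lo = "\<lambda>x. (L0 - (K + K\<^sup>2 / \<mu>) * E - \<mu> / 4 * m\<^sup>2) + \<kappa> * (z x - p) + \<mu> / 2 * m * \<bar>z x - p\<bar>"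
    let ?hi = "\<lambda>x. (L0 + 3 / 2 * K * E + K * \<omega>\<^sup>2) + \<kappa> * (w' x - p)"
    have lower: "?lo x \<le> lagr L a b u x" if x: "x \<in> {c..d}" for x
    proof -
      have x': "x \<in> {a..b}" using x sub by blast
      let ?y = "z x - p"
      have "l * (m + M) \<le> l * (m + M + 1)" using l by simp
      then have ux: "\<bar>u x - u c\<bar> \<le> l * (m + M + 1)" using u_close[OF x] by linarith
      note n = near[OF x conjunct1[OF u_admissible(4)[OF x']] conjunct2[OF u_admissible(4)[OF x']] ux]
      have "L x (u x) p + deriv (L x (u x)) p * ?y + \<mu> / 2 * ?y\<^sup>2 \<le> lagr L a b u x"
        unfolding lagr_def z_def by (rule convex_lower_bound[OF x'])
      moreover have "L0 - K * E \<le> L x (u x) p" using n(1) by linarith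
      moreover have "\<kappa> * ?y - K * D powr \<beta> * \<bar>?y\<bar> \<le> deriv (L x (u x)) p * ?y"
      proof -
        have "\<bar>(deriv (L x (u x)) p - \<kappa>) * ?y\<bar> \<le> K * D powr \<beta> * \<bar>?y\<bar>"
          unfolding abs_mult by (rule mult_right_mono[OF n(2)]) simp
        moreover have "(deriv (L x (u x)) p - \<kappa>) * ?y = deriv (L x (u x)) p * ?y - \<kappa> * ?y" by (rule left_diff_distrib)
        ultimately show ?thesis by linarith
      qed
      moreover have "K * D powr \<beta> * \<bar>?y\<bar> \<le> \<mu> / 4 * ?y\<^sup>2 + K\<^sup>2 / \<mu> * E"
        using weighted_Young[OF \<mu>(1), of K "D powr \<beta>" ?y] unfolding E_sq .
      moreover have "\<mu> / 2 * m * \<bar>?y\<bar> - \<mu> / 4 * m\<^sup>2 \<le> \<mu> / 4 * ?y\<^sup>2"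
        by (rule square_above_tangent[OF \<mu>(1)])
      moreover have "(K + K\<^sup>2 / \<mu>) * E = K * E + K\<^sup>2 / \<mu> * E" "\<mu> / 2 * ?y\<^sup>2 = \<mu> / 4 * ?y\<^sup>2 + \<mu> / 4 * ?y\<^sup>2"
        by (rule distrib_right) simp
      ultimately show ?thesis by linarith
    qed
    have upper: "L x (w x) (w' x) \<le> ?hi x" if x: "x \<in> {c..d}" for x
    proof -
      have x': "x \<in> {a..b}" using x sub by blast
      let ?y = "w' x - p"
      have y: "\<bar>?y\<bar> \<le> \<omega>" using close[OF x] by (simp add: p_def)
      have "l * (M + 1) \<le> l * (m + M + 1)" using l m0 by simp
      then have wx: "\<bar>w x - u c\<bar> \<le> l * (m + M + 1)" using w_close[OF x] by linarith
      note n = near[OF x conjunct1[OF between[OF x]] conjunct2[OF between[OF x]] wx]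
      obtain t where t: "min p (w' x) \<le> t" "t \<le> max p (w' x)"
        "L x (w x) (w' x) = L x (w x) p + deriv (L x (w x)) p * ?y + L_vv L x (w x) t / 2 * ?y\<^sup>2"
        by (rule L_vv_Taylor[OF L_vv_ex x'])
      have "\<bar>t\<bar> \<le> M + 1" using t(1,2) y pM \<omega> by linarith
      then have tK: "\<bar>L_vv L x (w x) t\<bar> \<le> K" using H3[OF x'] R[OF x'] between[OF x] by blast
      have "?y\<^sup>2 \<le> \<omega>\<^sup>2" using y \<omega> by (simp add: abs_le_square_iff[symmetric])
      then have "L_vv L x (w x) t / 2 * ?y\<^sup>2 \<le> K / 2 * \<omega>\<^sup>2" using tK K by (intro mult_mono) auto
      moreover have "L x (w x) p \<le> L0 + K * E" using n(1) by linarith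
      moreover have "deriv (L x (w x)) p * ?y \<le> \<kappa> * ?y + K * D powr \<beta> * \<omega>"
      proof -
        have "\<bar>(deriv (L x (w x)) p - \<kappa>) * ?y\<bar> \<le> K * D powr \<beta> * \<omega>"
          unfolding abs_mult using n(2) y K by (intro mult_mono) auto
        moreover have "(deriv (L x (w x)) p - \<kappa>) * ?y = deriv (L x (w x)) p * ?y - \<kappa> * ?y" by (rule left_diff_distrib)
        ultimately show ?thesis by linarith
      qed
      moreover have "K * D powr \<beta> * \<omega> \<le> K / 2 * E + K / 2 * \<omega>\<^sup>2"
      proof -
        have "0 \<le> K / 2 * (D powr \<beta> - \<omega>)\<^sup>2" using K by simp
        then show ?thesis unfolding power2_diff E_sq by (simp add: algebra_simps)
      qed
      ultimately show ?thesis using t(3) by (simp add: algebra_simps)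
    qed
    have "(?lo has_integral (L0 - (K + K\<^sup>2 / \<mu>) * E - \<mu> / 4 * m\<^sup>2) * l + \<kappa> * 0 + \<mu> / 2 * m * S) {c..d}"
    proof (intro has_integral_add has_integral_mult_right)
      show "((\<lambda>x. L0 - (K + K\<^sup>2 / \<mu>) * E - \<mu> / 4 * m\<^sup>2) has_integral (L0 - (K + K\<^sup>2 / \<mu>) * E - \<mu> / 4 * m\<^sup>2) * l) {c..d}"
        using has_integral_const_real[of "L0 - (K + K\<^sup>2 / \<mu>) * E - \<mu> / 4 * m\<^sup>2" c d] cd by (simp add: l_def mult.commute)
      show "((\<lambda>x. z x - p) has_integral 0) {c..d}" using zp_int[of d] pl cd by (simp add: l_def)
    qed (rule S_int)
    moreover have "(L0 - (K + K\<^sup>2 / \<mu>) * E - \<mu> / 4 * m\<^sup>2) * l + \<kappa> * 0 + \<mu> / 2 * m * S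
        = (L0 - (K + K\<^sup>2 / \<mu>) * E + \<mu> / 4 * m\<^sup>2) * l"
      unfolding Sm by (simp add: algebra_simps power2_eq_square)
    ultimately have lo: "(?lo has_integral (L0 - (K + K\<^sup>2 / \<mu>) * E + \<mu> / 4 * m\<^sup>2) * l) {c..d}" by simp
    have "(?hi has_integral (L0 + 3 / 2 * K * E + K * \<omega>\<^sup>2) * l + \<kappa> * 0) {c..d}"
    proof (intro has_integral_add has_integral_mult_right)
      show "((\<lambda>x. L0 + 3 / 2 * K * E + K * \<omega>\<^sup>2) has_integral (L0 + 3 / 2 * K * E + K * \<omega>\<^sup>2) * l) {c..d}"
        using has_integral_const_real[of "L0 + 3 / 2 * K * E + K * \<omega>\<^sup>2" c d] cd by (simp add: l_def mult.commute)
      have "((\<lambda>x. w' x - p) has_integral (w d - w c) - p * l) {c..d}"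
        using has_integral_diff[OF integral_has_field_derivative[OF w] has_integral_const_real[of p c d]] cd
        by (simp add: l_def mult.commute)
      then show "((\<lambda>x. w' x - p) has_integral 0) {c..d}" using pl ends by simp
    qed
    then have hi: "(?hi has_integral (L0 + 3 / 2 * K * E + K * \<omega>\<^sup>2) * l) {c..d}" by simp
    have F_i: "lagr L a b u integrable_on {c..d}"
      using lagr_absolutely_integrable integrable_subinterval_real[OF _ sub] unfolding absolutely_integrable_on_def by blast
    have cw: "continuous_on {c..d} w" using w DERIV_continuous_on by blast
    have "continuous_on {c..d} ((\<lambda>(x, u, v). L x u v) \<circ> (\<lambda>x. (x, w x, w' x)))"
      by (intro continuous_on_compose continuous_on_subset[OF L_cont] continuous_intros cw w') (use sub in auto)
    then have G_i: "(\<lambda>x. L x (w x) (w' x)) integrable_on {c..d}"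
      by (intro integrable_continuous_real) (simp add: o_def)
    have "(L0 - (K + K\<^sup>2 / \<mu>) * E + \<mu> / 4 * m\<^sup>2) * l \<le> integral {c..d} (lagr L a b u)"
      by (rule has_integral_le[OF lo integrable_integral[OF F_i] lower])
    also have "\<dots> \<le> integral {c..d} (\<lambda>x. L x (w x) (w' x))"
      by (rule local_minimality[OF cd(1-3) w w' ends between])
    also have "\<dots> \<le> (L0 + 3 / 2 * K * E + K * \<omega>\<^sup>2) * l"
      by (rule has_integral_le[OF integrable_integral[OF G_i] hi upper])
    finally have "L0 - (K + K\<^sup>2 / \<mu>) * E + \<mu> / 4 * m\<^sup>2 \<le> L0 + 3 / 2 * K * E + K * \<omega>\<^sup>2"
      using l by simp
    then have "\<mu> / 4 * m\<^sup>2 \<le> (5 / 2 * K + K\<^sup>2 / \<mu>) * E + K * \<omega>\<^sup>2" by (simp add: algebra_simps)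
    also have "\<dots> \<le> (4 * K + K\<^sup>2 / \<mu>) * E + (4 * K + K\<^sup>2 / \<mu>) * \<omega>\<^sup>2"
      using K \<mu> E0 by (intro add_mono mult_right_mono) auto
    finally have "4 / \<mu> * (\<mu> / 4 * m\<^sup>2) \<le> 4 / \<mu> * ((4 * K + K\<^sup>2 / \<mu>) * E + (4 * K + K\<^sup>2 / \<mu>) * \<omega>\<^sup>2)"
      using \<mu> by (intro mult_left_mono) auto
    moreover have "4 / \<mu> * (\<mu> / 4 * m\<^sup>2) = m\<^sup>2" using \<mu> by simp
    moreover have "4 / \<mu> * ((4 * K + K\<^sup>2 / \<mu>) * E + (4 * K + K\<^sup>2 / \<mu>) * \<omega>\<^sup>2) = K1 * (E + \<omega>\<^sup>2)"
    proof -
      have "k * (q * e + q * o2) = k * q * (e + o2)" for k q e o2 :: real by (simp add: algebra_simps)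
      then show ?thesis unfolding K1_def .
    qed
    ultimately have m2: "m\<^sup>2 \<le> K1 * (E + \<omega>\<^sup>2)" by (simp only:)
    define t where "t = l powr \<beta>"
    have t: "0 \<le> t" "t \<le> 1" using l K by (auto simp: t_def powr_le1)
    \<comment> \<open>Here \<open>2 * \<beta> \<le> 1\<close> together with
      \<open>m + M + 2 \<ge> 1\<close> makes the dependence on \<open>m\<close> linear.\<close>
    have "E \<le> t\<^sup>2 * (m + M + 2)"
    proof -
      have "E = l powr (2 * \<beta>) * (m + M + 2) powr (2 * \<beta>)"
        unfolding E_def D_def using l m0 M by (simp add: powr_mult)
      also have "l powr (2 * \<beta>) = t\<^sup>2" using l by (simp add: t_def power2_eq_square powr_add[symmetric])
      also have "(m + M + 2) powr (2 * \<beta>) \<le> (m + M + 2) powr 1" using m0 M K by (intro powr_mono) auto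
      finally show ?thesis using m0 M by (simp add: mult_left_mono)
    qed
    then have "K1 * (E + \<omega>\<^sup>2) \<le> K1 * (t\<^sup>2 * (m + M + 2) + \<omega>\<^sup>2)" using K1 by (intro mult_left_mono) auto
    then have "m\<^sup>2 \<le> K1 * (t\<^sup>2 * (m + M + 2) + \<omega>\<^sup>2)" using m2 by linarith
    then have "m \<le> K2 * (t + \<omega>)"
      unfolding K2_def using m0 t \<omega> K1 M by (intro quadratic_absorption) auto
    then have "m * l \<le> K2 * (t + \<omega>) * l" using l by (intro mult_right_mono) auto
    then show "integral {c..d} (\<lambda>x. \<bar>derivI a b u x - slope u c d\<bar>) \<le> K2 * ((d - c) powr \<beta> + \<omega>) * (d - c)"
      using Sm unfolding S_def z_def p_def t_def l_def by simp
  qed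
qed

text \<open>\<open>w - h\<close> is the chord of \<open>u - h\<close>, so \<open>w\<close> stays on
  the right side of \<open>h\<close>. At \<open>c\<close> the value of \<open>u\<close> is at least
  \<open>4 * \<eta>\<close> away from the other obstacle; \<open>w\<close> moves by at most
  \<open>3 * \<eta>\<close> and that obstacle by at most \<open>\<eta>\<close>, which explains the
  factor \<open>8\<close> in \<open>gap\<close>.\<close>

lemma obstacle_competitor:
  assumes cd: "a \<le> c" "c < d" "d \<le> b"
    and h: "h = f \<or> h = g"
    and var: "\<And>x y. x \<in> {c..d} \<Longrightarrow> y \<in> {c..d} \<Longrightarrow> \<bar>u x - u y\<bar> \<le> \<eta> \<and> \<bar>f x - f y\<bar> \<le> \<eta> \<and> \<bar>g x - g y\<bar> \<le> \<eta>"
    and gap: "8 * \<eta> \<le> g c - f c"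
    and side: "if h = f then u c \<le> (f c + g c) / 2 else (f c + g c) / 2 \<le> u c"
    and w: "\<And>x. w x = u c + slope u c d * (x - c) + (h x - h c - slope h c d * (x - c))"
  shows "w c = u c" "w d = u d" "\<And>x. x \<in> {c..d} \<Longrightarrow> f x \<le> w x \<and> w x \<le> g x"
proof -
  show "w c = u c" by (simp add: w)
  show "w d = u d" using cd by (simp add: w slope_def)
  fix x assume x: "x \<in> {c..d}"
  define r where "r = (x - c) / (d - c)"
  have r: "0 \<le> r" "r \<le> 1" using x cd by (auto simp: r_def)
  have sl: "slope k c d * (x - c) = r * (k d - k c)" for k by (simp add: slope_def r_def)
  have small: "\<bar>r * (k d - k c)\<bar> \<le> \<eta>" if "\<bar>k d - k c\<bar> \<le> \<eta>" for k :: "real \<Rightarrow> real"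
    using mult_mono[OF r(2) that] r by (simp add: abs_mult)
  have w_eq: "w x - h x = (1 - r) * (u c - h c) + r * (u d - h d)"
    unfolding w sl by (simp add: algebra_simps)
  have near: "\<bar>w x - u c\<bar> \<le> 3 * \<eta>"
  proof -
    have "\<bar>r * (u d - u c)\<bar> \<le> \<eta>" using var[of d c] cd by (intro small) auto
    moreover have "\<bar>r * (h d - h c)\<bar> \<le> \<eta>" using var[of d c] cd h by (intro small) auto
    moreover have "\<bar>h x - h c\<bar> \<le> \<eta>" using var[OF x, of c] cd h by auto
    ultimately show ?thesis unfolding w sl by linarith
  qed
  have fx: "\<bar>f x - f c\<bar> \<le> \<eta>" "\<bar>g x - g c\<bar> \<le> \<eta>" using var[OF x, of c] cd by auto
  have ends: "f c \<le> u c" "u c \<le> g c" "f d \<le> u d" "u d \<le> g d" using u_admissible(4)[of c] u_admissible(4)[of d] cd by auto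
  show "f x \<le> w x \<and> w x \<le> g x"
  proof (cases "h = f")
    case True
    have "0 \<le> (1 - r) * (u c - h c) + r * (u d - h d)" using r ends True by simp
    then have "f x \<le> w x" using w_eq True by simp
    moreover have "w x \<le> g x" using near fx gap side True by simp
    ultimately show ?thesis by simp
  next
    case False
    then have hg: "h = g" using h by simp
    have "(1 - r) * (u c - h c) + r * (u d - h d) \<le> 0"
      using r ends hg by (intro add_nonpos_nonpos mult_nonneg_nonpos) auto
    then have "w x \<le> g x" using w_eq hg by simp
    moreover have "f x \<le> w x" using near fx gap side False by simp
    ultimately show ?thesis by simp
  qed
qed

lemma uniform_smallness:
  assumes "\<eta> > 0"
  obtains l where "l > 0" "\<And>x y. x \<in> {a..b} \<Longrightarrow> y \<in> {a..b} \<Longrightarrow> \<bar>x - y\<bar> \<le> l \<Longrightarrow>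
     \<bar>u x - u y\<bar> \<le> \<eta> \<and> \<bar>f x - f y\<bar> \<le> \<eta> \<and> \<bar>g x - g y\<bar> \<le> \<eta>"
proof -
  have uc: "\<exists>l>0. \<forall>x\<in>{a..b}. \<forall>y\<in>{a..b}. \<bar>x - y\<bar> < l \<longrightarrow> \<bar>k x - k y\<bar> \<le> \<eta>"
    if "continuous_on {a..b} k" for k :: "real \<Rightarrow> real"
    using compact_uniformly_continuous[OF that compact_Icc] assms
    unfolding uniformly_continuous_on_def dist_real_def by (meson abs_minus_commute less_imp_le)
  obtain l1 l2 l3 where l: "l1 > 0" "l2 > 0" "l3 > 0"
    "\<forall>x\<in>{a..b}. \<forall>y\<in>{a..b}. \<bar>x - y\<bar> < l1 \<longrightarrow> \<bar>u x - u y\<bar> \<le> \<eta>"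
    "\<forall>x\<in>{a..b}. \<forall>y\<in>{a..b}. \<bar>x - y\<bar> < l2 \<longrightarrow> \<bar>f x - f y\<bar> \<le> \<eta>"
    "\<forall>x\<in>{a..b}. \<forall>y\<in>{a..b}. \<bar>x - y\<bar> < l3 \<longrightarrow> \<bar>g x - g y\<bar> \<le> \<eta>"
    using uc[OF continuous_on_obstacles(1)] uc[OF continuous_on_obstacles(2)] uc[OF continuous_on_obstacles(3)] by blast
  show ?thesis
  proof (rule that[of "min l1 (min l2 l3) / 2"])
    fix x y assume xy: "x \<in> {a..b}" "y \<in> {a..b}" "\<bar>x - y\<bar> \<le> min l1 (min l2 l3) / 2"
    then have "\<bar>x - y\<bar> < l1" "\<bar>x - y\<bar> < l2" "\<bar>x - y\<bar> < l3" using l(1-3) by linarith+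
    then show "\<bar>u x - u y\<bar> \<le> \<eta> \<and> \<bar>f x - f y\<bar> \<le> \<eta> \<and> \<bar>g x - g y\<bar> \<le> \<eta>" using l xy by blast
  qed (use l in auto)
qed

lemma obstacle_gap:
  obtains \<eta> where "\<eta> > 0" "\<And>x. x \<in> {a..b} \<Longrightarrow> 8 * \<eta> \<le> g x - f x"
proof -
  have "continuous_on {a..b} (\<lambda>x. g x - f x)" by (intro continuous_intros continuous_on_obstacles)
  then obtain x0 where x0: "x0 \<in> {a..b}" "\<forall>x\<in>{a..b}. g x0 - f x0 \<le> g x - f x"
    using continuous_attains_inf[of "{a..b}" "\<lambda>x. g x - f x"] ab by auto
  show ?thesis
  proof (rule that[of "(g x0 - f x0) / 8"])
    show "8 * ((g x0 - f x0) / 8) \<le> g x - f x" if "x \<in> {a..b}" for x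
      using bspec[OF x0(2) that] by simp
  qed (use f_less_g[OF x0(1)] in simp)
qed

text \<open>The mean of \<open>\<bar>derivI a b u x - slope u c d\<bar>\<close> at most doubles when
  passing from \<open>[c,d]\<close> to a subinterval of at least half its length; hence the factor
  \<open>2\<close> in \<open>\<eta>\<close>. Dyadic sums of \<open>\<eta>\<close> are small because
  those of the power and of both moduli are.\<close>

lemma one_step_estimate:
  assumes dini_f: "dini_condition a b (derivI a b f) 1 1" and dini_g: "dini_condition a b (derivI a b g) 1 1"
  shows "\<exists>l0>0. \<exists>\<eta>. (\<forall>l>0. 0 \<le> \<eta> l) \<and>
     (\<forall>c d x y. a \<le> c \<longrightarrow> c < d \<longrightarrow> d \<le> b \<longrightarrow> d - c \<le> l0 \<longrightarrow> \<bar>slope u c d\<bar> \<le> M \<longrightarrow>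
        c \<le> x \<longrightarrow> x < y \<longrightarrow> y \<le> d \<longrightarrow> (d - c) / 2 \<le> y - x \<longrightarrow> \<bar>slope u x y - slope u c d\<bar> \<le> \<eta> (d - c)) \<and>
     (\<forall>\<delta>>0. \<exists>\<epsilon>>0. \<forall>l. 0 < l \<longrightarrow> l \<le> \<epsilon> \<longrightarrow> (\<forall>n. (\<Sum>i<n. \<eta> (l / 2^i)) \<le> \<delta>))"
proof -
  let ?f' = "derivI a b f" and ?g' = "derivI a b g"
  have cf: "continuous_on {a..b} ?f'" and cg: "continuous_on {a..b} ?g'" using f_C1 g_C1 by (auto simp: C1_on_def)
  have ab': "a \<le> b" using ab by simp
  define \<omega> where "\<omega> l = modulus a b ?f' l + modulus a b ?g' l" for l
  have m0: "0 \<le> modulus a b ?f' l" "0 \<le> modulus a b ?g' l" if "l > 0" for l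
    using modulus_nonneg[OF cf ab'] modulus_nonneg[OF cg ab'] that by auto
  \<comment> \<open>The one-step property is claimed for every real \<open>M\<close>, the energy
    estimate only for nonnegative ones, hence \<open>max M 0\<close>.\<close>
  show ?thesis
  proof (rule energy_estimate[of "max M 0"])
    show "0 \<le> max M 0" by simp
  next
    fix K \<beta> assume K: "K > 0" "\<beta> > 0" and
      energy: "\<And>c d w w' \<omega>. \<lbrakk>a \<le> c; c < d; d \<le> b; d - c \<le> 1; \<bar>slope u c d\<bar> \<le> max M 0; 0 \<le> \<omega>; \<omega> \<le> 1;
         \<And>x. x \<in> {c..d} \<Longrightarrow> (w has_field_derivative w' x) (at x within {c..d});
         continuous_on {c..d} w'; w c = u c; w d = u d;
         \<And>x. x \<in> {c..d} \<Longrightarrow> f x \<le> w x \<and> w x \<le> g x;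
         \<And>x. x \<in> {c..d} \<Longrightarrow> \<bar>w' x - slope u c d\<bar> \<le> \<omega>\<rbrakk> \<Longrightarrow>
         integral {c..d} (\<lambda>x. \<bar>derivI a b u x - slope u c d\<bar>) \<le> K * ((d - c) powr \<beta> + \<omega>) * (d - c)"
    define \<eta> where "\<eta> l = 2 * K * (l powr \<beta> + \<omega> l)" for l
    have \<omega>0: "0 \<le> \<omega> l" if "l > 0" for l using m0[OF that] by (simp add: \<omega>_def)
    have \<eta>0: "0 \<le> \<eta> l" if "l > 0" for l using \<omega>0[OF that] K by (simp add: \<eta>_def)
    have \<omega>_sum: "\<exists>\<epsilon>>0. \<forall>l. 0 < l \<longrightarrow> l \<le> \<epsilon> \<longrightarrow> (\<forall>n. (\<Sum>i<n. \<omega> (l / 2^i)) \<le> \<delta>)" if "\<delta> > 0" for \<delta>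
    proof -
      obtain e1 where e1: "e1 > 0" "\<forall>l. 0 < l \<longrightarrow> l \<le> e1 \<longrightarrow> (\<forall>n. (\<Sum>i<n. modulus a b ?f' (l / 2^i)) \<le> \<delta>/2)"
        using sum_modulus_small[OF cf ab' dini_f half_gt_zero[OF \<open>\<delta> > 0\<close>]] by blast
      obtain e2 where e2: "e2 > 0" "\<forall>l. 0 < l \<longrightarrow> l \<le> e2 \<longrightarrow> (\<forall>n. (\<Sum>i<n. modulus a b ?g' (l / 2^i)) \<le> \<delta>/2)"
        using sum_modulus_small[OF cg ab' dini_g half_gt_zero[OF \<open>\<delta> > 0\<close>]] by blast
      have "(\<Sum>i<n. \<omega> (l / 2^i)) \<le> \<delta>" if l: "0 < l" "l \<le> min e1 e2" for l n
      proof -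
        have "(\<Sum>i<n. modulus a b ?f' (l / 2^i)) \<le> \<delta>/2" "(\<Sum>i<n. modulus a b ?g' (l / 2^i)) \<le> \<delta>/2"
          using e1(2) e2(2) l by simp_all
        then show ?thesis unfolding \<omega>_def sum.distrib by linarith
      qed
      then show ?thesis using e1(1) e2(1) by (intro exI[of _ "min e1 e2"]) simp
    qed
    have \<eta>_sum: "\<exists>\<epsilon>>0. \<forall>l. 0 < l \<longrightarrow> l \<le> \<epsilon> \<longrightarrow> (\<forall>n. (\<Sum>i<n. \<eta> (l / 2^i)) \<le> \<delta>)" if \<delta>: "\<delta> > 0" for \<delta>
    proof -
      define \<delta>' where "\<delta>' = \<delta> / (4 * K)"
      have \<delta>': "\<delta>' > 0" using \<delta> K by (simp add: \<delta>'_def)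
      obtain e1 where e1: "e1 > 0" "\<forall>l. 0 < l \<longrightarrow> l \<le> e1 \<longrightarrow> (\<forall>n. (\<Sum>i<n. \<omega> (l / 2^i)) \<le> \<delta>')"
        using \<omega>_sum[OF \<delta>'] by blast
      obtain e2 where e2: "e2 > 0" "\<forall>l. 0 < l \<longrightarrow> l \<le> e2 \<longrightarrow> (\<forall>n. (\<Sum>i<n. (l / 2^i) powr \<beta>) \<le> \<delta>')"
        using sum_powr_small[OF K(2) \<delta>'] by blast
      have "(\<Sum>i<n. \<eta> (l / 2^i)) \<le> \<delta>" if l: "0 < l" "l \<le> min e1 e2" for l n
      proof -
        have "(\<Sum>i<n. \<omega> (l / 2^i)) \<le> \<delta>'" "(\<Sum>i<n. (l / 2^i) powr \<beta>) \<le> \<delta>'" using e1(2) e2(2) l by simp_all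
        then have "2 * K * ((\<Sum>i<n. (l / 2^i) powr \<beta>) + (\<Sum>i<n. \<omega> (l / 2^i))) \<le> 2 * K * (\<delta>' + \<delta>')"
          using K by (intro mult_left_mono) auto
        also have "\<dots> = \<delta>" using K by (simp add: \<delta>'_def)
        finally show ?thesis unfolding \<eta>_def sum.distrib[symmetric] sum_distrib_left .
      qed
      then show ?thesis using e1(1) e2(1) by (intro exI[of _ "min e1 e2"]) simp
    qed
    obtain e where e: "e > 0" "\<forall>l. 0 < l \<longrightarrow> l \<le> e \<longrightarrow> (\<forall>n. (\<Sum>i<n. \<omega> (l / 2^i)) \<le> 1)"
      using \<omega>_sum[of 1] by auto
    \<comment> \<open>The bound on the sums with a single term; the energy estimate admits only
      deviations \<open>\<omega> \<le> 1\<close>.\<close>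
    have \<omega>1: "\<omega> l \<le> 1" if "0 < l" "l \<le> e" for l
      using spec[OF mp[OF mp[OF spec[OF e(2)] that(1)] that(2)], of 1] by simp
    obtain \<zeta> where \<zeta>: "\<zeta> > 0" "\<And>x. x \<in> {a..b} \<Longrightarrow> 8 * \<zeta> \<le> g x - f x" using obstacle_gap by blast
    obtain l1 where l1: "l1 > 0" "\<And>x y. x \<in> {a..b} \<Longrightarrow> y \<in> {a..b} \<Longrightarrow> \<bar>x - y\<bar> \<le> l1 \<Longrightarrow>
       \<bar>u x - u y\<bar> \<le> \<zeta> \<and> \<bar>f x - f y\<bar> \<le> \<zeta> \<and> \<bar>g x - g y\<bar> \<le> \<zeta>"
      using uniform_smallness[OF \<zeta>(1)] by blast
    \<comment> \<open>Three smallness demands: length at most \<open>1\<close>,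
      \<open>\<omega>\<close> at most \<open>1\<close>, and oscillation of \<open>u\<close>,
      \<open>f\<close> and \<open>g\<close> at most an eighth of the gap between the
      obstacles.\<close>
    define l0 where "l0 = min 1 (min e l1)"
    have l0: "l0 > 0" "l0 \<le> 1" "l0 \<le> e" "l0 \<le> l1" using e(1) l1(1) by (auto simp: l0_def)
    have step: "\<bar>slope u x y - slope u c d\<bar> \<le> \<eta> (d - c)"
      if cd: "a \<le> c" "c < d" "d \<le> b" "d - c \<le> l0" "\<bar>slope u c d\<bar> \<le> M"
        and xy: "c \<le> x" "x < y" "y \<le> d" "(d - c) / 2 \<le> y - x" for c d x y
    proof -
      define h where "h = (if u c \<le> (f c + g c) / 2 then f else g)"
      define p where "p = slope u c d"
      define w where "w x = u c + p * (x - c) + (h x - h c - slope h c d * (x - c))" for x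
      define w' where "w' x = p + (derivI a b h x - slope h c d)" for x
      have h: "h = f \<or> h = g" by (simp add: h_def)
      then have hC1: "C1_on a b h" using f_C1 g_C1 by auto
      \<comment> \<open>\<open>side\<close> is decided by the equation \<open>h = f\<close>, so the
        obstacles have to differ as functions for the choice of \<open>h\<close> to determine the
        branch.\<close>
      have fg: "f \<noteq> g" using f_less_g[of a] ab by auto
      have var: "\<bar>u x - u y\<bar> \<le> \<zeta> \<and> \<bar>f x - f y\<bar> \<le> \<zeta> \<and> \<bar>g x - g y\<bar> \<le> \<zeta>"
        if "x \<in> {c..d}" "y \<in> {c..d}" for x y
        using that cd l0 by (intro l1(2)) auto
      have gap: "8 * \<zeta> \<le> g c - f c" using cd by (intro \<zeta>(2)) auto
      have side: "if h = f then u c \<le> (f c + g c) / 2 else (f c + g c) / 2 \<le> u c"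
        using fg by (auto simp: h_def)
      have weq: "w x = u c + slope u c d * (x - c) + (h x - h c - slope h c d * (x - c))" for x
        by (simp add: w_def p_def)
      note comp = obstacle_competitor[OF cd(1-3) h var gap side weq]
      have w': "(w has_field_derivative w' x) (at x within {c..d})" if "x \<in> {c..d}" for x
      proof -
        have "(h has_field_derivative derivI a b h x) (at x within {c..d})"
          by (rule DERIV_subset[OF C1_on_derivI[OF hC1]]) (use that cd in auto)
        then show ?thesis unfolding w_def[abs_def] w'_def
          by (auto intro!: derivative_eq_intros)
      qed
      have ch: "continuous_on {c..d} (derivI a b h)"
        using hC1 cd unfolding C1_on_def by (auto elim: continuous_on_subset)
      have cw': "continuous_on {c..d} w'"
        unfolding w'_def[abs_def] by (intro continuous_intros ch)
      have dc: "0 < d - c" using cd by simp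
      have close: "\<bar>w' x - slope u c d\<bar> \<le> \<omega> (d - c)" if "x \<in> {c..d}" for x
      proof -
        have "\<bar>w' x - slope u c d\<bar> \<le> modulus a b (derivI a b h) (d - c)"
          using derivI_close_to_slope[OF hC1 cd(1-3) that] by (simp add: w'_def p_def)
        also have "\<dots> \<le> \<omega> (d - c)" using h m0[OF dc] by (auto simp: \<omega>_def)
        finally show ?thesis .
      qed
      have "integral {c..d} (\<lambda>x. \<bar>derivI a b u x - slope u c d\<bar>) \<le> K * ((d - c) powr \<beta> + \<omega> (d - c)) * (d - c)"
        by (rule energy[OF cd(1-3) _ _ \<omega>0[OF dc] \<omega>1[OF dc] w' cw' comp close]) (use cd l0 in auto)
      then have E: "integral {c..d} (\<lambda>x. \<bar>derivI a b u x - p\<bar>) \<le> K * ((d - c) powr \<beta> + \<omega> (d - c)) * (d - c)"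
        by (simp add: p_def)
      have "derivI a b u absolutely_integrable_on {c..d}"
        by (rule absolutely_integrable_on_subinterval[OF u_derivI(1)]) (use cd in auto)
      then have "(\<lambda>x. derivI a b u x - p) absolutely_integrable_on {c..d}"
        by (intro set_integral_diff absolutely_integrable_on_const) auto
      then have i: "(\<lambda>x. \<bar>derivI a b u x - p\<bar>) integrable_on {c..d}"
        unfolding absolutely_integrable_on_def by simp
      have sub: "{x..y} \<subseteq> {c..d}" using xy by auto
      have I: "((\<lambda>x. derivI a b u x - p) has_integral (u y - u x - p * (y - x))) {x..y}"
        using has_integral_diff[OF derivI_u_integral has_integral_const_real[of p x y]] cd xy by (simp add: mult.commute)
      have "norm (u y - u x - p * (y - x)) \<le> integral {x..y} (\<lambda>x. \<bar>derivI a b u x - p\<bar>)"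
        unfolding integral_unique[OF I, symmetric]
        by (intro integral_norm_bound_integral integrable_subinterval_real[OF i sub]) (use I in auto)
      also have "\<dots> \<le> integral {c..d} (\<lambda>x. \<bar>derivI a b u x - p\<bar>)"
        by (intro integral_subset_le integrable_subinterval_real[OF i sub] i sub) auto
      also have "\<dots> \<le> K * ((d - c) powr \<beta> + \<omega> (d - c)) * (d - c)" by (rule E)
      also have "\<dots> \<le> K * ((d - c) powr \<beta> + \<omega> (d - c)) * (2 * (y - x))"
        using xy K \<omega>0[OF dc] by (intro mult_left_mono mult_nonneg_nonneg add_nonneg_nonneg) auto
      also have "\<dots> = \<eta> (d - c) * (y - x)" by (simp add: \<eta>_def)
      finally have "\<bar>u y - u x - p * (y - x)\<bar> \<le> \<eta> (d - c) * (y - x)" by simp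
      moreover have "u y - u x - p * (y - x) = (slope u x y - p) * (y - x)"
      proof -
        have "u y - u x = slope u x y * (y - x)" using xy by (simp add: slope_def)
        then show ?thesis by (simp only: left_diff_distrib)
      qed
      ultimately show ?thesis using xy by (simp add: abs_mult p_def)
    qed
    show ?thesis
    proof (rule exI[of _ l0], intro conjI exI[of _ \<eta>])
      show "0 < l0" by (rule l0(1))
      show "\<forall>l>0. 0 \<le> \<eta> l" using \<eta>0 by blast
      show "\<forall>c d x y. a \<le> c \<longrightarrow> c < d \<longrightarrow> d \<le> b \<longrightarrow> d - c \<le> l0 \<longrightarrow> \<bar>slope u c d\<bar> \<le> M \<longrightarrow>
          c \<le> x \<longrightarrow> x < y \<longrightarrow> y \<le> d \<longrightarrow> (d - c) / 2 \<le> y - x \<longrightarrow> \<bar>slope u x y - slope u c d\<bar> \<le> \<eta> (d - c)"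
        by (intro allI impI) (rule step)
      show "\<forall>\<delta>>0. \<exists>\<epsilon>>0. \<forall>l. 0 < l \<longrightarrow> l \<le> \<epsilon> \<longrightarrow> (\<forall>n. (\<Sum>i<n. \<eta> (l / 2^i)) \<le> \<delta>)"
        using \<eta>_sum by blast
    qed
  qed
qed

end

theorem theorem2p8:
  fixes a b A B :: real
    and L :: "real \<Rightarrow> real \<Rightarrow> real \<Rightarrow> real"
    and f g u :: "real \<Rightarrow> real"
  assumes ab: "a < b"
    and L_cont: "continuous_on ({a..b} \<times> UNIV \<times> UNIV) (\<lambda>(x, u, v). L x u v)"
    and L_holder: "\<And>G :: (real \<times> real \<times> real) set.
          compact G \<Longrightarrow> G \<subseteq> {a..b} \<times> UNIV \<times> UNIV \<Longrightarrow>
          \<exists>C>0. \<exists>\<alpha>>0. \<forall>(x1, u1, v1)\<in>G. \<forall>(x2, u2, v2)\<in>G.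
            \<bar>L x1 u1 v1 - L x2 u2 v2\<bar> \<le> C * (\<bar>x1 - x2\<bar> + \<bar>u1 - u2\<bar> + \<bar>v1 - v2\<bar>) powr \<alpha>"
    and L_vv_ex: "L_vv_exists L a b"
    and L_vv_cont: "continuous_on ({a..b} \<times> UNIV \<times> UNIV) (\<lambda>(x, u, v). L_vv L x u v)"
    and L_vv_lower: "\<exists>\<mu>>0. \<forall>x\<in>{a..b}. \<forall>u v. L_vv L x u v \<ge> \<mu>"
    and f_C1: "C1_on a b f"
    and g_C1: "C1_on a b g"
    and f_less_g: "\<forall>x\<in>{a..b}. f x < g x"
    and dini: "\<And>h \<gamma> \<theta>. h \<in> {f, derivI a b f, g, derivI a b g} \<Longrightarrow> \<gamma> > 0 \<Longrightarrow> \<theta> > 0 \<Longrightarrow>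
          dini_condition a b h \<gamma> \<theta>"
    and u_min: "is_minimizer L a b (admissible a b A B f g) u"
  shows "tonelli_partial_regularity a b u"
proof -
  obtain \<mu> where \<mu>: "\<mu> > 0" "\<forall>x\<in>{a..b}. \<forall>u v. L_vv L x u v \<ge> \<mu>" using L_vv_lower by blast
  interpret obstacle_minimizer a b A B L f g u \<mu>
    by (rule obstacle_minimizer.intro[OF ab L_cont L_holder L_vv_ex L_vv_cont \<mu>(1) _ f_C1 g_C1 _ u_min])
      (use \<mu>(2) f_less_g in simp_all)
  have dini_f: "dini_condition a b (derivI a b f) 1 1" and dini_g: "dini_condition a b (derivI a b g) 1 1"
    using dini[of "derivI a b f" 1 1] dini[of "derivI a b g" 1 1] by simp_all
  interpret slope_rigid a b u
    by (rule slope_rigid.intro[OF ab continuous_on_obstacles(3)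
          rigid_if_one_step[OF one_step_estimate[OF dini_f dini_g]]])
  show ?thesis
    by (rule tonelli_partial_regularity_if_strict_derivative[OF ab strict_derivative])
qed

end
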